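(* Let $(Q,L_d,\mathcal{D},\mathcal{D}_d)$ be a nonholonomic discrete mechanical system with symmetry group $G$, with connection $\mathcal{A}$ and affine discrete connection $\mathcal{A}_d$ on $\pi:Q\to Q/G$ as in the context. Let $(\bar{q}_0,\bar{q}_1)\in\mathcal{D}_d$ and let $(v_\cdot,r_\cdot)$ be a discrete curve in $\tilde{G}\times(Q/G)$ (with $v_k\in\tilde{G}$, $0\le k\le N-1$, $r_k\in Q/G$, $0\le k\le N$, and $p^{Q/G}(v_k)=r_k$ for all $k$) such that $\pi(\bar{q}_0)=r_0$, $\pi(\bar{q}_1)=r_1$ and $v_0=\rho(\bar{q}_0,\mathcal{A}_d(\bar{q}_0,\bar{q}_1))$. Suppose that $(v_k,r_{k+1})\in\hat{\mathcal{D}}_d$ for all $k$ and that the conditions $$\bar{\phi}|_{p_2^*\hat{\mathcal{D}}}=0\quad\text{and}\quad\bar{\psi}|_{(F_1^*\mathfrak{g}^{\mathcal{D}})/G}=0$$ hold at $(v_{k-1},r_k,v_k,r_{k+1})\in Q^{(2)}_G$ for all $1\le k\le N-1$. Define the discrete curve $q_\cdot$ in $Q$ recursively by $q_0:=\bar{q}_0$ and, writing $v_k=\rho(\tilde{q}_k,\tilde{w}_k)$, $$u_k:=l^G_{\tau(q_k,\tilde{q}_k)}(\tilde{w}_k)\in G,\qquad q_{k+1}:=\tilde{F}_1(q_k,u_k,r_{k+1}),$$ where $\tau(q,q')\in G$ is the element with $l^Q_{\tau(q,q')}(q')=q$ (this does not depend on the representatives $(\tilde{q}_k,\tilde{w}_k)$).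 Then $q_\cdot$ is a trajectory of $(Q,L_d,\mathcal{D},\mathcal{D}_d)$, its image by $\Upsilon$ is $(v_\cdot,r_\cdot)$, i.e. $\Upsilon(q_k,q_{k+1})=(v_k,r_{k+1})$ for all $k$, and $q_0=\bar{q}_0$, $q_1=\bar{q}_1$.
   Context: All manifolds and maps are smooth. $G$ is a Lie group with Lie algebra $\mathfrak{g}$ and identity $e$, acting on the left, freely and properly on a manifold $Q$ by $l^Q_g(q)$, so that the quotient map $\pi:Q\to Q/G$ is a principal bundle. Notation: $\xi_Q(q)=\frac{d}{dt}\big|_{t=0}l^Q_{\exp(t\xi)}(q)$; $l^{TQ}_g=dl^Q_g$ (lifted action); $l^{Q\times Q}_g(q_0,q_1)=(l^Q_g(q_0),l^Q_g(q_1))$ (diagonal action); $l^G_g(h)=ghg^{-1}$; $\mathcal{V}^G_q=T_q(l^Q_G(\{q\}))$; $D_j$ is differentiation with respect to the $j$-th factor of a Cartesian product; $p_j$ is the projection on the $j$-th factor. Systems. A nonholonomic discrete mechanical system is $(Q,L_d,\mathcal{D},\mathcal{D}_d)$ with $L_d:Q\times Q\to\mathbb{R}$ smooth, $\mathcal{D}$ a subbundle of $TQ$ and $\mathcal{D}_d\subset Q\times Q$ a submanifold. $G$ is a symmetry group of it if $G$ acts on the left, freely and properly on $Q$ by $l^Q$ (so that $\pi:Q\to Q/G$ is a principal bundle), $L_d$ and $\mathcal{D}_d$ are invariant under the diagonal action and $\mathcal{D}$ is invariant under the lifted action. A discrete curve is a map $q_\cdot:\{0,\dots,N\}\to Q$;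 $S_d(q_\cdot)=\sum_{k=0}^{N-1}L_d(q_k,q_{k+1})$. A trajectory of the system is a discrete curve $q_\cdot$ with $(q_k,q_{k+1})\in\mathcal{D}_d$ for all $k$ and $dS_d(q_\cdot)(\delta q_\cdot)=0$ for all variations $\delta q_\cdot$ ($\delta q_k\in T_{q_k}Q$) with $\delta q_0=0$, $\delta q_N=0$ and $\delta q_k\in\mathcal{D}_{q_k}$ for all $k$. Connection. It is assumed that $\mathcal{S}_q:=\mathcal{V}^G_q\cap\mathcal{D}_q$ has locally constant rank and that $G$-invariant subbundles $\mathcal{H},\mathcal{U},\mathcal{W}$ of $TQ$ are fixed with $\mathcal{D}=\mathcal{S}\oplus\mathcal{H}$, $\mathcal{V}^G=\mathcal{S}\oplus\mathcal{U}$, $TQ=\mathcal{W}\oplus\mathcal{U}\oplus\mathcal{S}\oplus\mathcal{H}$. $\mathcal{A}$ is the principal connection on $\pi$ with horizontal bundle $\mathcal{W}\oplus\mathcal{H}$, and $h^q:T_{\pi(q)}(Q/G)\to T_qQ$ is its horizontal lift. $\mathfrak{g}^{\mathcal{D}}=\{(q,\xi)\in Q\times\mathfrak{g}:\xi_Q(q)\in\mathcal{D}_q\}$. Affine discrete connection. Let $\gamma:Q\to G$ be smooth and $G$-equivariant for $l^Q$ and $l^G$, $\Gamma=\{(q,l^Q_{\gamma(q)}(q)):q\in Q\}$, and $Hor\subset Q\times Q$ a $G$-invariant submanifold with $\Gamma\subset Hor$; put $Hor^2(q)=p_2(Hor\cap(\{q\}\times Q))$. $Hor$ defines an affine discrete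 connection $\mathcal{A}_d$ of level $\gamma$ if for each $q\in Q$, $Hor^2(q)$ is a submanifold of $Q$ and $T_{q_1}Q=T_{q_1}(l^Q_G(\{q\}))\oplus T_{q_1}Hor^2(q)$ for all $q_1\in l^Q_G(\{q\})\cap Hor^2(q)$. Then there are a $G$-invariant open neighborhood $U$ of $\Gamma$ and an open neighborhood $\mathcal{O}$ of the diagonal in $(Q/G)\times(Q/G)$ such that for all $(q_0,q_1)\in\mathfrak{U}:=(\pi\times\pi)^{-1}(\mathcal{O})$ there is a unique $g\in G$ with $(q_0,l^Q_{g^{-1}}(q_1))\in Hor\cap U$; fix such $U,\mathcal{O}$ and set $\mathcal{A}_d(q_0,q_1):=g$ (discrete connection 1-form, smooth on $\mathfrak{U}$). For $(\pi(q_0),r_1)\in\mathcal{O}$, $\overline{h_d^{q_0}}(r_1)$ is the unique $q_1$ with $\pi(q_1)=r_1$ and $\mathcal{A}_d(q_0,q_1)=e$. Convention: the notation treats $\mathcal{A}_d$ as defined everywhere; all pairs at which $\mathcal{A}_d$ is evaluated are assumed to be in $\mathfrak{U}$, subsets of $Q\times Q$ are intersected with $\mathfrak{U}$ where needed, and $Q\times G\times(Q/G)$, $\tilde{G}\times(Q/G)$ stand for the open subsets where $(\pi(q_0),r_1)\in\mathcal{O}$. Reduced objects. $\tilde{G}=(Q\times G)/G$ for the action $g\cdot(q,w)=(l^Q_g(q),gwg^{-1})$, with quotient map $\rho:Q\times G\to\tilde{G}$ and $p^{Q/G}:\tilde{G}\to Q/G$, $p^{Q/G}(\rho(q,w))=\pi(q)$.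 $\Upsilon:Q\times Q\to\tilde{G}\times(Q/G)$, $\Upsilon(q_0,q_1)=(\rho(q_0,\mathcal{A}_d(q_0,q_1)),\pi(q_1))$, induces $\Phi_{\mathcal{A}_d}:(Q\times Q)/G\to\tilde{G}\times(Q/G)$. $\tilde{F}_1(q_0,w_0,r_1)=l^Q_{w_0}(\overline{h_d^{q_0}}(r_1))$; $\check{L}_d(q_0,w_0,r_1)=L_d(q_0,\tilde{F}_1(q_0,w_0,r_1))$; $\hat{\mathcal{D}}_d=\Phi_{\mathcal{A}_d}(\mathcal{D}_d/G)$; $\hat{\mathcal{D}}\subset T(Q/G)$ has fibers $\hat{\mathcal{D}}_{\pi(q)}=d\pi(q)(\mathcal{D}_q)$. The reduced discrete forces are, for $v_0=\rho(q_0,w_0)$ and $q_1=\tilde{F}_1(q_0,w_0,r_1)$, $\hat{F}_d^+(v_0,r_1)(\delta r_1)=D_2\check{L}_d(q_0,w_0,r_1)\,D_2\mathcal{A}_d(q_0,q_1)(h^{q_1}(\delta r_1))$ and $\hat{F}_d^-(v_0,r_1)(\delta r_0)=D_2\check{L}_d(q_0,w_0,r_1)\,D_1\mathcal{A}_d(q_0,q_1)(h^{q_0}(\delta r_0))$ (independent of the representative $(q_0,w_0)$). For $\alpha\in T^*_wG$, $\alpha w^{-1}\in\mathfrak{g}^*$ is the right translate: $(\alpha w^{-1})(\xi)=\alpha(dR_w(e)(\xi))$, $R_w$ being right multiplication by $w$. Intrinsic conditions. $Q^{(2)}_G=\{(v_0,r_1,v_1,r_2): (v_0,r_1),(v_1,r_2)\in\tilde{G}\times(Q/G),\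 p^{Q/G}(v_1)=r_1\}$, which is the quotient by $G$ of $\check{Q}^{(2)}_G=\{(q_0,w_0,r_1,v_1,r_2): p^{Q/G}(v_1)=r_1\}$ with action $g\cdot(q_0,w_0,r_1,v_1,r_2)=(l^Q_g(q_0),l^G_g(w_0),r_1,v_1,r_2)$. For $(q_0,w_0,r_1,v_1,r_2)\in\check{Q}^{(2)}_G$ let $q_1=F_1(q_0,w_0,r_1,v_1,r_2):=\tilde{F}_1(q_0,w_0,r_1)$, and let $w_1\in G$ be the unique element with $\rho(q_1,w_1)=v_1$. Then $\bar{\phi}:p_2^*T(Q/G)\to\mathbb{R}$ (bundle over $Q^{(2)}_G$, $p_2(v_0,r_1,v_1,r_2)=r_1$) and $\bar{\psi}:(\check{Q}^{(2)}_G\times\mathfrak{g})/G\to\mathbb{R}$ ($G$ acting on $\mathfrak{g}$ by the adjoint action) are the well-defined fiberwise linear maps given, for any $(q_0,w_0)\in\rho^{-1}(v_0)$, by $\bar{\phi}(v_0,r_1,v_1,r_2,\delta r_1)=\big(D_1\check{L}_d(q_1,w_1,r_2)\circ h^{q_1}+D_3\check{L}_d(q_0,w_0,r_1)+\hat{F}_d^-(v_1,r_2)+\hat{F}_d^+(v_0,r_1)\big)(\delta r_1)$ and $\bar{\psi}([(q_0,w_0,r_1,v_1,r_2,\xi_1)])=\big(D_2\check{L}_d(q_0,w_0,r_1)w_0^{-1}-D_2\check{L}_d(q_1,w_1,r_2)w_1^{-1}\big)(\xi_1)$. The first condition at a point says $\bar{\phi}(v_0,r_1,v_1,r_2,\delta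 r_1)=0$ for all $\delta r_1\in\hat{\mathcal{D}}_{r_1}$; the second says $\bar{\psi}([(q_0,w_0,r_1,v_1,r_2,\xi_1)])=0$ whenever $(q_1,\xi_1)\in\mathfrak{g}^{\mathcal{D}}$. *)

theory Defs
  imports "HOL-Analysis.Analysis" "HOL-Algebra.Group_Action"
begin

section \<open>Smooth manifolds\<close>

text \<open>
  A chart is a pair of a domain and a coordinate map, and a manifold is given by an atlas.  The
  model spaces are finite-dimensional normed spaces rather than members of the class
  \<open>euclidean_space\<close>, because the latter excludes dimension \<open>0\<close> (needed for discrete \<open>G\<close>, and for
  \<open>Q/G\<close> when \<open>G\<close> acts transitively).  The point sets are carriers inside a type, so that orbit
  spaces can be carriers of manifolds.
\<close>

type_synonym ('a, 'e) chart = "'a set \<times> ('a \<Rightarrow> 'e)"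
type_synonym ('a, 'e) atlas = "('a, 'e) chart set"

text \<open>Class \<open>C\<^sup>n\<close> on an open set of a finite-dimensional space, through iterated directional
  derivatives.\<close>

primrec Ck_on :: "nat \<Rightarrow> ('a::real_normed_vector \<Rightarrow> 'b::real_normed_vector) \<Rightarrow> 'a set \<Rightarrow> bool" where
  "Ck_on 0 f S \<longleftrightarrow> continuous_on S f"
| "Ck_on (Suc n) f S \<longleftrightarrow> (\<forall>x\<in>S. f differentiable (at x)) \<and>
     (\<forall>v. Ck_on n (\<lambda>x. frechet_derivative f (at x) v) S)"

definition smooth_on :: "('a::real_normed_vector \<Rightarrow> 'b::real_normed_vector) \<Rightarrow> 'a set \<Rightarrow> bool" where
  "smooth_on f S \<longleftrightarrow> open S \<and> (\<forall>n. Ck_on n f S)"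

definition chart_inv :: "('a, 'e) chart \<Rightarrow> 'e \<Rightarrow> 'a" where
  "chart_inv c = inv_into (fst c) (snd c)"

definition is_chart :: "('a, 'e::real_normed_vector) chart \<Rightarrow> bool" where
  "is_chart c \<longleftrightarrow> inj_on (snd c) (fst c) \<and> open (snd c ` fst c)"

definition smooth_transition :: "('a, 'e::real_normed_vector) chart \<Rightarrow> ('a, 'e) chart \<Rightarrow> bool" where
  "smooth_transition c c' \<longleftrightarrow> smooth_on (snd c' \<circ> chart_inv c) (snd c ` (fst c \<inter> fst c'))"

definition mcarrier :: "('a, 'e) atlas \<Rightarrow> 'a set" where
  "mcarrier M = \<Union> (fst ` M)"

definition mtop :: "('a, 'e::real_normed_vector) atlas \<Rightarrow> 'a topology" where
  "mtop M = topology (\<lambda>W. W \<subseteq> mcarrier M \<and> (\<forall>c\<in>M. open (snd c ` (W \<inter> fst c))))"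

definition smooth_manifold :: "('a, 'e::real_normed_vector) atlas \<Rightarrow> bool" where
  "smooth_manifold M \<longleftrightarrow>
     (\<exists>B::'e set. finite B \<and> span B = UNIV) \<and>
     (\<forall>c\<in>M. is_chart c) \<and> (\<forall>c\<in>M. \<forall>c'\<in>M. smooth_transition c c') \<and>
     Hausdorff_space (mtop M) \<and> second_countable (mtop M)"

definition maximal_atlas :: "('a, 'e::real_normed_vector) atlas \<Rightarrow> ('a, 'e) atlas" where
  "maximal_atlas M = {c. is_chart c \<and> fst c \<subseteq> mcarrier M \<and>
     (\<forall>c'\<in>M. smooth_transition c c' \<and> smooth_transition c' c)}"

definition prod_mfd ::
  "('a, 'e::real_normed_vector) atlas \<Rightarrow> ('b, 'f::real_normed_vector) atlas \<Rightarrow> ('a \<times> 'b, 'e \<times> 'f) atlas" where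
  "prod_mfd M M' = {(fst c \<times> fst c', map_prod (snd c) (snd c')) | c c'. c \<in> M \<and> c' \<in> M'}"

definition real_mfd :: "(real, real) atlas" where
  "real_mfd = {(UNIV, \<lambda>x. x)}"

text \<open>Smooth maps defined on an open subset \<open>W\<close> of \<open>M\<close>; continuity is contained in the openness
  of the coordinate domains, which is part of \<open>smooth_on\<close>.\<close>

definition smooth_map_on ::
  "('a, 'e::real_normed_vector) atlas \<Rightarrow> ('b, 'f::real_normed_vector) atlas \<Rightarrow> 'a set \<Rightarrow> ('a \<Rightarrow> 'b) \<Rightarrow> bool" where
  "smooth_map_on M M' W f \<longleftrightarrow> openin (mtop M) W \<and> f ` W \<subseteq> mcarrier M' \<and>
     (\<forall>c\<in>M. \<forall>c'\<in>M'. smooth_on (snd c' \<circ> f \<circ> chart_inv c) (snd c ` {x \<in> fst c \<inter> W. f x \<in> fst c'}))"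

abbreviation smooth_map where
  "smooth_map M M' \<equiv> smooth_map_on M M' (mcarrier M)"

subsection \<open>Tangent spaces\<close>

text \<open>
  A tangent vector at \<open>x\<close> is represented by its components in one fixed chart \<open>chart_at M x\<close> of
  the atlas around \<open>x\<close>.  Thus every \<open>T\<^sub>xM\<close> is a copy of the model space, and the derivative of a
  map at \<open>x\<close> is its coordinate derivative in the fixed charts at \<open>x\<close> and \<open>f x\<close>.
\<close>

definition chart_at :: "('a, 'e) atlas \<Rightarrow> 'a \<Rightarrow> ('a, 'e) chart" where
  "chart_at M x = (SOME c. c \<in> M \<and> x \<in> fst c)"

definition mfderiv ::
  "('a, 'e::real_normed_vector) atlas \<Rightarrow> ('b, 'f::real_normed_vector) atlas \<Rightarrow> ('a \<Rightarrow> 'b) \<Rightarrow> 'a \<Rightarrow> 'e \<Rightarrow> 'f" where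
  "mfderiv M M' f x =
     frechet_derivative (snd (chart_at M' (f x)) \<circ> f \<circ> chart_inv (chart_at M x)) (at (snd (chart_at M x) x))"

definition velocity :: "('a, 'e::real_normed_vector) atlas \<Rightarrow> (real \<Rightarrow> 'a) \<Rightarrow> 'e" where
  "velocity M c = mfderiv real_mfd M c 0 1"

text \<open>Components in an arbitrary chart \<open>c\<close> of the tangent vector \<open>v\<close> at \<open>x\<close>.\<close>

definition tangent_coord :: "('a, 'e::real_normed_vector) atlas \<Rightarrow> ('a, 'e) chart \<Rightarrow> 'a \<Rightarrow> 'e \<Rightarrow> 'e" where
  "tangent_coord M c x = frechet_derivative (snd c \<circ> chart_inv (chart_at M x)) (at (snd (chart_at M x) x))"

definition smooth_vector_field_on ::
  "('a, 'e::real_normed_vector) atlas \<Rightarrow> 'a set \<Rightarrow> ('a \<Rightarrow> 'e) \<Rightarrow> bool" where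
  "smooth_vector_field_on M W Z \<longleftrightarrow> openin (mtop M) W \<and>
     (\<forall>c\<in>M. smooth_on (\<lambda>z. tangent_coord M c (chart_inv c z) (Z (chart_inv c z))) (snd c ` (fst c \<inter> W)))"

definition smooth_subbundle :: "('a, 'e::real_normed_vector) atlas \<Rightarrow> ('a \<Rightarrow> 'e set) \<Rightarrow> bool" where
  "smooth_subbundle M E \<longleftrightarrow> (\<forall>x\<in>mcarrier M. \<exists>W (n::nat) Z. x \<in> W \<and> openin (mtop M) W \<and>
     (\<forall>i<n. smooth_vector_field_on M W (Z i)) \<and>
     (\<forall>y\<in>W. inj_on (\<lambda>i. Z i y) {..<n} \<and> independent ((\<lambda>i. Z i y) ` {..<n}) \<and>
            E y = span ((\<lambda>i. Z i y) ` {..<n})))"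

text \<open>Embedded submanifolds, by slice charts.\<close>

definition submanifold :: "('a, 'e::real_normed_vector) atlas \<Rightarrow> 'a set \<Rightarrow> bool" where
  "submanifold M S \<longleftrightarrow> S \<subseteq> mcarrier M \<and>
     (\<forall>x\<in>S. \<exists>c\<in>maximal_atlas M. \<exists>E. x \<in> fst c \<and> subspace E \<and>
        snd c ` (fst c \<inter> S) = snd c ` fst c \<inter> E)"

text \<open>\<open>T\<^sub>xS\<close> for a submanifold \<open>S\<close>, as the velocities of the smooth curves in \<open>S\<close> through \<open>x\<close>.\<close>

definition tangent_space :: "('a, 'e::real_normed_vector) atlas \<Rightarrow> 'a set \<Rightarrow> 'a \<Rightarrow> 'e set" where
  "tangent_space M S x = {velocity M c | c. c 0 = x \<and>
     (\<exists>\<epsilon>>0. smooth_map_on real_mfd M {-\<epsilon><..<\<epsilon>} c \<and> c ` {-\<epsilon><..<\<epsilon>} \<subseteq> S)}"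

text \<open>Internal direct sum: addition is a bijection from the product of the subspaces onto \<open>V\<close>.\<close>

definition direct_sum :: "'e::real_vector set \<Rightarrow> 'e set list \<Rightarrow> bool" where
  "direct_sum V Es \<longleftrightarrow> bij_betw sum_list (listset Es) V"


section \<open>Nonholonomic discrete mechanical systems\<close>

record ('q, 'e) nh_system =
  Qm :: "('q, 'e) atlas"
  Ld :: "'q \<times> 'q \<Rightarrow> real"
  Dc :: "'q \<Rightarrow> 'e set"
  Dd :: "('q \<times> 'q) set"

abbreviation Qset :: "('q, 'e, 'z) nh_system_scheme \<Rightarrow> 'q set" where
  "Qset X \<equiv> mcarrier (Qm X)"

definition nonholonomic_system :: "('q, 'e::real_normed_vector, 'z) nh_system_scheme \<Rightarrow> bool" where
  "nonholonomic_system X \<longleftrightarrow> smooth_manifold (Qm X) \<and>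
     smooth_map (prod_mfd (Qm X) (Qm X)) real_mfd (Ld X) \<and>
     smooth_subbundle (Qm X) (Dc X) \<and>
     submanifold (prod_mfd (Qm X) (Qm X)) (Dd X)"

definition discrete_action :: "('q, 'e, 'z) nh_system_scheme \<Rightarrow> nat \<Rightarrow> (nat \<Rightarrow> 'q) \<Rightarrow> real" where
  "discrete_action X N q = (\<Sum>k<N. Ld X (q k, q (Suc k)))"

text \<open>
  The differential of \<open>discrete_action X N\<close>, a function on \<open>Q\<^sup>N\<^sup>+\<^sup>1\<close>, at \<open>q\<close> and applied to the
  tangent vector \<open>\<delta> = (\<delta>\<^sub>0, \<dots>, \<delta>\<^sub>N)\<close>: the coordinate derivative in the direction \<open>\<delta>\<close>, in the
  product of the charts \<open>chart_at (Qm X) (q k)\<close>.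
\<close>

definition d_discrete_action ::
  "('q, 'e::real_normed_vector, 'z) nh_system_scheme \<Rightarrow> nat \<Rightarrow> (nat \<Rightarrow> 'q) \<Rightarrow> (nat \<Rightarrow> 'e) \<Rightarrow> real" where
  "d_discrete_action X N q \<delta> = deriv (\<lambda>s. discrete_action X N
     (\<lambda>k. chart_inv (chart_at (Qm X) (q k)) (snd (chart_at (Qm X) (q k)) (q k) + s *\<^sub>R \<delta> k))) 0"

definition trajectory :: "('q, 'e::real_normed_vector, 'z) nh_system_scheme \<Rightarrow> nat \<Rightarrow> (nat \<Rightarrow> 'q) \<Rightarrow> bool" where
  "trajectory X N q \<longleftrightarrow> (\<forall>k\<le>N. q k \<in> Qset X) \<and> (\<forall>k<N. (q k, q (Suc k)) \<in> Dd X) \<and>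
     (\<forall>\<delta>. \<delta> 0 = 0 \<and> \<delta> N = 0 \<and> (\<forall>k\<le>N. \<delta> k \<in> Dc X (q k)) \<longrightarrow> d_discrete_action X N q \<delta> = 0)"


section \<open>Symmetry groups\<close>

text \<open>
  \<open>Gexp\<close> is the exponential map, and \<open>Bm\<close> the smooth structure on the set \<open>Q/G\<close> of orbits; the
  predicates below determine both uniquely.  The Lie algebra is the tangent space of \<open>Gm\<close> at the
  identity, i.e. the type \<open>'f\<close>.
\<close>

record ('q, 'e, 'g, 'f, 'b) sym_system = "('q, 'e) nh_system" +
  Grp :: "'g monoid"
  Gm :: "('g, 'f) atlas"
  Gexp :: "'f \<Rightarrow> 'g"
  act :: "'g \<Rightarrow> 'q \<Rightarrow> 'q"
  Bm :: "('q set, 'b) atlas"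

definition lie_group :: "'g monoid \<Rightarrow> ('g, 'f::real_normed_vector) atlas \<Rightarrow> bool" where
  "lie_group G M \<longleftrightarrow> group G \<and> smooth_manifold M \<and> mcarrier M = carrier G \<and>
     smooth_map (prod_mfd M M) M (\<lambda>(g, h). g \<otimes>\<^bsub>G\<^esub> h) \<and> smooth_map M M (\<lambda>g. inv\<^bsub>G\<^esub> g)"

text \<open>For each \<open>\<xi>\<close>, \<open>t \<mapsto> exp (t \<xi>)\<close> is the one-parameter subgroup with initial velocity \<open>\<xi>\<close>.\<close>

definition exponential_map :: "'g monoid \<Rightarrow> ('g, 'f::real_normed_vector) atlas \<Rightarrow> ('f \<Rightarrow> 'g) \<Rightarrow> bool" where
  "exponential_map G M e \<longleftrightarrow> (\<forall>\<xi>. smooth_map real_mfd M (\<lambda>t. e (t *\<^sub>R \<xi>)) \<and>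
     (\<forall>s t. e ((s + t) *\<^sub>R \<xi>) = e (s *\<^sub>R \<xi>) \<otimes>\<^bsub>G\<^esub> e (t *\<^sub>R \<xi>)) \<and>
     velocity M (\<lambda>t. e (t *\<^sub>R \<xi>)) = \<xi>)"

text \<open>
  \<open>principal_bundle\<close>: \<open>B\<close> is a manifold structure on the orbit space for which the orbit map is a
  principal bundle.  By freeness and properness it exists, and it is the unique structure making
  the orbit map a submersion.  In the local trivializations \<open>\<pi>\<^sup>-\<^sup>1(V) \<cong> V \<times> G\<close>, \<open>j\<close> is the
  \<open>G\<close>-component and \<open>i\<close> is the inverse.
\<close>

definition principal_bundle ::
  "('q, 'e::real_normed_vector) atlas \<Rightarrow> 'g monoid \<Rightarrow> ('g, 'f::real_normed_vector) atlas \<Rightarrow>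
   ('g \<Rightarrow> 'q \<Rightarrow> 'q) \<Rightarrow> ('q set, 'b::real_normed_vector) atlas \<Rightarrow> bool" where
  "principal_bundle M G GM l B \<longleftrightarrow> smooth_manifold B \<and>
     mcarrier B = orbits G (mcarrier M) l \<and> smooth_map M B (orbit G l) \<and>
     (\<forall>r\<in>mcarrier B. \<exists>V j i. r \<in> V \<and> openin (mtop B) V \<and>
        smooth_map_on M GM {q \<in> mcarrier M. orbit G l q \<in> V} j \<and>
        smooth_map_on (prod_mfd B GM) M (V \<times> carrier G) i \<and>
        (\<forall>q\<in>mcarrier M. orbit G l q \<in> V \<longrightarrow> i (orbit G l q, j q) = q \<and>
           (\<forall>g\<in>carrier G. j (l g q) = g \<otimes>\<^bsub>G\<^esub> j q)) \<and>
        (\<forall>s\<in>V. \<forall>g\<in>carrier G. orbit G l (i (s, g)) = s \<and> j (i (s, g)) = g))"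

definition symmetry_group ::
  "('q, 'e::real_normed_vector, 'g, 'f::real_normed_vector, 'b::real_normed_vector, 'z) sym_system_scheme \<Rightarrow> bool" where
  "symmetry_group X \<longleftrightarrow>
     lie_group (Grp X) (Gm X) \<and> exponential_map (Grp X) (Gm X) (Gexp X) \<and>
     \<comment> \<open>smooth, free and proper left action\<close>
     group_action (Grp X) (Qset X) (act X) \<and>
     smooth_map (prod_mfd (Gm X) (Qm X)) (Qm X) (\<lambda>(g, q). act X g q) \<and>
     (\<forall>g\<in>carrier (Grp X). \<forall>q\<in>Qset X. act X g q = q \<longrightarrow> g = \<one>\<^bsub>Grp X\<^esub>) \<and>
     proper_map (prod_topology (mtop (Gm X)) (mtop (Qm X))) (prod_topology (mtop (Qm X)) (mtop (Qm X)))
       (\<lambda>(g, q). (q, act X g q)) \<and>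
     principal_bundle (Qm X) (Grp X) (Gm X) (act X) (Bm X) \<and>
     \<comment> \<open>invariance of the data\<close>
     (\<forall>g\<in>carrier (Grp X). \<forall>q0\<in>Qset X. \<forall>q1\<in>Qset X. Ld X (act X g q0, act X g q1) = Ld X (q0, q1)) \<and>
     (\<forall>g\<in>carrier (Grp X). \<forall>(q0, q1)\<in>Dd X. (act X g q0, act X g q1) \<in> Dd X) \<and>
     (\<forall>g\<in>carrier (Grp X). \<forall>q\<in>Qset X. mfderiv (Qm X) (Qm X) (act X g) q ` Dc X q = Dc X (act X g q))"

definition proj :: "('q, 'e, 'g, 'f, 'b, 'z) sym_system_scheme \<Rightarrow> 'q \<Rightarrow> 'q set" where
  "proj X q = orbit (Grp X) (act X) q"

definition Gconj :: "('q, 'e, 'g, 'f, 'b, 'z) sym_system_scheme \<Rightarrow> 'g \<Rightarrow> 'g \<Rightarrow> 'g" where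
  "Gconj X g w = g \<otimes>\<^bsub>Grp X\<^esub> w \<otimes>\<^bsub>Grp X\<^esub> inv\<^bsub>Grp X\<^esub> g"

definition Adj :: "('q, 'e, 'g, 'f::real_normed_vector, 'b, 'z) sym_system_scheme \<Rightarrow> 'g \<Rightarrow> 'f \<Rightarrow> 'f" where
  "Adj X g = mfderiv (Gm X) (Gm X) (Gconj X g) \<one>\<^bsub>Grp X\<^esub>"

definition diag_act :: "('q, 'e, 'g, 'f, 'b, 'z) sym_system_scheme \<Rightarrow> 'g \<Rightarrow> 'q \<times> 'q \<Rightarrow> 'q \<times> 'q" where
  "diag_act X g = (\<lambda>(q0, q1). (act X g q0, act X g q1))"

definition inf_gen ::
  "('q, 'e::real_normed_vector, 'g, 'f::real_normed_vector, 'b, 'z) sym_system_scheme \<Rightarrow> 'f \<Rightarrow> 'q \<Rightarrow> 'e" where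
  "inf_gen X \<xi> q = velocity (Qm X) (\<lambda>t. act X (Gexp X (t *\<^sub>R \<xi>)) q)"

definition gD ::
  "('q, 'e::real_normed_vector, 'g, 'f::real_normed_vector, 'b, 'z) sym_system_scheme \<Rightarrow> ('q \<times> 'f) set" where
  "gD X = {(q, \<xi>). q \<in> Qset X \<and> inf_gen X \<xi> q \<in> Dc X q}"

definition vertical ::
  "('q, 'e::real_normed_vector, 'g, 'f, 'b, 'z) sym_system_scheme \<Rightarrow> 'q \<Rightarrow> 'e set" where
  "vertical X q = tangent_space (Qm X) (orbit (Grp X) (act X) q) q"

definition dproj ::
  "('q, 'e::real_normed_vector, 'g, 'f, 'b::real_normed_vector, 'z) sym_system_scheme \<Rightarrow> 'q \<Rightarrow> 'e \<Rightarrow> 'b" where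
  "dproj X = mfderiv (Qm X) (Bm X) (proj X)"


section \<open>Connection and affine discrete connection\<close>

record ('q, 'e, 'g, 'f, 'b) conn_system = "('q, 'e, 'g, 'f, 'b) sym_system" +
  Hb :: "'q \<Rightarrow> 'e set"
  Ub :: "'q \<Rightarrow> 'e set"
  Wb :: "'q \<Rightarrow> 'e set"
  gam :: "'q \<Rightarrow> 'g"
  Hor :: "('q \<times> 'q) set"
  Unb :: "('q \<times> 'q) set"
  Onb :: "('q set \<times> 'q set) set"

definition Sb :: "('q, 'e::real_normed_vector, 'g, 'f, 'b, 'z) conn_system_scheme \<Rightarrow> 'q \<Rightarrow> 'e set" where
  "Sb X q = vertical X q \<inter> Dc X q"

definition invariant_subbundle ::
  "('q, 'e::real_normed_vector, 'g, 'f, 'b, 'z) conn_system_scheme \<Rightarrow> ('q \<Rightarrow> 'e set) \<Rightarrow> bool" where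
  "invariant_subbundle X E \<longleftrightarrow> smooth_subbundle (Qm X) E \<and>
     (\<forall>g\<in>carrier (Grp X). \<forall>q\<in>Qset X. mfderiv (Qm X) (Qm X) (act X g) q ` E q = E (act X g q))"

definition connection_data ::
  "('q, 'e::real_normed_vector, 'g, 'f, 'b, 'z) conn_system_scheme \<Rightarrow> bool" where
  "connection_data X \<longleftrightarrow>
     (\<forall>q\<in>Qset X. \<exists>V. q \<in> V \<and> openin (mtop (Qm X)) V \<and> (\<forall>q'\<in>V. dim (Sb X q') = dim (Sb X q))) \<and>
     invariant_subbundle X (Hb X) \<and> invariant_subbundle X (Ub X) \<and> invariant_subbundle X (Wb X) \<and>
     (\<forall>q\<in>Qset X. direct_sum (Dc X q) [Sb X q, Hb X q] \<and>
        direct_sum (vertical X q) [Sb X q, Ub X q] \<and>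
        direct_sum UNIV [Wb X q, Ub X q, Sb X q, Hb X q])"

text \<open>The horizontal lift of the connection with horizontal bundle \<open>\<W> \<oplus> \<H>\<close>.\<close>

definition hlift ::
  "('q, 'e::real_normed_vector, 'g, 'f, 'b::real_normed_vector, 'z) conn_system_scheme \<Rightarrow> 'q \<Rightarrow> 'b \<Rightarrow> 'e" where
  "hlift X q dr = (THE v. v \<in> {a + b | a b. a \<in> Wb X q \<and> b \<in> Hb X q} \<and> dproj X q v = dr)"

definition Hor2 :: "('q, 'e, 'g, 'f, 'b, 'z) conn_system_scheme \<Rightarrow> 'q \<Rightarrow> 'q set" where
  "Hor2 X q = snd ` (Hor X \<inter> ({q} \<times> Qset X))"

definition Gam :: "('q, 'e, 'g, 'f, 'b, 'z) conn_system_scheme \<Rightarrow> ('q \<times> 'q) set" where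
  "Gam X = {(q, act X (gam X q) q) | q. q \<in> Qset X}"

definition frakU :: "('q, 'e, 'g, 'f, 'b, 'z) conn_system_scheme \<Rightarrow> ('q \<times> 'q) set" where
  "frakU X = {(q0, q1) \<in> Qset X \<times> Qset X. (proj X q0, proj X q1) \<in> Onb X}"

definition Adisc :: "('q, 'e, 'g, 'f, 'b, 'z) conn_system_scheme \<Rightarrow> 'q \<Rightarrow> 'q \<Rightarrow> 'g" where
  "Adisc X q0 q1 = (THE g. g \<in> carrier (Grp X) \<and> (q0, act X (inv\<^bsub>Grp X\<^esub> g) q1) \<in> Hor X \<inter> Unb X)"

text \<open>
  Besides the definition of an affine discrete connection of level \<open>gam X\<close>, the following predicate
  contains the requirements on the fixed neighborhoods \<open>Unb X\<close> of \<open>\<Gamma>\<close> and \<open>Onb X\<close> of the diagonal: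
  unique existence of \<open>\<A>\<^sub>d(q\<^sub>0, q\<^sub>1)\<close>, and smoothness of \<open>\<A>\<^sub>d\<close>, on \<open>\<UU> = (\<pi> \<times> \<pi>)\<^sup>-\<^sup>1(\<O>)\<close>.
\<close>

definition affine_discrete_connection ::
  "('q, 'e::real_normed_vector, 'g, 'f::real_normed_vector, 'b::real_normed_vector, 'z) conn_system_scheme \<Rightarrow> bool" where
  "affine_discrete_connection X \<longleftrightarrow>
     smooth_map (Qm X) (Gm X) (gam X) \<and>
     (\<forall>g\<in>carrier (Grp X). \<forall>q\<in>Qset X. gam X (act X g q) = Gconj X g (gam X q)) \<and>
     submanifold (prod_mfd (Qm X) (Qm X)) (Hor X) \<and>
     (\<forall>g\<in>carrier (Grp X). diag_act X g ` Hor X \<subseteq> Hor X) \<and>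
     Gam X \<subseteq> Hor X \<and>
     (\<forall>q\<in>Qset X. submanifold (Qm X) (Hor2 X q) \<and>
        (\<forall>q1 \<in> orbit (Grp X) (act X) q \<inter> Hor2 X q.
           direct_sum UNIV [tangent_space (Qm X) (orbit (Grp X) (act X) q) q1,
                            tangent_space (Qm X) (Hor2 X q) q1])) \<and>
     openin (mtop (prod_mfd (Qm X) (Qm X))) (Unb X) \<and> Gam X \<subseteq> Unb X \<and>
     (\<forall>g\<in>carrier (Grp X). diag_act X g ` Unb X \<subseteq> Unb X) \<and>
     openin (mtop (prod_mfd (Bm X) (Bm X))) (Onb X) \<and> (\<forall>r\<in>mcarrier (Bm X). (r, r) \<in> Onb X) \<and>
     (\<forall>(q0, q1)\<in>frakU X. \<exists>!g. g \<in> carrier (Grp X) \<and>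
        (q0, act X (inv\<^bsub>Grp X\<^esub> g) q1) \<in> Hor X \<inter> Unb X) \<and>
     smooth_map_on (prod_mfd (Qm X) (Qm X)) (Gm X) (frakU X) (\<lambda>(q0, q1). Adisc X q0 q1)"

definition hd_bar :: "('q, 'e, 'g, 'f, 'b, 'z) conn_system_scheme \<Rightarrow> 'q \<Rightarrow> 'q set \<Rightarrow> 'q" where
  "hd_bar X q0 r1 = (THE q1. q1 \<in> Qset X \<and> proj X q1 = r1 \<and> Adisc X q0 q1 = \<one>\<^bsub>Grp X\<^esub>)"


section \<open>Reduced objects\<close>

text \<open>
  Quotients are sets of orbits, so a point of \<open>G~ = (Q \<times> G)/G\<close> is its own preimage under \<open>\<rho>\<close>.
  A map induced on a quotient by an invariant map is obtained by \<^const>\<open>the_elem\<close> from the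
  (one-element) image of the orbit.
\<close>

definition QG_act :: "('q, 'e, 'g, 'f, 'b, 'z) sym_system_scheme \<Rightarrow> 'g \<Rightarrow> 'q \<times> 'g \<Rightarrow> 'q \<times> 'g" where
  "QG_act X g = (\<lambda>(q, w). (act X g q, Gconj X g w))"

definition rho :: "('q, 'e, 'g, 'f, 'b, 'z) sym_system_scheme \<Rightarrow> 'q \<Rightarrow> 'g \<Rightarrow> ('q \<times> 'g) set" where
  "rho X q w = orbit (Grp X) (QG_act X) (q, w)"

definition Gtilde :: "('q, 'e, 'g, 'f, 'b, 'z) sym_system_scheme \<Rightarrow> ('q \<times> 'g) set set" where
  "Gtilde X = orbits (Grp X) (Qset X \<times> carrier (Grp X)) (QG_act X)"

definition pQG :: "('q, 'e, 'g, 'f, 'b, 'z) sym_system_scheme \<Rightarrow> ('q \<times> 'g) set \<Rightarrow> 'q set" where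
  "pQG X v = the_elem ((\<lambda>(q, w). proj X q) ` v)"

definition Upsilon :: "('q, 'e, 'g, 'f, 'b, 'z) conn_system_scheme \<Rightarrow> 'q \<times> 'q \<Rightarrow> ('q \<times> 'g) set \<times> 'q set" where
  "Upsilon X = (\<lambda>(q0, q1). (rho X q0 (Adisc X q0 q1), proj X q1))"

definition Phi_A :: "('q, 'e, 'g, 'f, 'b, 'z) conn_system_scheme \<Rightarrow> ('q \<times> 'q) set \<Rightarrow> ('q \<times> 'g) set \<times> 'q set" where
  "Phi_A X z = the_elem (Upsilon X ` z)"

definition Dd_hat :: "('q, 'e, 'g, 'f, 'b, 'z) conn_system_scheme \<Rightarrow> (('q \<times> 'g) set \<times> 'q set) set" where
  "Dd_hat X = Phi_A X ` orbits (Grp X) (Dd X \<inter> frakU X) (diag_act X)"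

definition Dc_hat ::
  "('q, 'e::real_normed_vector, 'g, 'f, 'b::real_normed_vector, 'z) sym_system_scheme \<Rightarrow> 'q set \<Rightarrow> 'b set" where
  "Dc_hat X r = the_elem ((\<lambda>q. dproj X q ` Dc X q) ` r)"

definition F1_tilde :: "('q, 'e, 'g, 'f, 'b, 'z) conn_system_scheme \<Rightarrow> 'q \<Rightarrow> 'g \<Rightarrow> 'q set \<Rightarrow> 'q" where
  "F1_tilde X q0 w0 r1 = act X w0 (hd_bar X q0 r1)"

definition L_check :: "('q, 'e, 'g, 'f, 'b, 'z) conn_system_scheme \<Rightarrow> 'q \<Rightarrow> 'g \<Rightarrow> 'q set \<Rightarrow> real" where
  "L_check X q0 w0 r1 = Ld X (q0, F1_tilde X q0 w0 r1)"

definition D1L ::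
  "('q, 'e::real_normed_vector, 'g, 'f, 'b, 'z) conn_system_scheme \<Rightarrow> 'q \<Rightarrow> 'g \<Rightarrow> 'q set \<Rightarrow> 'e \<Rightarrow> real" where
  "D1L X q w r = mfderiv (Qm X) real_mfd (\<lambda>x. L_check X x w r) q"

definition D2L ::
  "('q, 'e, 'g, 'f::real_normed_vector, 'b, 'z) conn_system_scheme \<Rightarrow> 'q \<Rightarrow> 'g \<Rightarrow> 'q set \<Rightarrow> 'f \<Rightarrow> real" where
  "D2L X q w r = mfderiv (Gm X) real_mfd (\<lambda>x. L_check X q x r) w"

definition D3L ::
  "('q, 'e, 'g, 'f, 'b::real_normed_vector, 'z) conn_system_scheme \<Rightarrow> 'q \<Rightarrow> 'g \<Rightarrow> 'q set \<Rightarrow> 'b \<Rightarrow> real" where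
  "D3L X q w r = mfderiv (Bm X) real_mfd (\<lambda>x. L_check X q w x) r"

definition D1A ::
  "('q, 'e::real_normed_vector, 'g, 'f::real_normed_vector, 'b, 'z) conn_system_scheme \<Rightarrow> 'q \<Rightarrow> 'q \<Rightarrow> 'e \<Rightarrow> 'f" where
  "D1A X q0 q1 = mfderiv (Qm X) (Gm X) (\<lambda>x. Adisc X x q1) q0"

definition D2A ::
  "('q, 'e::real_normed_vector, 'g, 'f::real_normed_vector, 'b, 'z) conn_system_scheme \<Rightarrow> 'q \<Rightarrow> 'q \<Rightarrow> 'e \<Rightarrow> 'f" where
  "D2A X q0 q1 = mfderiv (Qm X) (Gm X) (\<lambda>x. Adisc X q0 x) q1"

definition F_plus ::
  "('q, 'e::real_normed_vector, 'g, 'f::real_normed_vector, 'b::real_normed_vector, 'z) conn_system_scheme \<Rightarrow>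
   ('q \<times> 'g) set \<Rightarrow> 'q set \<Rightarrow> 'b \<Rightarrow> real" where
  "F_plus X v0 r1 dr1 = the_elem ((\<lambda>(q0, w0). let q1 = F1_tilde X q0 w0 r1 in
     D2L X q0 w0 r1 (D2A X q0 q1 (hlift X q1 dr1))) ` v0)"

definition F_minus ::
  "('q, 'e::real_normed_vector, 'g, 'f::real_normed_vector, 'b::real_normed_vector, 'z) conn_system_scheme \<Rightarrow>
   ('q \<times> 'g) set \<Rightarrow> 'q set \<Rightarrow> 'b \<Rightarrow> real" where
  "F_minus X v0 r1 dr0 = the_elem ((\<lambda>(q0, w0). let q1 = F1_tilde X q0 w0 r1 in
     D2L X q0 w0 r1 (D1A X q0 q1 (hlift X q0 dr0))) ` v0)"

text \<open>\<open>\<alpha> w\<^sup>-\<^sup>1\<close> for a covector \<open>\<alpha>\<close> at \<open>w\<close>.\<close>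

definition rtrans ::
  "('q, 'e, 'g, 'f::real_normed_vector, 'b, 'z) sym_system_scheme \<Rightarrow> ('f \<Rightarrow> real) \<Rightarrow> 'g \<Rightarrow> 'f \<Rightarrow> real" where
  "rtrans X \<alpha> w \<xi> = \<alpha> (mfderiv (Gm X) (Gm X) (\<lambda>x. x \<otimes>\<^bsub>Grp X\<^esub> w) \<one>\<^bsub>Grp X\<^esub> \<xi>)"

definition w_rep :: "('q, 'e, 'g, 'f, 'b, 'z) sym_system_scheme \<Rightarrow> 'q \<Rightarrow> ('q \<times> 'g) set \<Rightarrow> 'g" where
  "w_rep X q v = (THE w. w \<in> carrier (Grp X) \<and> rho X q w = v)"

definition phi_bar ::
  "('q, 'e::real_normed_vector, 'g, 'f::real_normed_vector, 'b::real_normed_vector, 'z) conn_system_scheme \<Rightarrow>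
   ('q \<times> 'g) set \<Rightarrow> 'q set \<Rightarrow> ('q \<times> 'g) set \<Rightarrow> 'q set \<Rightarrow> 'b \<Rightarrow> real" where
  "phi_bar X v0 r1 v1 r2 dr1 = the_elem ((\<lambda>(q0, w0).
     let q1 = F1_tilde X q0 w0 r1; w1 = w_rep X q1 v1 in
     D1L X q1 w1 r2 (hlift X q1 dr1) + D3L X q0 w0 r1 dr1 + F_minus X v1 r2 dr1 + F_plus X v0 r1 dr1) ` v0)"

definition Q2_act ::
  "('q, 'e, 'g, 'f::real_normed_vector, 'b, 'z) sym_system_scheme \<Rightarrow> 'g \<Rightarrow>
   'q \<times> 'g \<times> 'q set \<times> ('q \<times> 'g) set \<times> 'q set \<times> 'f \<Rightarrow> 'q \<times> 'g \<times> 'q set \<times> ('q \<times> 'g) set \<times> 'q set \<times> 'f" where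
  "Q2_act X g = (\<lambda>(q0, w0, r1, v1, r2, \<xi>). (act X g q0, Gconj X g w0, r1, v1, r2, Adj X g \<xi>))"

definition psi_bar ::
  "('q, 'e, 'g, 'f::real_normed_vector, 'b, 'z) conn_system_scheme \<Rightarrow>
   ('q \<times> 'g \<times> 'q set \<times> ('q \<times> 'g) set \<times> 'q set \<times> 'f) set \<Rightarrow> real" where
  "psi_bar X z = the_elem ((\<lambda>(q0, w0, r1, v1, r2, \<xi>1).
     let q1 = F1_tilde X q0 w0 r1; w1 = w_rep X q1 v1 in
     rtrans X (D2L X q0 w0 r1) w0 \<xi>1 - rtrans X (D2L X q1 w1 r2) w1 \<xi>1) ` z)"

definition first_condition ::
  "('q, 'e::real_normed_vector, 'g, 'f::real_normed_vector, 'b::real_normed_vector, 'z) conn_system_scheme \<Rightarrow>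
   ('q \<times> 'g) set \<Rightarrow> 'q set \<Rightarrow> ('q \<times> 'g) set \<Rightarrow> 'q set \<Rightarrow> bool" where
  "first_condition X v0 r1 v1 r2 \<longleftrightarrow> (\<forall>dr1\<in>Dc_hat X r1. phi_bar X v0 r1 v1 r2 dr1 = 0)"

definition second_condition ::
  "('q, 'e::real_normed_vector, 'g, 'f::real_normed_vector, 'b, 'z) conn_system_scheme \<Rightarrow>
   ('q \<times> 'g) set \<Rightarrow> 'q set \<Rightarrow> ('q \<times> 'g) set \<Rightarrow> 'q set \<Rightarrow> bool" where
  "second_condition X v0 r1 v1 r2 \<longleftrightarrow> (\<forall>(q0, w0)\<in>v0. \<forall>\<xi>1. (F1_tilde X q0 w0 r1, \<xi>1) \<in> gD X \<longrightarrow>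
     psi_bar X (orbit (Grp X) (Q2_act X) (q0, w0, r1, v1, r2, \<xi>1)) = 0)"

definition tau :: "('q, 'e, 'g, 'f, 'b, 'z) sym_system_scheme \<Rightarrow> 'q \<Rightarrow> 'q \<Rightarrow> 'g" where
  "tau X q q' = (THE g. g \<in> carrier (Grp X) \<and> act X g q' = q)"

end

theory Submission
  imports Defs
begin

text \<open>
  Two things have to be seen: that the reconstructed curve lies in \<open>\<D>\<^sub>d\<close> and has the prescribed image
  under \<open>\<Upsilon>\<close>, and that along it the two reduced conditions are the discrete
  Lagrange-d'Alembert equations, split according to \<open>\<D> = \<S> \<oplus> \<H>\<close>.

  Lifting.  A pair \<open>(v\<^sub>k, r\<^sub>k\<^sub>+\<^sub>1)\<close> in the reduced constraint is the image of some \<open>(a, b) \<in> \<D>\<^sub>d\<close>, and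
  since \<open>\<D>\<^sub>d\<close> is invariant, \<open>(a, b)\<close> can be moved so that \<open>a\<close> becomes \<open>q\<^sub>k\<close>.  The element \<open>u\<^sub>k\<close> is the
  only \<open>w\<close> with \<open>\<rho>(q\<^sub>k, w) = v\<^sub>k\<close>, so it is \<open>\<A>\<^sub>d(q\<^sub>k, b)\<close>; and \<open>\<A>\<^sub>d(q\<^sub>k, b)\<close> and \<open>\<pi>(b)\<close> together determine
  \<open>b\<close>.  Hence \<open>q\<^sub>k\<^sub>+\<^sub>1 = b\<close> (\<open>lift_step\<close>, \<open>reconstruction_step\<close>).

  Dynamics.  After summation by parts, \<open>dS\<^sub>d\<close> vanishes on the admissible variations as soon as
  \<open>D\<^sub>2L\<^sub>d(q\<^sub>k\<^sub>-\<^sub>1, q\<^sub>k) + D\<^sub>1L\<^sub>d(q\<^sub>k, q\<^sub>k\<^sub>+\<^sub>1)\<close> vanishes on \<open>\<D>\<close> at every interior \<open>q\<^sub>k\<close> (\<open>trajectoryI\<close>).  A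
  vector of \<open>\<D>\<close> is the sum of some \<open>h \<in> \<H>\<close> and some \<open>s \<in> \<S>\<close>.

  For \<open>h\<close>, differentiate \<open>L\<^sub>d(x, y) = L(x, \<A>\<^sub>d(x, y), \<pi>(y))\<close>, where \<open>L\<close> is the Lagrangian \<open>L_check\<close>, in
  either variable.  The result expresses \<open>D\<^sub>1L\<^sub>d\<close> and \<open>D\<^sub>2L\<^sub>d\<close> through the partial derivatives of \<open>L\<close> and
  terms \<open>D\<^sub>2L \<circ> D\<^sub>j\<A>\<^sub>d\<close>, which are the discrete forces.  So \<open>\<phi>\<close> at \<open>d\<pi>(h)\<close> is the Lagrange-d'Alembert
  expression at \<open>h\<close> (\<open>phi_bar_eq\<close>).

  For \<open>s\<close>, write \<open>s = \<xi>\<^sub>Q(q\<^sub>k)\<close> (\<open>vertical_imp_inf_gen\<close>).  Differentiating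
  \<open>L(q\<^sub>0, exp(t\<xi>) w\<^sub>0, r\<^sub>1) = L\<^sub>d(q\<^sub>0, exp(t\<xi>) q\<^sub>1)\<close> identifies the two momenta in \<open>\<psi>\<close> with derivatives of
  \<open>L\<^sub>d\<close> in its second argument along infinitesimal generators; invariance of \<open>L\<^sub>d\<close> turns the second
  of them into a derivative in the first argument with the opposite sign (\<open>psi_bar_eq\<close>).

  The reduced functions are defined on orbits by means of representatives.  Each of the formulas is
  proved at every representative at once: the points are translated by \<open>g\<close>, the identities above
  are applied there, and equivariance of \<open>L\<^sub>d\<close>, \<open>\<A>\<^sub>d\<close> and the horizontal lift removes \<open>g\<close>.  The value of
  the horizontal lift rests on the fact that the kernel of \<open>d\<pi>\<close> is vertical
  (\<open>kernel_dproj_vertical\<close>).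
\<close>

section \<open>Derivatives along parametrizations\<close>

definition inj_charts :: "('a, 'e::real_normed_vector) atlas \<Rightarrow> bool" where
  "inj_charts M \<longleftrightarrow> (\<forall>c\<in>M. inj_on (snd c) (fst c))"

lemma inj_charts_manifold: "smooth_manifold M \<Longrightarrow> inj_charts M"
  by (auto simp: smooth_manifold_def inj_charts_def is_chart_def)

lemma inj_charts_real: "inj_charts real_mfd"
  by (simp add: inj_charts_def real_mfd_def)

lemma inj_charts_prod: "inj_charts M \<Longrightarrow> inj_charts M' \<Longrightarrow> inj_charts (prod_mfd M M')"
  unfolding inj_charts_def prod_mfd_def by (auto intro!: map_prod_inj_on)

lemma openin_mtop:
  assumes "inj_charts M"
  shows "openin (mtop M) W \<longleftrightarrow> W \<subseteq> mcarrier M \<and> (\<forall>c\<in>M. open (snd c ` (W \<inter> fst c)))"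
proof -
  have "istopology (\<lambda>W. W \<subseteq> mcarrier M \<and> (\<forall>c\<in>M. open (snd c ` (W \<inter> fst c))))"
    unfolding istopology_def
  proof (intro conjI allI impI ballI)
    fix S T c
    assume S: "S \<subseteq> mcarrier M \<and> (\<forall>c\<in>M. open (snd c ` (S \<inter> fst c)))"
      and T: "T \<subseteq> mcarrier M \<and> (\<forall>c\<in>M. open (snd c ` (T \<inter> fst c)))"
    show "S \<inter> T \<subseteq> mcarrier M" using S by blast
    assume c: "c \<in> M"
    have "snd c ` (S \<inter> T \<inter> fst c) = snd c ` (S \<inter> fst c) \<inter> snd c ` (T \<inter> fst c)"
      using assms c by (auto simp: inj_charts_def inj_on_def)
    then show "open (snd c ` (S \<inter> T \<inter> fst c))" using S T c by auto
  next
    fix K c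
    assume K: "\<forall>S\<in>K. S \<subseteq> mcarrier M \<and> (\<forall>c\<in>M. open (snd c ` (S \<inter> fst c)))"
    show "\<Union>K \<subseteq> mcarrier M" using K by blast
    assume c: "c \<in> M"
    have "snd c ` (\<Union>K \<inter> fst c) = (\<Union>S\<in>K. snd c ` (S \<inter> fst c))" by blast
    then show "open (snd c ` (\<Union>K \<inter> fst c))" using K c by auto
  qed
  then show ?thesis unfolding mtop_def by (simp add: topology_inverse')
qed

lemma chart_at_in: "x \<in> mcarrier M \<Longrightarrow> chart_at M x \<in> M"
  and chart_at_mem: "x \<in> mcarrier M \<Longrightarrow> x \<in> fst (chart_at M x)"
proof -
  assume "x \<in> mcarrier M"
  then have "\<exists>c. c \<in> M \<and> x \<in> fst c" by (auto simp: mcarrier_def)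
  then have "chart_at M x \<in> M \<and> x \<in> fst (chart_at M x)"
    unfolding chart_at_def by (rule someI_ex)
  then show "chart_at M x \<in> M" "x \<in> fst (chart_at M x)" by auto
qed

lemma chart_inv_chart: "inj_charts M \<Longrightarrow> c \<in> M \<Longrightarrow> x \<in> fst c \<Longrightarrow> chart_inv c (snd c x) = x"
  by (auto simp: chart_inv_def inj_charts_def)

lemma chart_inv_mem: "z \<in> snd c ` fst c \<Longrightarrow> chart_inv c z \<in> fst c"
  and chart_chart_inv: "z \<in> snd c ` fst c \<Longrightarrow> snd c (chart_inv c z) = z"
  unfolding chart_inv_def by (auto intro: inv_into_into f_inv_into_f)

lemma openin_mcarrier:
  assumes "smooth_manifold M" shows "openin (mtop M) (mcarrier M)"
proof -
  have "mcarrier M \<inter> fst c = fst c" if "c \<in> M" for c using that by (auto simp: mcarrier_def)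
  then show ?thesis using assms
    by (auto simp: openin_mtop[OF inj_charts_manifold] smooth_manifold_def is_chart_def)
qed

lemma openin_chart:
  assumes "smooth_manifold M" "c \<in> M" shows "openin (mtop M) (fst c)"
proof -
  have "open (snd c' ` (fst c \<inter> fst c'))" if "c' \<in> M" for c'
    using assms that by (auto simp: smooth_manifold_def smooth_transition_def smooth_on_def Int_commute)
  then show ?thesis using assms
    by (auto simp: openin_mtop[OF inj_charts_manifold] mcarrier_def)
qed

lemma mcarrier_prod: "mcarrier (prod_mfd M M') = mcarrier M \<times> mcarrier M'"
proof
  show "mcarrier (prod_mfd M M') \<subseteq> mcarrier M \<times> mcarrier M'"
    unfolding mcarrier_def prod_mfd_def by auto
  show "mcarrier M \<times> mcarrier M' \<subseteq> mcarrier (prod_mfd M M')"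
  proof
    fix p assume "p \<in> mcarrier M \<times> mcarrier M'"
    then obtain c c' where "c \<in> M" "c' \<in> M'" "p \<in> fst c \<times> fst c'" by (auto simp: mcarrier_def)
    moreover from this have "(fst c \<times> fst c', map_prod (snd c) (snd c')) \<in> prod_mfd M M'"
      unfolding prod_mfd_def by blast
    ultimately show "p \<in> mcarrier (prod_mfd M M')"
      unfolding mcarrier_def by force
  qed
qed

text \<open>
  The derivative of a parametrization \<open>F\<close> by a normed space, in the fixed chart at \<open>F z\<close>.
  Continuity is a separate clause, because the coordinate function takes arbitrary values outside
  the chart and so does not see whether \<open>F\<close> stays close to \<open>F z\<close>.  Derivatives of maps are computed
  by pushing such parametrizations forward; maps of two arguments then take a pair of
  parametrizations, and tangent spaces of products do not occur.
\<close>

definition has_tangent_map ::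
  "('a, 'e::real_normed_vector) atlas \<Rightarrow> ('z::real_normed_vector \<Rightarrow> 'a) \<Rightarrow> 'z \<Rightarrow> ('z \<Rightarrow> 'e) \<Rightarrow> bool" where
  "has_tangent_map M F z D \<longleftrightarrow> F z \<in> mcarrier M \<and>
     (\<forall>W. openin (mtop M) W \<and> F z \<in> W \<longrightarrow> (\<forall>\<^sub>F y in nhds z. F y \<in> W)) \<and>
     ((\<lambda>y. snd (chart_at M (F z)) (F y)) has_derivative D) (at z)"

lemma has_tangent_map_carrier: "has_tangent_map M F z D \<Longrightarrow> F z \<in> mcarrier M"
  by (simp add: has_tangent_map_def)

lemma has_tangent_map_eventually:
  "has_tangent_map M F z D \<Longrightarrow> openin (mtop M) W \<Longrightarrow> F z \<in> W \<Longrightarrow> \<forall>\<^sub>F y in nhds z. F y \<in> W"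
  by (simp add: has_tangent_map_def)

lemma has_tangent_map_linear: "has_tangent_map M F z D \<Longrightarrow> linear D"
  by (auto simp: has_tangent_map_def dest: has_derivative_linear)

lemma has_tangent_map_unique:
  "has_tangent_map M F z D \<Longrightarrow> has_tangent_map M F z D' \<Longrightarrow> D = D'"
  by (auto simp: has_tangent_map_def dest: has_derivative_unique)

lemma has_tangent_map_cong:
  assumes F: "has_tangent_map M F z D" and ev: "\<forall>\<^sub>F y in nhds z. F y = G y"
  shows "has_tangent_map M G z D"
proof -
  have z: "F z = G z" using ev by (rule eventually_nhds_x_imp_x)
  have "\<forall>\<^sub>F y in nhds z. G y \<in> W" if "openin (mtop M) W" "G z \<in> W" for W
    using has_tangent_map_eventually[OF F that(1)] that(2) ev z
    by (auto elim: eventually_elim2)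
  moreover have "((\<lambda>y. snd (chart_at M (F z)) (G y)) has_derivative D) (at z)"
  proof (rule has_derivative_transform_eventually)
    show "((\<lambda>y. snd (chart_at M (F z)) (F y)) has_derivative D) (at z)"
      using F by (simp add: has_tangent_map_def)
    show "\<forall>\<^sub>F y in at z. snd (chart_at M (F z)) (F y) = snd (chart_at M (F z)) (G y)"
      using ev by (auto simp: eventually_at_filter elim: eventually_mono)
  qed (simp_all add: z)
  ultimately show ?thesis using F z by (auto simp: has_tangent_map_def)
qed

lemma has_tangent_map_const: "x \<in> mcarrier M \<Longrightarrow> has_tangent_map M (\<lambda>_. x) z (\<lambda>_. 0)"
  by (simp add: has_tangent_map_def)

lemma has_tangent_map_reparametrize:
  assumes F: "has_tangent_map M F (g w) D" and g: "(g has_derivative E) (at w)"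
  shows "has_tangent_map M (\<lambda>y. F (g y)) w (\<lambda>v. D (E v))"
proof -
  have "filterlim g (nhds (g w)) (nhds w)"
    using has_derivative_continuous[OF g] by (simp add: continuous_at tendsto_nhds_iff)
  then have "\<forall>\<^sub>F y in nhds w. F (g y) \<in> W" if "openin (mtop M) W" "F (g w) \<in> W" for W
    using has_tangent_map_eventually[OF F that] by (rule eventually_compose_filterlim[rotated])
  moreover have "((\<lambda>y. snd (chart_at M (F (g w))) (F (g y))) has_derivative (\<lambda>v. D (E v))) (at w)"
    using F by (intro has_derivative_compose[OF g]) (simp add: has_tangent_map_def)
  ultimately show ?thesis using F by (simp add: has_tangent_map_def)
qed

lemma has_tangent_map_chart:
  assumes M: "smooth_manifold M" and x: "x \<in> mcarrier M"
  shows "has_tangent_map M (chart_inv (chart_at M x)) (snd (chart_at M x) x) (\<lambda>v. v)"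
proof -
  let ?c = "chart_at M x"
  note inj = inj_charts_manifold[OF M] and c = chart_at_in[OF x] and xc = chart_at_mem[OF x]
  have inv: "chart_inv ?c (snd ?c x) = x" using chart_inv_chart[OF inj c xc] .
  have "\<forall>\<^sub>F z in nhds (snd ?c x). chart_inv ?c z \<in> W" if W: "openin (mtop M) W" "x \<in> W" for W
  proof (rule eventually_mono)
    show "\<forall>\<^sub>F z in nhds (snd ?c x). z \<in> snd ?c ` (W \<inter> fst ?c)"
      using W c xc by (intro eventually_nhds_in_open) (auto simp: openin_mtop[OF inj])
    fix z assume "z \<in> snd ?c ` (W \<inter> fst ?c)"
    then show "chart_inv ?c z \<in> W" using chart_inv_chart[OF inj c] by auto
  qed
  moreover have "((\<lambda>y. snd ?c (chart_inv ?c y)) has_derivative (\<lambda>v. v)) (at (snd ?c x))"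
  proof (rule has_derivative_transform_eventually)
    show "((\<lambda>y. y) has_derivative (\<lambda>v. v)) (at (snd ?c x))" by (rule has_derivative_ident)
    have "open (snd ?c ` fst ?c)" using M c by (auto simp: smooth_manifold_def is_chart_def)
    then have "\<forall>\<^sub>F z in nhds (snd ?c x). z \<in> snd ?c ` fst ?c"
      using xc by (intro eventually_nhds_in_open) auto
    then show "\<forall>\<^sub>F z in at (snd ?c x). z = snd ?c (chart_inv ?c z)"
      by (auto simp: eventually_at_filter chart_chart_inv elim: eventually_mono)
  qed (simp_all add: inv)
  ultimately show ?thesis using x by (simp add: has_tangent_map_def inv)
qed

lemma has_tangent_map_line:
  assumes "smooth_manifold M" "x \<in> mcarrier M"
  shows "has_tangent_map M (\<lambda>s::real. chart_inv (chart_at M x) (snd (chart_at M x) x + s *\<^sub>R d)) 0 (\<lambda>s. s *\<^sub>R d)"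
  by (rule has_tangent_map_reparametrize[where F = "chart_inv (chart_at M x)"
        and g = "\<lambda>s. snd (chart_at M x) x + s *\<^sub>R d" and D = "\<lambda>v. v"])
     (auto simp: has_tangent_map_chart[OF assms] intro!: derivative_eq_intros)

text \<open>
  The coordinate expression of \<open>f\<close> is differentiable on an open set, into which \<open>F\<close> is carried near
  \<open>z\<close> because it is continuous in the chart \<open>c\<close>.  The chart is arbitrary, so that \<open>c\<close> can be the
  product of the fixed charts at two points when \<open>M\<close> is a product.
\<close>

lemma smooth_map_on_chart:
  assumes f: "smooth_map_on M M' W f" and M: "inj_charts M" and M': "inj_charts M'"
    and c: "c \<in> M" and Fz: "F z \<in> W" and F: "\<forall>\<^sub>F y in nhds z. F y \<in> fst c"
    and D: "((\<lambda>y. snd c (F y)) has_derivative D) (at z)"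
  defines "loc \<equiv> snd (chart_at M' (f (F z))) \<circ> f \<circ> chart_inv c"
  shows "loc differentiable (at (snd c (F z)))"
    and "has_tangent_map M' (\<lambda>y. f (F y)) z (\<lambda>v. frechet_derivative loc (at (snd c (F z))) (D v))"
    and "\<forall>\<^sub>F y in nhds z. F y \<in> W"
proof -
  have fz: "f (F z) \<in> mcarrier M'" using f Fz by (auto simp: smooth_map_on_def)
  let ?c' = "chart_at M' (f (F z))"
  note c' = chart_at_in[OF fz] and fc' = chart_at_mem[OF fz]
  have Fzc: "F z \<in> fst c" using F by (rule eventually_nhds_x_imp_x)
  let ?A = "{x \<in> fst c \<inter> W. f x \<in> fst ?c'}"
  have sm: "smooth_on loc (snd c ` ?A)" using f c c' by (auto simp: smooth_map_on_def loc_def)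
  then have opA: "open (snd c ` ?A)" by (simp add: smooth_on_def)
  have zA: "snd c (F z) \<in> snd c ` ?A" using Fzc Fz fc' by auto
  have dl: "loc differentiable (at p)" if "p \<in> snd c ` ?A" for p
  proof -
    have "Ck_on (Suc 0) loc (snd c ` ?A)" using sm unfolding smooth_on_def by blast
    then show ?thesis using that unfolding Ck_on.simps by (elim conjE) (rule bspec)
  qed
  then show dz: "loc differentiable (at (snd c (F z)))" using zA by blast
  have cont: "continuous_on (snd c ` ?A) loc"
    using dl by (auto intro!: continuous_at_imp_continuous_on differentiable_imp_continuous_within)
  have lim: "filterlim (\<lambda>y. snd c (F y)) (nhds (snd c (F z))) (nhds z)"
    using has_derivative_continuous[OF D] by (simp add: continuous_at tendsto_nhds_iff)
  have inj: "x = y" if "x \<in> fst c" "y \<in> fst c" "snd c x = snd c y" for x y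
    using M c that by (auto simp: inj_charts_def inj_on_def)
  have evA: "\<forall>\<^sub>F y in nhds z. F y \<in> ?A"
  proof -
    have "\<forall>\<^sub>F y in nhds z. snd c (F y) \<in> snd c ` ?A"
      using eventually_nhds_in_open[OF opA zA] lim by (rule eventually_compose_filterlim)
    with F show ?thesis by eventually_elim (use inj in blast)
  qed
  then show "\<forall>\<^sub>F y in nhds z. F y \<in> W" by (auto elim: eventually_mono)
  have loc: "loc (snd c (F y)) = snd ?c' (f (F y))" if "F y \<in> ?A" for y
    using that chart_inv_chart[OF M c] by (simp add: loc_def)
  have evW: "\<forall>\<^sub>F y in nhds z. f (F y) \<in> W'" if W': "openin (mtop M') W'" "f (F z) \<in> W'" for W'
  proof -
    let ?V = "snd ?c' ` (W' \<inter> fst ?c')"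
    have opV: "open ?V" using W' c' by (auto simp: openin_mtop[OF M'])
    have op: "open (loc -` ?V \<inter> snd c ` ?A)"
      using continuous_on_open_vimage[OF opA, of loc] cont opV by blast
    have "loc (snd c (F z)) \<in> ?V" using loc[of z] Fzc Fz fc' W' by auto
    then have zV: "snd c (F z) \<in> loc -` ?V \<inter> snd c ` ?A" using zA by blast
    have "\<forall>\<^sub>F y in nhds z. snd c (F y) \<in> loc -` ?V \<inter> snd c ` ?A"
      using eventually_nhds_in_open[OF op zV] lim by (rule eventually_compose_filterlim)
    with evA show ?thesis
    proof eventually_elim
      case (elim y)
      then obtain x where x: "x \<in> W'" "x \<in> fst ?c'" "snd ?c' (f (F y)) = snd ?c' x"
        using loc[of y] by auto
      moreover have "f (F y) \<in> fst ?c'" using elim by blast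
      ultimately have "f (F y) = x" using M' c' unfolding inj_charts_def inj_on_def by blast
      with x show ?case by simp
    qed
  qed
  have "((\<lambda>y. snd ?c' (f (F y))) has_derivative (\<lambda>v. frechet_derivative loc (at (snd c (F z))) (D v))) (at z)"
  proof (rule has_derivative_transform_eventually)
    show "((\<lambda>y. loc (snd c (F y))) has_derivative (\<lambda>v. frechet_derivative loc (at (snd c (F z))) (D v))) (at z)"
      using dz by (intro has_derivative_compose[OF D]) (simp add: frechet_derivative_works)
    show "\<forall>\<^sub>F y in at z. loc (snd c (F y)) = snd ?c' (f (F y))"
      using evA loc by (auto simp: eventually_at_filter elim: eventually_mono)
    show "loc (snd c (F z)) = snd ?c' (f (F z))" using loc[of z] Fzc Fz fc' by auto
  qed simp
  then show "has_tangent_map M' (\<lambda>y. f (F y)) z (\<lambda>v. frechet_derivative loc (at (snd c (F z))) (D v))"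
    using fz evW by (simp add: has_tangent_map_def)
qed

lemma smooth_map_on_tangent:
  assumes f: "smooth_map_on M M' W f" and M: "smooth_manifold M" and M': "inj_charts M'"
    and F: "has_tangent_map M F z D" and Fz: "F z \<in> W"
  shows "has_tangent_map M' (\<lambda>y. f (F y)) z (\<lambda>v. mfderiv M M' f (F z) (D v))"
proof -
  have x: "F z \<in> mcarrier M" using F by (rule has_tangent_map_carrier)
  show ?thesis unfolding mfderiv_def
    using F x
    by (intro smooth_map_on_chart(2)[OF f inj_charts_manifold[OF M] M'] chart_at_in Fz
        has_tangent_map_eventually[OF F] openin_chart M chart_at_mem) (auto simp: has_tangent_map_def)
qed

text \<open>
  The total derivative is taken in the product of the fixed charts at \<open>x\<close> and at \<open>y\<close>, which may
  differ from the fixed chart of the product manifold at \<open>(x, y)\<close>.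
\<close>

definition pair_deriv ::
  "('a, 'e::real_normed_vector) atlas \<Rightarrow> ('b, 'f::real_normed_vector) atlas \<Rightarrow>
   ('c, 'k::real_normed_vector) atlas \<Rightarrow> ('a \<times> 'b \<Rightarrow> 'c) \<Rightarrow> 'a \<Rightarrow> 'b \<Rightarrow> 'e \<times> 'f \<Rightarrow> 'k" where
  "pair_deriv M1 M2 M' f x y = (let c1 = chart_at M1 x; c2 = chart_at M2 y in
     frechet_derivative (snd (chart_at M' (f (x, y))) \<circ> f \<circ>
       chart_inv (fst c1 \<times> fst c2, map_prod (snd c1) (snd c2))) (at (snd c1 x, snd c2 y)))"

lemma smooth_map_on_tangent2:
  assumes f: "smooth_map_on (prod_mfd M1 M2) M' W f"
    and M1: "smooth_manifold M1" and M2: "smooth_manifold M2" and M': "inj_charts M'"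
    and F: "has_tangent_map M1 F z D" and G: "has_tangent_map M2 G z E" and W: "(F z, G z) \<in> W"
  shows "linear (pair_deriv M1 M2 M' f (F z) (G z))"
    and "has_tangent_map M' (\<lambda>y. f (F y, G y)) z (\<lambda>v. pair_deriv M1 M2 M' f (F z) (G z) (D v, E v))"
    and "\<forall>\<^sub>F y in nhds z. (F y, G y) \<in> W"
proof -
  let ?c1 = "chart_at M1 (F z)" and ?c2 = "chart_at M2 (G z)"
  let ?c = "(fst ?c1 \<times> fst ?c2, map_prod (snd ?c1) (snd ?c2))"
  note inj = inj_charts_prod[OF inj_charts_manifold[OF M1] inj_charts_manifold[OF M2]]
  note Fz = has_tangent_map_carrier[OF F] and Gz = has_tangent_map_carrier[OF G]
  have c: "?c \<in> prod_mfd M1 M2"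
    using chart_at_in[OF Fz] chart_at_in[OF Gz] unfolding prod_mfd_def by blast
  have "\<forall>\<^sub>F y in nhds z. F y \<in> fst ?c1"
    using has_tangent_map_eventually[OF F openin_chart[OF M1 chart_at_in[OF Fz]] chart_at_mem[OF Fz]] .
  moreover have "\<forall>\<^sub>F y in nhds z. G y \<in> fst ?c2"
    using has_tangent_map_eventually[OF G openin_chart[OF M2 chart_at_in[OF Gz]] chart_at_mem[OF Gz]] .
  ultimately have ev: "\<forall>\<^sub>F y in nhds z. (F y, G y) \<in> fst ?c" by eventually_elim auto
  have D: "((\<lambda>y. snd ?c (F y, G y)) has_derivative (\<lambda>v. (D v, E v))) (at z)"
    using F G by (auto simp: has_tangent_map_def intro!: has_derivative_Pair)
  note * = smooth_map_on_chart[OF f inj M' c, of "\<lambda>y. (F y, G y)", OF W ev D]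
  show "linear (pair_deriv M1 M2 M' f (F z) (G z))"
    using linear_frechet_derivative[OF *(1)] by (simp add: pair_deriv_def Let_def)
  show "has_tangent_map M' (\<lambda>y. f (F y, G y)) z (\<lambda>v. pair_deriv M1 M2 M' f (F z) (G z) (D v, E v))"
    using *(2) by (simp add: pair_deriv_def Let_def)
  show "\<forall>\<^sub>F y in nhds z. (F y, G y) \<in> W" using *(3) .
qed

text \<open>
  Differentiability at the single point \<open>x\<close>.  It applies to maps like \<open>L_check\<close> with two arguments
  held fixed, which are controlled only near one point.
\<close>

definition mdiff ::
  "('a, 'e::real_normed_vector) atlas \<Rightarrow> ('b, 'f::real_normed_vector) atlas \<Rightarrow> ('a \<Rightarrow> 'b) \<Rightarrow> 'a \<Rightarrow> bool" where
  "mdiff M M' f x \<longleftrightarrow>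
     has_tangent_map M' (\<lambda>y. f (chart_inv (chart_at M x) y)) (snd (chart_at M x) x) (mfderiv M M' f x)"

lemma mdiffI:
  assumes M: "inj_charts M" and x: "x \<in> mcarrier M"
    and "has_tangent_map M' (\<lambda>y. f (chart_inv (chart_at M x) y)) (snd (chart_at M x) x) D"
  shows "mdiff M M' f x" and "mfderiv M M' f x = D"
proof -
  have inv: "chart_inv (chart_at M x) (snd (chart_at M x) x) = x"
    using chart_inv_chart[OF M chart_at_in[OF x] chart_at_mem[OF x]] .
  have "((snd (chart_at M' (f x)) \<circ> f \<circ> chart_inv (chart_at M x)) has_derivative D) (at (snd (chart_at M x) x))"
    using assms(3) by (simp add: has_tangent_map_def inv comp_def)
  then show D: "mfderiv M M' f x = D"
    unfolding mfderiv_def by (rule frechet_derivative_at[symmetric])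
  show "mdiff M M' f x" unfolding mdiff_def D by (rule assms(3))
qed

text \<open>
  The chain rule.  Near \<open>z\<close> the values of \<open>F\<close> lie in the fixed chart, so \<open>F\<close> factors through the
  chart parametrization by which the derivative of \<open>f\<close> is defined.
\<close>

lemma mdiff_tangent:
  assumes M: "smooth_manifold M" and f: "mdiff M M' f (F z)" and F: "has_tangent_map M F z D"
  shows "has_tangent_map M' (\<lambda>y. f (F y)) z (\<lambda>v. mfderiv M M' f (F z) (D v))"
proof -
  let ?c = "chart_at M (F z)"
  note Fz = has_tangent_map_carrier[OF F]
  have D: "((\<lambda>y. snd ?c (F y)) has_derivative D) (at z)" using F by (simp add: has_tangent_map_def)
  have "has_tangent_map M' (\<lambda>y. f (chart_inv ?c (snd ?c (F y)))) z (\<lambda>v. mfderiv M M' f (F z) (D v))"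
    using f unfolding mdiff_def by (rule has_tangent_map_reparametrize[OF _ D])
  moreover have "\<forall>\<^sub>F y in nhds z. F y \<in> fst ?c"
    using has_tangent_map_eventually[OF F openin_chart[OF M chart_at_in[OF Fz]] chart_at_mem[OF Fz]] .
  then have "\<forall>\<^sub>F y in nhds z. f (chart_inv ?c (snd ?c (F y))) = f (F y)"
    by eventually_elim (simp add: chart_inv_chart[OF inj_charts_manifold[OF M] chart_at_in[OF Fz]])
  ultimately show ?thesis by (rule has_tangent_map_cong)
qed

lemma smooth_map_on_mdiff:
  assumes "smooth_map_on M M' W f" "smooth_manifold M" "inj_charts M'" "x \<in> W" "x \<in> mcarrier M"
  shows "mdiff M M' f x"
proof -
  have inv: "chart_inv (chart_at M x) (snd (chart_at M x) x) = x"
    using chart_inv_chart[OF inj_charts_manifold[OF assms(2)] chart_at_in[OF assms(5)]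
        chart_at_mem[OF assms(5)]] .
  show ?thesis
    unfolding mdiff_def
    using smooth_map_on_tangent[OF assms(1-3) has_tangent_map_chart[OF assms(2,5)]] assms(4)
    by (simp add: inv)
qed

lemma mdiff_linear: "mdiff M M' f x \<Longrightarrow> linear (mfderiv M M' f x)"
  unfolding mdiff_def by (rule has_tangent_map_linear)

lemma chart_at_real: "chart_at real_mfd x = (UNIV, \<lambda>x. x)"
  unfolding chart_at_def real_mfd_def by (rule some_equality) auto

lemma mcarrier_real [simp]: "mcarrier real_mfd = UNIV"
  by (simp add: mcarrier_def real_mfd_def)

lemma chart_inv_real: "chart_inv (UNIV, \<lambda>x::real. x) = (\<lambda>x. x)"
  by (rule ext) (simp add: chart_inv_def inv_into_def)

lemma openin_real: "openin (mtop real_mfd) W \<longleftrightarrow> open W"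
  by (simp add: openin_mtop[OF inj_charts_real], simp add: real_mfd_def)

lemma has_tangent_map_real: "has_tangent_map real_mfd F z D \<longleftrightarrow> (F has_derivative D) (at z)"
proof
  assume "(F has_derivative D) (at z)"
  moreover from this have "filterlim F (nhds (F z)) (nhds z)"
    using has_derivative_continuous[of F D z UNIV] by (simp add: continuous_at tendsto_nhds_iff)
  then have "\<forall>\<^sub>F y in nhds z. F y \<in> W" if "open W" "F z \<in> W" for W
    using eventually_nhds_in_open[OF that] by (rule eventually_compose_filterlim[rotated])
  ultimately show "has_tangent_map real_mfd F z D"
    by (simp add: has_tangent_map_def chart_at_real openin_real)
qed (simp add: has_tangent_map_def chart_at_real)

lemma velocity_eq: "has_tangent_map M c 0 D \<Longrightarrow> velocity M c = D 1"
  unfolding velocity_def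
  by (subst mdiffI(2)[OF inj_charts_real]) (simp_all add: chart_at_real chart_inv_real)

lemma smooth_curve_tangent:
  assumes "smooth_map_on real_mfd M W c" "0 \<in> W" "inj_charts M"
  shows "has_tangent_map M c 0 (\<lambda>t. t *\<^sub>R velocity M c)"
proof -
  have "\<exists>D. has_tangent_map M c 0 D"
    using smooth_map_on_chart(2)[OF assms(1) inj_charts_real assms(3), of "(UNIV, \<lambda>x. x)" "\<lambda>t. t" 0 "\<lambda>t. t"]
      assms(2) by (auto simp: real_mfd_def)
  then obtain D where D: "has_tangent_map M c 0 D" by blast
  have "D t = t *\<^sub>R velocity M c" for t
    using linear_cmul[OF has_tangent_map_linear[OF D], of t 1] velocity_eq[OF D] by simp
  then have "D = (\<lambda>t. t *\<^sub>R velocity M c)" by auto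
  with D show ?thesis by simp
qed


text \<open>
  Keeping one parametrization constant shows that the partial derivatives are the restrictions of
  the total derivative to the two factors, and linearity adds them up.
\<close>

lemma smooth_map_on_partial:
  assumes f: "smooth_map_on (prod_mfd M1 M2) M' W f"
    and M1: "smooth_manifold M1" and M2: "smooth_manifold M2" and M': "inj_charts M'"
    and x: "x \<in> mcarrier M1" and y: "y \<in> mcarrier M2" and W: "(x, y) \<in> W"
  shows "mdiff M1 M' (\<lambda>x. f (x, y)) x" and "mdiff M2 M' (\<lambda>y. f (x, y)) y"
    and "pair_deriv M1 M2 M' f x y (v, w) = mfderiv M1 M' (\<lambda>x. f (x, y)) x v + mfderiv M2 M' (\<lambda>y. f (x, y)) y w"
proof -
  have inv: "chart_inv (chart_at M1 x) (snd (chart_at M1 x) x) = x"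
    "chart_inv (chart_at M2 y) (snd (chart_at M2 y) y) = y"
    using chart_inv_chart[OF inj_charts_manifold[OF M1] chart_at_in[OF x] chart_at_mem[OF x]]
      chart_inv_chart[OF inj_charts_manifold[OF M2] chart_at_in[OF y] chart_at_mem[OF y]] by auto
  note t2 = smooth_map_on_tangent2[OF f M1 M2 M']
  have "has_tangent_map M' (\<lambda>z. f (chart_inv (chart_at M1 x) z, y)) (snd (chart_at M1 x) x)
      (\<lambda>v. pair_deriv M1 M2 M' f x y (v, 0))"
    using t2(2)[OF has_tangent_map_chart[OF M1 x] has_tangent_map_const[OF y]] W by (simp add: inv)
  note 1 = mdiffI[OF inj_charts_manifold[OF M1] x this]
  have "has_tangent_map M' (\<lambda>z. f (x, chart_inv (chart_at M2 y) z)) (snd (chart_at M2 y) y)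
      (\<lambda>v. pair_deriv M1 M2 M' f x y (0, v))"
    using t2(2)[OF has_tangent_map_const[OF x] has_tangent_map_chart[OF M2 y]] W by (simp add: inv)
  note 2 = mdiffI[OF inj_charts_manifold[OF M2] y this]
  show "mdiff M1 M' (\<lambda>x. f (x, y)) x" "mdiff M2 M' (\<lambda>y. f (x, y)) y" using 1 2 by auto
  have lin: "linear (pair_deriv M1 M2 M' f x y)"
    using t2(1)[of "\<lambda>_. x" "0::real" "\<lambda>_. 0" "\<lambda>_. y" "\<lambda>_. 0"] x y W by (simp add: has_tangent_map_const)
  show "pair_deriv M1 M2 M' f x y (v, w) = mfderiv M1 M' (\<lambda>x. f (x, y)) x v + mfderiv M2 M' (\<lambda>y. f (x, y)) y w"
    using linear_add[OF lin, of "(v, 0)" "(0, w)"] 1(2) 2(2) by simp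
qed

lemma smooth_map_on_total:
  assumes f: "smooth_map_on (prod_mfd M1 M2) M' W f"
    and M1: "smooth_manifold M1" and M2: "smooth_manifold M2" and M': "inj_charts M'"
    and F: "has_tangent_map M1 F z D" and G: "has_tangent_map M2 G z E" and W: "(F z, G z) \<in> W"
  shows "has_tangent_map M' (\<lambda>y. f (F y, G y)) z
      (\<lambda>v. mfderiv M1 M' (\<lambda>x. f (x, G z)) (F z) (D v) + mfderiv M2 M' (\<lambda>y. f (F z, y)) (G z) (E v))"
  using smooth_map_on_tangent2(2)[OF assms]
  by (simp add: smooth_map_on_partial(3)[OF f M1 M2 M' has_tangent_map_carrier[OF F] has_tangent_map_carrier[OF G] W])

section \<open>Smooth curves from straight lines\<close>

lemma Ck_on_cong:
  assumes "Ck_on n f S" "open S" "\<And>x. x \<in> S \<Longrightarrow> f x = g x"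
  shows "Ck_on n g S"
  using assms
proof (induction n arbitrary: f g)
  case 0
  then show ?case by simp
next
  case (Suc n)
  have der: "(g has_derivative frechet_derivative f (at x)) (at x)" if "x \<in> S" for x
  proof (rule has_derivative_transform_within_open)
    show "(f has_derivative frechet_derivative f (at x)) (at x)"
      using Suc.prems(1) that by (simp add: frechet_derivative_works)
  qed (use Suc.prems that in auto)
  have "Ck_on n (\<lambda>x. frechet_derivative g (at x) v) S" for v
  proof (rule Suc.IH)
    show "Ck_on n (\<lambda>x. frechet_derivative f (at x) v) S" using Suc.prems(1) by simp
    show "frechet_derivative f (at x) v = frechet_derivative g (at x) v" if "x \<in> S" for x
      using frechet_derivative_at[OF der[OF that]] by simp
  qed (fact Suc.prems)
  then show ?case using der by (auto simp: differentiable_def)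
qed

lemma Ck_on_subset: "Ck_on n f S \<Longrightarrow> T \<subseteq> S \<Longrightarrow> Ck_on n f T"
  by (induction n arbitrary: f) (auto intro: continuous_on_subset)

lemma Ck_on_scaleR:
  assumes "Ck_on n f S" "open S" shows "Ck_on n (\<lambda>x. t *\<^sub>R f x) S"
  using assms
proof (induction n arbitrary: f)
  case 0
  then show ?case by (auto intro: continuous_intros)
next
  case (Suc n)
  have der: "((\<lambda>x. t *\<^sub>R f x) has_derivative (\<lambda>v. t *\<^sub>R frechet_derivative f (at x) v)) (at x)"
    if "x \<in> S" for x
    using Suc.prems(1) that by (intro has_derivative_scaleR_right) (simp add: frechet_derivative_works)
  have "Ck_on n (\<lambda>x. frechet_derivative (\<lambda>x. t *\<^sub>R f x) (at x) v) S" for v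
  proof (rule Ck_on_cong)
    show "Ck_on n (\<lambda>x. t *\<^sub>R frechet_derivative f (at x) v) S" using Suc by simp
    show "t *\<^sub>R frechet_derivative f (at x) v = frechet_derivative (\<lambda>x. t *\<^sub>R f x) (at x) v" if "x \<in> S" for x
      by (simp flip: frechet_derivative_at[OF der[OF that]])
  qed (fact Suc.prems)
  then show ?case using der by (auto simp: differentiable_def)
qed

text \<open>
  The derivative along a line is the directional derivative in the constant direction \<open>d\<close>, up to the
  scalar \<open>t\<close>.  It is again a function restricted to the line, to which the induction
  hypothesis applies.
\<close>

lemma Ck_on_line:
  fixes f :: "'a::real_normed_vector \<Rightarrow> 'b::real_normed_vector"
  assumes "Ck_on n f S" "open S"
  shows "Ck_on n (\<lambda>s::real. f (p + s *\<^sub>R d)) {s. p + s *\<^sub>R d \<in> S}"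
proof -
  have op: "open {s::real. p + s *\<^sub>R d \<in> S}"
    using open_vimage[OF assms(2), of "\<lambda>s. p + s *\<^sub>R d"] by (simp add: vimage_def continuous_intros)
  show ?thesis
    using assms(1)
  proof (induction n arbitrary: f)
    case 0
    then show ?case
      by (auto intro!: continuous_on_compose2[of S f] continuous_intros)
  next
    case (Suc n)
    let ?S = "{s::real. p + s *\<^sub>R d \<in> S}"
    have der: "((\<lambda>s. f (p + s *\<^sub>R d)) has_derivative (\<lambda>t. t *\<^sub>R frechet_derivative f (at (p + s *\<^sub>R d)) d)) (at s)"
      if "s \<in> ?S" for s
    proof -
      have f: "(f has_derivative frechet_derivative f (at (p + s *\<^sub>R d))) (at (p + s *\<^sub>R d))"
        using Suc.prems that by (simp add: frechet_derivative_works)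
      have "((\<lambda>s. p + s *\<^sub>R d) has_derivative (\<lambda>t. t *\<^sub>R d)) (at s)" by (auto intro!: derivative_eq_intros)
      from has_derivative_compose[OF this f] show ?thesis
        by (simp add: linear_cmul[OF has_derivative_linear[OF f]])
    qed
    have "Ck_on n (\<lambda>s. frechet_derivative (\<lambda>s. f (p + s *\<^sub>R d)) (at s) t) ?S" for t
    proof (rule Ck_on_cong)
      have "Ck_on n (\<lambda>x. frechet_derivative f (at x) d) S" using Suc.prems by simp
      from Suc.IH[OF this] show "Ck_on n (\<lambda>s. t *\<^sub>R frechet_derivative f (at (p + s *\<^sub>R d)) d) ?S"
        using op by (rule Ck_on_scaleR)
      show "t *\<^sub>R frechet_derivative f (at (p + s *\<^sub>R d)) d = frechet_derivative (\<lambda>s. f (p + s *\<^sub>R d)) (at s) t"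
        if "s \<in> ?S" for s
        by (simp flip: frechet_derivative_at[OF der[OF that]])
    qed (fact op)
    then show ?case using der by (auto simp: differentiable_def)
  qed
qed

text \<open>
  A source of curves that witness membership in \<^const>\<open>tangent_space\<close>, which are required to be
  smooth of every order: a straight line in a chart of the second factor, followed by \<open>f\<close>.
\<close>

lemma smooth_map_on_line:
  fixes d :: "'f::real_normed_vector"
  assumes f: "smooth_map_on (prod_mfd M1 M2) M' W f"
    and M1: "smooth_manifold M1" and M2: "smooth_manifold M2"
    and x: "x \<in> mcarrier M1" and y: "y \<in> mcarrier M2" and W: "{x} \<times> mcarrier M2 \<subseteq> W"
  defines "line \<equiv> \<lambda>s::real. chart_inv (chart_at M2 y) (snd (chart_at M2 y) y + s *\<^sub>R d)"
  obtains \<epsilon> where "\<epsilon> > 0" "\<And>s. s \<in> {-\<epsilon><..<\<epsilon>} \<Longrightarrow> line s \<in> mcarrier M2"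
    "smooth_map_on real_mfd M' {-\<epsilon><..<\<epsilon>} (\<lambda>s. f (x, line s))"
proof -
  let ?c1 = "chart_at M1 x" and ?c2 = "chart_at M2 y"
  let ?c = "(fst ?c1 \<times> fst ?c2, map_prod (snd ?c1) (snd ?c2))"
  let ?p = "(snd ?c1 x, snd ?c2 y)"
  note inj = inj_charts_prod[OF inj_charts_manifold[OF M1] inj_charts_manifold[OF M2]]
  note c1 = chart_at_in[OF x] chart_at_mem[OF x] and c2 = chart_at_in[OF y] chart_at_mem[OF y]
  have c: "?c \<in> prod_mfd M1 M2" using c1 c2 unfolding prod_mfd_def by blast
  have "open (snd ?c2 ` fst ?c2)" using M2 c2 by (auto simp: smooth_manifold_def is_chart_def)
  then have "open ((\<lambda>s. snd ?c2 y + s *\<^sub>R d) -` (snd ?c2 ` fst ?c2))"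
    by (intro open_vimage) (auto intro!: continuous_intros)
  moreover have "(0::real) \<in> (\<lambda>s. snd ?c2 y + s *\<^sub>R d) -` (snd ?c2 ` fst ?c2)" using c2 by auto
  ultimately obtain \<epsilon> where \<epsilon>: "\<epsilon> > 0" and ball: "ball 0 \<epsilon> \<subseteq> (\<lambda>s::real. snd ?c2 y + s *\<^sub>R d) -` (snd ?c2 ` fst ?c2)"
    by (meson open_contains_ball)
  let ?I = "{-\<epsilon><..<\<epsilon>}"
  have I: "snd ?c2 y + s *\<^sub>R d \<in> snd ?c2 ` fst ?c2" if "s \<in> ?I" for s
    using ball that by (auto simp: subset_iff)
  have line: "line s \<in> fst ?c2" "snd ?c2 (line s) = snd ?c2 y + s *\<^sub>R d" if "s \<in> ?I" for s
    unfolding line_def using chart_inv_mem[OF I[OF that]] chart_chart_inv[OF I[OF that]] by auto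
  have lineM: "line s \<in> mcarrier M2" if "s \<in> ?I" for s
    using line(1)[OF that] c2 by (auto simp: mcarrier_def)
  have P: "snd ?c (x, line s) = ?p + s *\<^sub>R (0, d)" if "s \<in> ?I" for s
    using line[OF that] by simp
  have Pinv: "chart_inv ?c (?p + s *\<^sub>R (0, d)) = (x, line s)" if "s \<in> ?I" for s
    using chart_inv_chart[OF inj c, of "(x, line s)"] P[OF that] line[OF that] c1 by simp
  have "smooth_on (\<lambda>s. snd c' (f (x, line s))) {s \<in> ?I. f (x, line s) \<in> fst c'}" if c': "c' \<in> M'" for c'
  proof -
    let ?loc = "snd c' \<circ> f \<circ> chart_inv ?c"
    let ?A = "snd ?c ` {q \<in> fst ?c \<inter> W. f q \<in> fst c'}"
    have sm: "smooth_on ?loc ?A" using f c c' unfolding smooth_map_on_def by blast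
    then have opA: "open ?A" by (simp add: smooth_on_def)
    have set: "{s \<in> ?I. f (x, line s) \<in> fst c'} = ?I \<inter> {s. ?p + s *\<^sub>R (0, d) \<in> ?A}"
    proof (rule Set.set_eqI, rule iffI)
      fix s assume "s \<in> {s \<in> ?I. f (x, line s) \<in> fst c'}"
      then have s: "s \<in> ?I" "f (x, line s) \<in> fst c'" by auto
      have "(x, line s) \<in> {q \<in> fst ?c \<inter> W. f q \<in> fst c'}" using s line(1)[OF s(1)] lineM[OF s(1)] W c1 by auto
      then have "snd ?c (x, line s) \<in> ?A" by (rule imageI)
      then show "s \<in> ?I \<inter> {s. ?p + s *\<^sub>R (0, d) \<in> ?A}" using s P[OF s(1)] by simp
    next
      fix s assume "s \<in> ?I \<inter> {s. ?p + s *\<^sub>R (0, d) \<in> ?A}"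
      then have s: "s \<in> ?I" and "?p + s *\<^sub>R (0, d) \<in> ?A" by auto
      then obtain q where q: "q \<in> fst ?c" "f q \<in> fst c'" "?p + s *\<^sub>R (0, d) = snd ?c q" by blast
      have "chart_inv ?c (snd ?c q) = q" using chart_inv_chart[OF inj c q(1)] .
      then have "q = (x, line s)" using Pinv[OF s] by (simp only: q(3))
      with q s show "s \<in> {s \<in> ?I. f (x, line s) \<in> fst c'}" by simp
    qed
    have op2: "open {s. ?p + s *\<^sub>R (0, d) \<in> ?A}"
      using open_vimage[OF opA, of "\<lambda>s. ?p + s *\<^sub>R (0, d)"]
      by (simp add: vimage_def continuous_intros del: scaleR_Pair add_Pair)
    then have op: "open {s \<in> ?I. f (x, line s) \<in> fst c'}" unfolding set by (intro open_Int) auto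
    have "Ck_on n (\<lambda>s. snd c' (f (x, line s))) {s \<in> ?I. f (x, line s) \<in> fst c'}" for n
    proof (rule Ck_on_cong)
      have "Ck_on n ?loc ?A" using sm unfolding smooth_on_def by blast
      from Ck_on_line[OF this opA]
      show "Ck_on n (\<lambda>s. ?loc (?p + s *\<^sub>R (0, d))) {s \<in> ?I. f (x, line s) \<in> fst c'}"
        by (rule Ck_on_subset) (unfold set, blast)
      show "?loc (?p + s *\<^sub>R (0, d)) = snd c' (f (x, line s))" if "s \<in> {s \<in> ?I. f (x, line s) \<in> fst c'}" for s
        using Pinv[of s] that by (simp only: comp_def) simp
    qed (fact op)
    then show ?thesis using op by (simp add: smooth_on_def)
  qed
  moreover have "(\<lambda>s. f (x, line s)) ` ?I \<subseteq> mcarrier M'"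
    using f W lineM by (fastforce simp: smooth_map_on_def)
  ultimately have "smooth_map_on real_mfd M' ?I (\<lambda>s. f (x, line s))"
    by (simp add: smooth_map_on_def openin_real, simp add: real_mfd_def chart_inv_real comp_def)
  with \<epsilon> lineM that show thesis by blast
qed

section \<open>Uniqueness of derivatives, direct sums and orbits\<close>

lemma has_derivative_at_point:
  assumes "(f has_derivative T) (at p)" "(g has_derivative E) (at y)" "g y = p"
  shows "((\<lambda>y. f (g y)) has_derivative (\<lambda>v. T (E v))) (at y)"
  using has_derivative_compose[OF assms(2), of f T] assms(1,3) by simp

lemma has_derivative_eventually_unique:
  assumes "(f has_derivative D) (at z)" "\<forall>\<^sub>F y in nhds z. f y = g y" "(g has_derivative E) (at z)"
  shows "D = E"
proof -
  have "(f has_derivative E) (at z)"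
  proof (rule has_derivative_transform_eventually[OF assms(3)])
    show "\<forall>\<^sub>F y in at z. g y = f y" "g z = f z"
      using assms(2) eventually_nhds_x_imp_x[OF assms(2)] by (auto simp: eventually_at_filter elim: eventually_mono)
  qed simp
  with assms(1) show ?thesis by (rule has_derivative_unique)
qed

lemma direct_sum2D:
  assumes "direct_sum V [A, B]"
  shows "V = {a + b | a b. a \<in> A \<and> b \<in> B}"
proof -
  have "V = sum_list ` listset [A, B]" using assms by (simp add: direct_sum_def bij_betw_def)
  also have "listset [A, B] = (\<lambda>(a, b). [a, b]) ` (A \<times> B)" by (auto simp: set_Cons_def)
  finally show ?thesis by force
qed

lemma direct_sum4_unique:
  assumes ds: "direct_sum V [A, B, C, E]"
    and "a \<in> A" "b \<in> B" "c \<in> C" "e \<in> E" "a' \<in> A" "b' \<in> B" "c' \<in> C" "e' \<in> E"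
    and "a + (b + (c + e)) = a' + (b' + (c' + e'))"
  shows "a = a'" "b = b'" "c = c'" "e = e'"
proof -
  have inj: "inj_on sum_list (listset [A, B, C, E])"
    using ds by (simp add: direct_sum_def bij_betw_def)
  have "[a, b, c, e] = [a', b', c', e']"
    by (rule inj_onD[OF inj]) (use assms in \<open>auto simp: set_Cons_def\<close>)
  then show "a = a'" "b = b'" "c = c'" "e = e'" by auto
qed

lemma smooth_subbundle_subspace:
  assumes "smooth_subbundle M E" "x \<in> mcarrier M" shows "subspace (E x)"
proof -
  obtain W Z and n :: nat where "x \<in> W \<and> openin (mtop M) W \<and> (\<forall>i<n. smooth_vector_field_on M W (Z i)) \<and>
     (\<forall>y\<in>W. inj_on (\<lambda>i. Z i y) {..<n} \<and> independent ((\<lambda>i. Z i y) ` {..<n}) \<and>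
            E y = span ((\<lambda>i. Z i y) ` {..<n}))"
    using bspec[OF assms(1)[unfolded smooth_subbundle_def] assms(2)] by (elim exE)
  then have "E x = span ((\<lambda>i. Z i x) ` {..<n})" by simp
  then show ?thesis by simp
qed

lemma the_elem_orbit:
  assumes "group G" "\<And>g. g \<in> carrier G \<Longrightarrow> f (\<phi> g x) = y"
  shows "the_elem (f ` orbit G \<phi> x) = y"
proof -
  have "carrier G \<noteq> {}" using group.is_monoid[OF assms(1)] monoid.one_closed by fastforce
  then have "f ` orbit G \<phi> x = {y}" using assms(2) by (fastforce simp: orbit_def)
  then show ?thesis by simp
qed

section \<open>The differential of the discrete action\<close>

definition D1Ld ::
  "('q, 'e::real_normed_vector, 'z) nh_system_scheme \<Rightarrow> 'q \<Rightarrow> 'q \<Rightarrow> 'e \<Rightarrow> real" where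
  "D1Ld X a b = mfderiv (Qm X) real_mfd (\<lambda>x. Ld X (x, b)) a"

definition D2Ld ::
  "('q, 'e::real_normed_vector, 'z) nh_system_scheme \<Rightarrow> 'q \<Rightarrow> 'q \<Rightarrow> 'e \<Rightarrow> real" where
  "D2Ld X a b = mfderiv (Qm X) real_mfd (\<lambda>x. Ld X (a, x)) b"

lemma Ld_has_derivative:
  assumes X: "nonholonomic_system X"
    and F: "has_tangent_map (Qm X) F z D" and G: "has_tangent_map (Qm X) G z E"
  shows "((\<lambda>y. Ld X (F y, G y)) has_derivative (\<lambda>v. D1Ld X (F z) (G z) (D v) + D2Ld X (F z) (G z) (E v))) (at z)"
proof -
  have "smooth_map (prod_mfd (Qm X) (Qm X)) real_mfd (Ld X)" and Q: "smooth_manifold (Qm X)"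
    using X by (auto simp: nonholonomic_system_def)
  from smooth_map_on_total[OF this(1) Q Q inj_charts_real F G]
    has_tangent_map_carrier[OF F] has_tangent_map_carrier[OF G]
  show ?thesis by (simp add: D1Ld_def D2Ld_def mcarrier_prod has_tangent_map_real)
qed

lemma d_discrete_action_eq:
  assumes X: "nonholonomic_system X" and q: "\<And>k. k \<le> N \<Longrightarrow> q k \<in> Qset X"
  shows "d_discrete_action X N q \<delta> =
    (\<Sum>k<N. D1Ld X (q k) (q (Suc k)) (\<delta> k) + D2Ld X (q k) (q (Suc k)) (\<delta> (Suc k)))"
proof -
  have Q: "smooth_manifold (Qm X)" using X by (simp add: nonholonomic_system_def)
  define c where "c k s = chart_inv (chart_at (Qm X) (q k)) (snd (chart_at (Qm X) (q k)) (q k) + s *\<^sub>R \<delta> k)"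
    for k and s :: real
  have c: "has_tangent_map (Qm X) (c k) 0 (\<lambda>s. s *\<^sub>R \<delta> k)" and c0: "c k 0 = q k" if "k \<le> N" for k
    using has_tangent_map_line[OF Q q[OF that], of "\<delta> k"]
      chart_inv_chart[OF inj_charts_manifold[OF Q] chart_at_in chart_at_mem, OF q q, OF that that]
    by (auto simp: c_def[abs_def])
  have "((\<lambda>s. discrete_action X N (\<lambda>k. c k s)) has_derivative
      (\<lambda>s. \<Sum>k<N. D1Ld X (q k) (q (Suc k)) (s *\<^sub>R \<delta> k) + D2Ld X (q k) (q (Suc k)) (s *\<^sub>R \<delta> (Suc k)))) (at 0)"
    unfolding discrete_action_def
  proof (rule has_derivative_sum)
    fix k assume "k \<in> {..<N}"
    then have "k \<le> N" "Suc k \<le> N" by auto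
    from Ld_has_derivative[OF X c[OF this(1)] c[OF this(2)]] c0[OF this(1)] c0[OF this(2)]
    show "((\<lambda>s. Ld X (c k s, c (Suc k) s)) has_derivative
      (\<lambda>s. D1Ld X (q k) (q (Suc k)) (s *\<^sub>R \<delta> k) + D2Ld X (q k) (q (Suc k)) (s *\<^sub>R \<delta> (Suc k)))) (at 0)" by simp
  qed
  note der = this
  have "(\<lambda>s. \<Sum>k<N. D1Ld X (q k) (q (Suc k)) (s *\<^sub>R \<delta> k) + D2Ld X (q k) (q (Suc k)) (s *\<^sub>R \<delta> (Suc k))) =
      (*) (\<Sum>k<N. D1Ld X (q k) (q (Suc k)) (\<delta> k) + D2Ld X (q k) (q (Suc k)) (\<delta> (Suc k)))"
    using linear_cmul[OF has_derivative_linear[OF der], of _ 1] by (auto simp: mult.commute)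
  with der have "((\<lambda>s. discrete_action X N (\<lambda>k. c k s)) has_real_derivative
    (\<Sum>k<N. D1Ld X (q k) (q (Suc k)) (\<delta> k) + D2Ld X (q k) (q (Suc k)) (\<delta> (Suc k)))) (at 0)"
    by (simp add: has_field_derivative_def)
  then show ?thesis unfolding d_discrete_action_def c_def[symmetric] by (rule DERIV_imp_deriv)
qed

section \<open>The group action and the affine discrete connection\<close>

locale discrete_reduction =
  fixes X :: "('q, 'e::real_normed_vector, 'g, 'f::real_normed_vector, 'b::real_normed_vector) conn_system"
  assumes system: "nonholonomic_system X"
    and symmetry: "symmetry_group X"
    and connection: "connection_data X"
    and discrete_connection: "affine_discrete_connection X"
begin

lemma manifold_Q: "smooth_manifold (Qm X)"
  using system by (simp add: nonholonomic_system_def)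

lemma manifold_G: "smooth_manifold (Gm X)" and carrier_G: "mcarrier (Gm X) = carrier (Grp X)"
  using symmetry by (auto simp: symmetry_group_def lie_group_def)

lemma manifold_B: "smooth_manifold (Bm X)"
  using symmetry by (simp add: symmetry_group_def principal_bundle_def)

lemmas inj_Q = inj_charts_manifold[OF manifold_Q]
  and inj_G = inj_charts_manifold[OF manifold_G]
  and inj_B = inj_charts_manifold[OF manifold_B]

sublocale G: group "Grp X"
  using symmetry by (simp add: symmetry_group_def lie_group_def)

sublocale action: group_action "Grp X" "Qset X" "act X"
  using symmetry by (simp add: symmetry_group_def)

lemma act_closed [simp]: "g \<in> carrier (Grp X) \<Longrightarrow> a \<in> Qset X \<Longrightarrow> act X g a \<in> Qset X"
  using action.element_image by blast

lemma act_mult: "g \<in> carrier (Grp X) \<Longrightarrow> h \<in> carrier (Grp X) \<Longrightarrow> a \<in> Qset X \<Longrightarrow>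
    act X (g \<otimes>\<^bsub>Grp X\<^esub> h) a = act X g (act X h a)"
  using action.composition_rule by blast

lemma act_one [simp]: "a \<in> Qset X \<Longrightarrow> act X \<one>\<^bsub>Grp X\<^esub> a = a"
  using action.id_eq_one by (metis restrict_apply')

lemma act_inv_act [simp]: "g \<in> carrier (Grp X) \<Longrightarrow> a \<in> Qset X \<Longrightarrow> act X (inv\<^bsub>Grp X\<^esub> g) (act X g a) = a"
  by (simp flip: act_mult)

lemma act_free:
  assumes "g \<in> carrier (Grp X)" "h \<in> carrier (Grp X)" "a \<in> Qset X" "act X g a = act X h a"
  shows "g = h"
proof -
  have "act X (inv\<^bsub>Grp X\<^esub> h \<otimes>\<^bsub>Grp X\<^esub> g) a = a" using assms by (simp add: act_mult)
  then have "inv\<^bsub>Grp X\<^esub> h \<otimes>\<^bsub>Grp X\<^esub> g = \<one>\<^bsub>Grp X\<^esub>"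
    using symmetry assms by (auto simp: symmetry_group_def)
  then show ?thesis using G.inv_equality[of "inv\<^bsub>Grp X\<^esub> h" g] assms G.inv_comm[of "inv\<^bsub>Grp X\<^esub> h" g]
    by (metis G.inv_closed G.inv_inv)
qed

lemma tau_eq: "g \<in> carrier (Grp X) \<Longrightarrow> a \<in> Qset X \<Longrightarrow> tau X (act X g a) a = g"
  unfolding tau_def by (rule the_equality) (auto dest: act_free)

lemma proj_closed [simp]: "a \<in> Qset X \<Longrightarrow> proj X a \<in> mcarrier (Bm X)"
  using symmetry by (auto simp: symmetry_group_def principal_bundle_def orbits_def proj_def)

lemma mem_proj_iff: "b \<in> proj X a \<longleftrightarrow> (\<exists>g\<in>carrier (Grp X). b = act X g a)"
  by (auto simp: proj_def orbit_def)

lemma proj_act [simp]: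
  assumes "g \<in> carrier (Grp X)" "a \<in> Qset X" shows "proj X (act X g a) = proj X a"
proof (rule Set.set_eqI)
  fix x
  have "(\<exists>h\<in>carrier (Grp X). x = act X h (act X g a)) \<longleftrightarrow> (\<exists>h\<in>carrier (Grp X). x = act X h a)"
  proof safe
    fix h assume "h \<in> carrier (Grp X)"
    then show "\<exists>h'\<in>carrier (Grp X). act X h (act X g a) = act X h' a"
      using assms by (intro bexI[of _ "h \<otimes>\<^bsub>Grp X\<^esub> g"]) (auto simp: act_mult)
    from \<open>h \<in> carrier (Grp X)\<close> show "\<exists>h'\<in>carrier (Grp X). act X h a = act X h' (act X g a)"
      using assms by (intro bexI[of _ "h \<otimes>\<^bsub>Grp X\<^esub> inv\<^bsub>Grp X\<^esub> g"]) (auto simp: act_mult)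
  qed
  then show "x \<in> proj X (act X g a) \<longleftrightarrow> x \<in> proj X a" by (simp add: mem_proj_iff)
qed

lemma proj_eqD:
  assumes "proj X a = proj X b" "b \<in> Qset X"
  obtains g where "g \<in> carrier (Grp X)" "b = act X g a"
proof -
  have "b \<in> proj X b" unfolding mem_proj_iff using assms by (intro bexI[of _ "\<one>\<^bsub>Grp X\<^esub>"]) auto
  then have "b \<in> proj X a" using assms(1) by simp
  then show thesis using that by (auto simp: mem_proj_iff)
qed

lemma Gconj_closed [simp]: "g \<in> carrier (Grp X) \<Longrightarrow> w \<in> carrier (Grp X) \<Longrightarrow> Gconj X g w \<in> carrier (Grp X)"
  by (simp add: Gconj_def)

lemma Gconj_one [simp]: "w \<in> carrier (Grp X) \<Longrightarrow> Gconj X \<one>\<^bsub>Grp X\<^esub> w = w"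
  by (simp add: Gconj_def)

lemma Gconj_mult: "g \<in> carrier (Grp X) \<Longrightarrow> h \<in> carrier (Grp X) \<Longrightarrow> w \<in> carrier (Grp X) \<Longrightarrow>
    Gconj X (g \<otimes>\<^bsub>Grp X\<^esub> h) w = Gconj X g (Gconj X h w)"
  by (simp add: Gconj_def G.inv_mult_group G.m_assoc)

lemma rho_act [simp]:
  assumes "g \<in> carrier (Grp X)" "a \<in> Qset X" "w \<in> carrier (Grp X)"
  shows "rho X (act X g a) (Gconj X g w) = rho X a w"
proof -
  have 1: "rho X (act X g a) (Gconj X g w) \<subseteq> rho X a w"
    if "g \<in> carrier (Grp X)" "a \<in> Qset X" "w \<in> carrier (Grp X)" for g a w
    unfolding rho_def orbit_def QG_act_def using that
    by (auto simp flip: act_mult Gconj_mult)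
  have "rho X a w = rho X (act X (inv\<^bsub>Grp X\<^esub> g) (act X g a)) (Gconj X (inv\<^bsub>Grp X\<^esub> g) (Gconj X g w))"
    using assms by (simp flip: Gconj_mult)
  then show ?thesis using 1[of "inv\<^bsub>Grp X\<^esub> g" "act X g a" "Gconj X g w"] 1[OF assms] assms by auto
qed

lemma rho_mem: "a \<in> Qset X \<Longrightarrow> w \<in> carrier (Grp X) \<Longrightarrow> (a, w) \<in> rho X a w"
  unfolding rho_def orbit_def QG_act_def by (auto intro!: exI[of _ "\<one>\<^bsub>Grp X\<^esub>"])

lemma rho_eqD:
  assumes "rho X a w = rho X a' w'" "a \<in> Qset X" "a' \<in> Qset X" "w \<in> carrier (Grp X)" "w' \<in> carrier (Grp X)"
  obtains g where "g \<in> carrier (Grp X)" "a' = act X g a" "w' = Gconj X g w"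
  using rho_mem[OF assms(3,5)] that unfolding assms(1)[symmetric] by (auto simp: rho_def orbit_def QG_act_def)

lemma w_rep_eq:
  assumes "a \<in> Qset X" "w \<in> carrier (Grp X)" shows "w_rep X a (rho X a w) = w"
  unfolding w_rep_def
proof (rule the_equality)
  fix w' assume w': "w' \<in> carrier (Grp X) \<and> rho X a w' = rho X a w"
  then obtain g where g: "g \<in> carrier (Grp X)" "a = act X g a" "w = Gconj X g w'"
    using assms by (auto elim: rho_eqD)
  then have "g = \<one>\<^bsub>Grp X\<^esub>" using act_free[of g "\<one>\<^bsub>Grp X\<^esub>" a] assms by simp
  then show "w' = w" using g w' by simp
qed (use assms in auto)

lemma pQG_rho:
  assumes "a \<in> Qset X" shows "pQG X (rho X a w) = proj X a"
  unfolding pQG_def rho_def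
  by (rule the_elem_orbit) (auto simp: QG_act_def assms G.is_group)

lemma frakU_memD: "(a, b) \<in> frakU X \<Longrightarrow> a \<in> Qset X" "(a, b) \<in> frakU X \<Longrightarrow> b \<in> Qset X"
  by (auto simp: frakU_def)

lemma frakU_act:
  "(a, b) \<in> frakU X \<Longrightarrow> g \<in> carrier (Grp X) \<Longrightarrow> h \<in> carrier (Grp X) \<Longrightarrow> (act X g a, act X h b) \<in> frakU X"
  by (auto simp: frakU_def)

lemma Adisc_ex1:
  assumes "(a, b) \<in> frakU X"
  shows "\<exists>!g. g \<in> carrier (Grp X) \<and> (a, act X (inv\<^bsub>Grp X\<^esub> g) b) \<in> Hor X \<inter> Unb X"
proof -
  have "\<forall>(q0, q1)\<in>frakU X. \<exists>!g. g \<in> carrier (Grp X) \<and> (q0, act X (inv\<^bsub>Grp X\<^esub> g) q1) \<in> Hor X \<inter> Unb X"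
    using discrete_connection unfolding affine_discrete_connection_def by (elim conjE)
  from bspec[OF this assms] show ?thesis by simp
qed

lemma
  assumes "(a, b) \<in> frakU X"
  shows Adisc_closed: "Adisc X a b \<in> carrier (Grp X)"
    and Adisc_mem: "(a, act X (inv\<^bsub>Grp X\<^esub> (Adisc X a b)) b) \<in> Hor X \<inter> Unb X"
  using theI'[OF Adisc_ex1[OF assms]] unfolding Adisc_def[symmetric] by (rule conjunct1, rule conjunct2)

lemma Adisc_eqI:
  assumes "(a, b) \<in> frakU X" "g \<in> carrier (Grp X)" "(a, act X (inv\<^bsub>Grp X\<^esub> g) b) \<in> Hor X \<inter> Unb X"
  shows "Adisc X a b = g"
  unfolding Adisc_def using Adisc_ex1[OF assms(1)] conjI[OF assms(2,3)] by (rule the1_equality)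

lemma Hor_Unb_act: "(a, b) \<in> Hor X \<inter> Unb X \<Longrightarrow> g \<in> carrier (Grp X) \<Longrightarrow> (act X g a, act X g b) \<in> Hor X \<inter> Unb X"
proof -
  assume ab: "(a, b) \<in> Hor X \<inter> Unb X" and g: "g \<in> carrier (Grp X)"
  have "\<forall>g\<in>carrier (Grp X). diag_act X g ` Hor X \<subseteq> Hor X"
    using discrete_connection unfolding affine_discrete_connection_def by (elim conjE)
  moreover have "\<forall>g\<in>carrier (Grp X). diag_act X g ` Unb X \<subseteq> Unb X"
    using discrete_connection unfolding affine_discrete_connection_def by (elim conjE)
  moreover have "(act X g a, act X g b) = diag_act X g (a, b)" by (simp add: diag_act_def)
  ultimately show ?thesis using ab g by blast
qed

lemma Adisc_act:
  assumes ab: "(a, b) \<in> frakU X" and g: "g \<in> carrier (Grp X)" and h: "h \<in> carrier (Grp X)"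
  shows "Adisc X (act X g a) (act X h b) = h \<otimes>\<^bsub>Grp X\<^esub> Adisc X a b \<otimes>\<^bsub>Grp X\<^esub> inv\<^bsub>Grp X\<^esub> g"
proof (rule Adisc_eqI)
  note A = Adisc_closed[OF ab] and Q = frakU_memD[OF ab]
  have "act X (inv\<^bsub>Grp X\<^esub> (h \<otimes>\<^bsub>Grp X\<^esub> Adisc X a b \<otimes>\<^bsub>Grp X\<^esub> inv\<^bsub>Grp X\<^esub> g)) (act X h b) =
      act X g (act X (inv\<^bsub>Grp X\<^esub> (Adisc X a b)) b)"
    using A Q g h by (simp add: G.inv_mult_group act_mult)
  then show "(act X g a, act X (inv\<^bsub>Grp X\<^esub> (h \<otimes>\<^bsub>Grp X\<^esub> Adisc X a b \<otimes>\<^bsub>Grp X\<^esub> inv\<^bsub>Grp X\<^esub> g)) (act X h b)) \<in> Hor X \<inter> Unb X"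
    using Hor_Unb_act[OF Adisc_mem[OF ab] g] by simp
qed (simp_all add: g h Adisc_closed[OF ab] frakU_act[OF ab g h])

lemma Adisc_diag:
  "(a, b) \<in> frakU X \<Longrightarrow> g \<in> carrier (Grp X) \<Longrightarrow> Adisc X (act X g a) (act X g b) = Gconj X g (Adisc X a b)"
  by (simp add: Adisc_act Gconj_def)

text \<open>
  Every point \<open>b\<close> of the target orbit yields the discrete horizontal lift, because \<open>\<A>\<^sub>d(a, g b) = g \<A>\<^sub>d(a, b)\<close>
  equals the identity for exactly one \<open>g\<close>.  This replaces the definite description by an expression
  that depends smoothly on \<open>a\<close> and \<open>b\<close>.
\<close>

lemma hd_bar_eq:
  assumes ab: "(a, b) \<in> frakU X"
  shows "hd_bar X a (proj X b) = act X (inv\<^bsub>Grp X\<^esub> (Adisc X a b)) b"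
  unfolding hd_bar_def
proof (rule the_equality)
  note A = Adisc_closed[OF ab] and Q = frakU_memD[OF ab]
  have A2: "Adisc X a (act X g b) = g \<otimes>\<^bsub>Grp X\<^esub> Adisc X a b" if "g \<in> carrier (Grp X)" for g
    using Adisc_act[OF ab G.one_closed that] A Q that by simp
  show "act X (inv\<^bsub>Grp X\<^esub> (Adisc X a b)) b \<in> Qset X \<and> proj X (act X (inv\<^bsub>Grp X\<^esub> (Adisc X a b)) b) = proj X b \<and>
      Adisc X a (act X (inv\<^bsub>Grp X\<^esub> (Adisc X a b)) b) = \<one>\<^bsub>Grp X\<^esub>"
    using A Q A2 by simp
  fix c assume c: "c \<in> Qset X \<and> proj X c = proj X b \<and> Adisc X a c = \<one>\<^bsub>Grp X\<^esub>"
  then have "proj X b = proj X c" "c \<in> Qset X" by auto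
  then obtain g where g: "g \<in> carrier (Grp X)" "c = act X g b" by (rule proj_eqD)
  then have "g \<otimes>\<^bsub>Grp X\<^esub> Adisc X a b = \<one>\<^bsub>Grp X\<^esub>" using c A2 by simp
  then have "g = inv\<^bsub>Grp X\<^esub> (Adisc X a b)" using g A by (metis G.inv_equality)
  then show "c = act X (inv\<^bsub>Grp X\<^esub> (Adisc X a b)) b" using g by simp
qed

lemma F1_tilde_eq:
  assumes "(a, b) \<in> frakU X" "w \<in> carrier (Grp X)"
  shows "F1_tilde X a w (proj X b) = act X (w \<otimes>\<^bsub>Grp X\<^esub> inv\<^bsub>Grp X\<^esub> (Adisc X a b)) b"
  using assms frakU_memD[OF assms(1)] Adisc_closed[OF assms(1)]
  by (simp add: F1_tilde_def hd_bar_eq act_mult)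

lemma F1_tilde_closed: "(a, b) \<in> frakU X \<Longrightarrow> w \<in> carrier (Grp X) \<Longrightarrow> F1_tilde X a w (proj X b) \<in> Qset X"
  by (simp add: F1_tilde_eq Adisc_closed frakU_memD)

lemma F1_tilde_Adisc: "(a, b) \<in> frakU X \<Longrightarrow> F1_tilde X a (Adisc X a b) (proj X b) = b"
  by (simp add: F1_tilde_eq Adisc_closed frakU_memD)

lemma F1_tilde_equivariant:
  assumes ab: "(a, b) \<in> frakU X" and g: "g \<in> carrier (Grp X)" and w: "w \<in> carrier (Grp X)"
  shows "F1_tilde X (act X g a) (Gconj X g w) (proj X b) = act X g (F1_tilde X a w (proj X b))"
proof -
  note A = Adisc_closed[OF ab] and Q = frakU_memD[OF ab]
  have "F1_tilde X (act X g a) (Gconj X g w) (proj X (act X g b)) =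
      act X (Gconj X g w \<otimes>\<^bsub>Grp X\<^esub> inv\<^bsub>Grp X\<^esub> Gconj X g (Adisc X a b)) (act X g b)"
    using F1_tilde_eq[OF frakU_act[OF ab g g], of "Gconj X g w"] g w ab by (simp add: Adisc_diag)
  also have "\<dots> = act X g (act X (w \<otimes>\<^bsub>Grp X\<^esub> inv\<^bsub>Grp X\<^esub> (Adisc X a b)) b)"
    using A Q g w by (simp add: Gconj_def G.inv_mult_group act_mult)
  finally show ?thesis using F1_tilde_eq[OF ab w] g Q by simp
qed

lemma Ld_act:
  "g \<in> carrier (Grp X) \<Longrightarrow> a \<in> Qset X \<Longrightarrow> b \<in> Qset X \<Longrightarrow> Ld X (act X g a, act X g b) = Ld X (a, b)"
  using symmetry by (simp add: symmetry_group_def)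

lemma L_check_Adisc: "(a, b) \<in> frakU X \<Longrightarrow> L_check X a (Adisc X a b) (proj X b) = Ld X (a, b)"
  by (simp add: L_check_def F1_tilde_Adisc)

lemma L_check_eq:
  "(a, b) \<in> frakU X \<Longrightarrow> w \<in> carrier (Grp X) \<Longrightarrow>
   L_check X a w (proj X b) = Ld X (a, act X (w \<otimes>\<^bsub>Grp X\<^esub> inv\<^bsub>Grp X\<^esub> (Adisc X a b)) b)"
  by (simp add: L_check_def F1_tilde_eq)

lemma L_check_equivariant:
  "(a, b) \<in> frakU X \<Longrightarrow> g \<in> carrier (Grp X) \<Longrightarrow> w \<in> carrier (Grp X) \<Longrightarrow>
   L_check X (act X g a) (Gconj X g w) (proj X b) = L_check X a w (proj X b)"
  by (simp add: L_check_def F1_tilde_equivariant Ld_act F1_tilde_closed frakU_memD)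

lemma L_check_mult:
  assumes "(a, b) \<in> frakU X" "g \<in> carrier (Grp X)"
  shows "L_check X a (g \<otimes>\<^bsub>Grp X\<^esub> Adisc X a b) (proj X b) = Ld X (a, act X g b)"
  using assms Adisc_closed[OF assms(1)] by (simp add: L_check_eq G.m_assoc)

lemma Upsilon_act:
  "(a, b) \<in> frakU X \<Longrightarrow> g \<in> carrier (Grp X) \<Longrightarrow> Upsilon X (act X g a, act X g b) = Upsilon X (a, b)"
  by (simp add: Upsilon_def Adisc_diag Adisc_closed frakU_memD)

lemma Dd_act: "(a, b) \<in> Dd X \<Longrightarrow> g \<in> carrier (Grp X) \<Longrightarrow> (act X g a, act X g b) \<in> Dd X"
  using symmetry unfolding symmetry_group_def by blast

lemma Dd_hatE:
  assumes "(v, r) \<in> Dd_hat X"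
  obtains a b where "(a, b) \<in> Dd X" "(a, b) \<in> frakU X" "v = rho X a (Adisc X a b)" "r = proj X b"
proof -
  from assms obtain a b where ab: "(a, b) \<in> Dd X" "(a, b) \<in> frakU X"
    and vr: "(v, r) = Phi_A X (orbit (Grp X) (diag_act X) (a, b))"
    by (auto simp: Dd_hat_def orbits_def)
  have "Phi_A X (orbit (Grp X) (diag_act X) (a, b)) = Upsilon X (a, b)"
    unfolding Phi_A_def using ab
    by (intro the_elem_orbit) (auto simp: diag_act_def Upsilon_act G.is_group)
  then show thesis using that ab vr by (auto simp: Upsilon_def)
qed

text \<open>
  A pair in \<open>\<D>\<^sub>d\<close> over the given reduced point starts somewhere in the orbit of \<open>c\<close>; translating it
  moves its first point to \<open>c\<close>.
\<close>

lemma lift_step: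
  assumes "(v, r) \<in> Dd_hat X" "pQG X v = proj X c" "c \<in> Qset X"
  obtains c' where "(c, c') \<in> Dd X" "(c, c') \<in> frakU X" "v = rho X c (Adisc X c c')" "r = proj X c'"
proof -
  from assms(1) obtain a b where ab: "(a, b) \<in> Dd X" "(a, b) \<in> frakU X"
    and v: "v = rho X a (Adisc X a b)" and r: "r = proj X b" by (rule Dd_hatE)
  note Q = frakU_memD[OF ab(2)]
  from v assms Q have "proj X a = proj X c" by (simp add: pQG_rho)
  from this assms(3) obtain g where g: "g \<in> carrier (Grp X)" "c = act X g a" by (rule proj_eqD)
  show thesis
  proof (rule that[of "act X g b"])
    show "v = rho X c (Adisc X c (act X g b))"
      using g v ab Q by (simp add: Adisc_diag Adisc_closed)
  qed (use ab g Q r in \<open>auto simp: Dd_act frakU_act\<close>)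
qed

section \<open>Vertical vectors and the horizontal lift\<close>

lemma smooth_act: "smooth_map (prod_mfd (Gm X) (Qm X)) (Qm X) (\<lambda>(g, q). act X g q)"
  using symmetry unfolding symmetry_group_def by (elim conjE)

lemma smooth_mult: "smooth_map (prod_mfd (Gm X) (Gm X)) (Gm X) (\<lambda>(g, h). g \<otimes>\<^bsub>Grp X\<^esub> h)"
  and smooth_inv: "smooth_map (Gm X) (Gm X) (\<lambda>g. inv\<^bsub>Grp X\<^esub> g)"
proof -
  have "lie_group (Grp X) (Gm X)" using symmetry unfolding symmetry_group_def by (elim conjE)
  then show "smooth_map (prod_mfd (Gm X) (Gm X)) (Gm X) (\<lambda>(g, h). g \<otimes>\<^bsub>Grp X\<^esub> h)"
    "smooth_map (Gm X) (Gm X) (\<lambda>g. inv\<^bsub>Grp X\<^esub> g)"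
    unfolding lie_group_def by auto
qed

lemma smooth_proj: "smooth_map (Qm X) (Bm X) (proj X)"
proof -
  have "proj X = orbit (Grp X) (act X)" by (rule ext) (simp add: proj_def)
  then show ?thesis using symmetry unfolding symmetry_group_def principal_bundle_def by simp
qed

lemma smooth_Adisc:
  "smooth_map_on (prod_mfd (Qm X) (Qm X)) (Gm X) (frakU X) (\<lambda>(q0, q1). Adisc X q0 q1)"
  using discrete_connection unfolding affine_discrete_connection_def by (elim conjE)

lemma mdiff_act: "g \<in> carrier (Grp X) \<Longrightarrow> a \<in> Qset X \<Longrightarrow> mdiff (Qm X) (Qm X) (act X g) a"
  and mdiff_orbit_map: "g \<in> carrier (Grp X) \<Longrightarrow> a \<in> Qset X \<Longrightarrow> mdiff (Gm X) (Qm X) (\<lambda>g. act X g a) g"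
  using smooth_map_on_partial(1,2)[OF smooth_act manifold_G manifold_Q inj_Q, of g a]
  by (simp_all add: mcarrier_prod carrier_G)

lemma mdiff_right_mult:
  "g \<in> carrier (Grp X) \<Longrightarrow> h \<in> carrier (Grp X) \<Longrightarrow> mdiff (Gm X) (Gm X) (\<lambda>g. g \<otimes>\<^bsub>Grp X\<^esub> h) g"
  and mdiff_left_mult:
  "g \<in> carrier (Grp X) \<Longrightarrow> h \<in> carrier (Grp X) \<Longrightarrow> mdiff (Gm X) (Gm X) (\<lambda>h. g \<otimes>\<^bsub>Grp X\<^esub> h) h"
  using smooth_map_on_partial(1,2)[OF smooth_mult manifold_G manifold_G inj_G, of g h]
  by (simp_all add: mcarrier_prod carrier_G)

lemma mdiff_proj: "a \<in> Qset X \<Longrightarrow> mdiff (Qm X) (Bm X) (proj X) a"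
  by (rule smooth_map_on_mdiff[OF smooth_proj manifold_Q inj_B])

lemma mdiff_Adisc:
  assumes "(a, b) \<in> frakU X"
  shows "mdiff (Qm X) (Gm X) (\<lambda>x. Adisc X x b) a" "mdiff (Qm X) (Gm X) (\<lambda>x. Adisc X a x) b"
  using smooth_map_on_partial(1,2)[OF smooth_Adisc manifold_Q manifold_Q inj_G] assms frakU_memD[OF assms]
  by simp_all

lemma mdiff_Ld:
  assumes "a \<in> Qset X" "b \<in> Qset X"
  shows "mdiff (Qm X) real_mfd (\<lambda>x. Ld X (x, b)) a" "mdiff (Qm X) real_mfd (\<lambda>x. Ld X (a, x)) b"
proof -
  have "smooth_map (prod_mfd (Qm X) (Qm X)) real_mfd (Ld X)"
    using system by (simp add: nonholonomic_system_def)
  from smooth_map_on_partial(1,2)[OF this manifold_Q manifold_Q inj_charts_real assms]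
  show "mdiff (Qm X) real_mfd (\<lambda>x. Ld X (x, b)) a" "mdiff (Qm X) real_mfd (\<lambda>x. Ld X (a, x)) b"
    using assms by (simp_all add: mcarrier_prod)
qed

lemma linear_D1Ld: "a \<in> Qset X \<Longrightarrow> b \<in> Qset X \<Longrightarrow> linear (D1Ld X a b)"
  and linear_D2Ld: "a \<in> Qset X \<Longrightarrow> b \<in> Qset X \<Longrightarrow> linear (D2Ld X a b)"
  unfolding D1Ld_def D2Ld_def by (auto intro: mdiff_linear mdiff_Ld)

lemma linear_dproj: "a \<in> Qset X \<Longrightarrow> linear (dproj X a)"
  unfolding dproj_def by (intro mdiff_linear mdiff_proj)

lemma eventually_frakU:
  assumes "has_tangent_map (Qm X) F z D" "has_tangent_map (Qm X) G z E" "(F z, G z) \<in> frakU X"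
  shows "\<forall>\<^sub>F y in nhds z. (F y, G y) \<in> frakU X"
  by (rule smooth_map_on_tangent2(3)[OF smooth_Adisc manifold_Q manifold_Q inj_G assms])

lemma eventually_Q: "has_tangent_map (Qm X) F z D \<Longrightarrow> \<forall>\<^sub>F y in nhds z. F y \<in> Qset X"
  by (rule has_tangent_map_eventually[OF _ openin_mcarrier[OF manifold_Q] has_tangent_map_carrier])

lemma eventually_G: "has_tangent_map (Gm X) F z D \<Longrightarrow> \<forall>\<^sub>F y in nhds z. F y \<in> carrier (Grp X)"
  unfolding carrier_G[symmetric]
  by (rule has_tangent_map_eventually[OF _ openin_mcarrier[OF manifold_G] has_tangent_map_carrier])

lemma trivialization:
  assumes "r \<in> mcarrier (Bm X)"
  obtains V j i where "r \<in> V" "openin (mtop (Bm X)) V"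
    "smooth_map_on (Qm X) (Gm X) {q \<in> Qset X. proj X q \<in> V} j"
    "smooth_map_on (prod_mfd (Bm X) (Gm X)) (Qm X) (V \<times> carrier (Grp X)) i"
    "\<And>q. q \<in> Qset X \<Longrightarrow> proj X q \<in> V \<Longrightarrow> i (proj X q, j q) = q"
    "\<And>q g. q \<in> Qset X \<Longrightarrow> proj X q \<in> V \<Longrightarrow> g \<in> carrier (Grp X) \<Longrightarrow> j (act X g q) = g \<otimes>\<^bsub>Grp X\<^esub> j q"
    "\<And>s g. s \<in> V \<Longrightarrow> g \<in> carrier (Grp X) \<Longrightarrow> proj X (i (s, g)) = s"
proof -
  have "principal_bundle (Qm X) (Grp X) (Gm X) (act X) (Bm X)"
    using symmetry unfolding symmetry_group_def by (elim conjE)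
  then have "\<forall>r\<in>mcarrier (Bm X). \<exists>V j i. r \<in> V \<and> openin (mtop (Bm X)) V \<and>
        smooth_map_on (Qm X) (Gm X) {q \<in> Qset X. proj X q \<in> V} j \<and>
        smooth_map_on (prod_mfd (Bm X) (Gm X)) (Qm X) (V \<times> carrier (Grp X)) i \<and>
        (\<forall>q\<in>Qset X. proj X q \<in> V \<longrightarrow> i (proj X q, j q) = q \<and>
           (\<forall>g\<in>carrier (Grp X). j (act X g q) = g \<otimes>\<^bsub>Grp X\<^esub> j q)) \<and>
        (\<forall>s\<in>V. \<forall>g\<in>carrier (Grp X). proj X (i (s, g)) = s \<and> j (i (s, g)) = g)"
    unfolding principal_bundle_def proj_def by (elim conjE)
  from bspec[OF this assms] obtain V j i where *: "r \<in> V \<and> openin (mtop (Bm X)) V \<and>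
        smooth_map_on (Qm X) (Gm X) {q \<in> Qset X. proj X q \<in> V} j \<and>
        smooth_map_on (prod_mfd (Bm X) (Gm X)) (Qm X) (V \<times> carrier (Grp X)) i \<and>
        (\<forall>q\<in>Qset X. proj X q \<in> V \<longrightarrow> i (proj X q, j q) = q \<and>
           (\<forall>g\<in>carrier (Grp X). j (act X g q) = g \<otimes>\<^bsub>Grp X\<^esub> j q)) \<and>
        (\<forall>s\<in>V. \<forall>g\<in>carrier (Grp X). proj X (i (s, g)) = s \<and> j (i (s, g)) = g)"
    by (elim exE)
  show thesis
    by (rule that[of V j i]) (use * in simp_all)
qed

lemma exp_tangent: "has_tangent_map (Gm X) (\<lambda>t. Gexp X (t *\<^sub>R \<xi>)) 0 (\<lambda>t. t *\<^sub>R \<xi>)"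
  and exp_zero: "Gexp X 0 = \<one>\<^bsub>Grp X\<^esub>"
  and exp_closed: "Gexp X (t *\<^sub>R \<xi>) \<in> carrier (Grp X)"
proof -
  have *: "smooth_map real_mfd (Gm X) (\<lambda>t. Gexp X (t *\<^sub>R \<xi>))"
     "Gexp X ((s + t) *\<^sub>R \<xi>) = Gexp X (s *\<^sub>R \<xi>) \<otimes>\<^bsub>Grp X\<^esub> Gexp X (t *\<^sub>R \<xi>)"
     "velocity (Gm X) (\<lambda>t. Gexp X (t *\<^sub>R \<xi>)) = \<xi>" for \<xi> s t
    using symmetry by (auto simp: symmetry_group_def exponential_map_def)
  show "has_tangent_map (Gm X) (\<lambda>t. Gexp X (t *\<^sub>R \<xi>)) 0 (\<lambda>t. t *\<^sub>R \<xi>)"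
    using smooth_curve_tangent[OF *(1) _ inj_G, of \<xi>] *(3)[of \<xi>] by simp
  show cl: "Gexp X (t *\<^sub>R \<xi>) \<in> carrier (Grp X)" for t \<xi>
    using *(1)[of \<xi>] by (auto simp: smooth_map_on_def carrier_G)
  from *(2)[of 0 0 0] cl[of 0 0] show "Gexp X 0 = \<one>\<^bsub>Grp X\<^esub>" by simp
qed

lemma inf_gen_tangent:
  assumes "a \<in> Qset X"
  shows "has_tangent_map (Qm X) (\<lambda>t. act X (Gexp X (t *\<^sub>R \<xi>)) a) 0 (\<lambda>t. t *\<^sub>R inf_gen X \<xi> a)"
    and "inf_gen X \<xi> a = mfderiv (Gm X) (Qm X) (\<lambda>g. act X g a) \<one>\<^bsub>Grp X\<^esub> \<xi>"
proof -
  let ?d = "mfderiv (Gm X) (Qm X) (\<lambda>g. act X g a) \<one>\<^bsub>Grp X\<^esub>"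
  have m: "mdiff (Gm X) (Qm X) (\<lambda>g. act X g a) \<one>\<^bsub>Grp X\<^esub>"
    by (intro mdiff_orbit_map G.one_closed assms)
  have t: "has_tangent_map (Qm X) (\<lambda>t. act X (Gexp X (t *\<^sub>R \<xi>)) a) 0 (\<lambda>t. ?d (t *\<^sub>R \<xi>))"
    using mdiff_tangent[OF manifold_G _ exp_tangent, of "Qm X" "\<lambda>g. act X g a" \<xi>] m by (simp add: exp_zero)
  then show eq: "inf_gen X \<xi> a = ?d \<xi>" by (simp add: inf_gen_def velocity_eq)
  show "has_tangent_map (Qm X) (\<lambda>t. act X (Gexp X (t *\<^sub>R \<xi>)) a) 0 (\<lambda>t. t *\<^sub>R inf_gen X \<xi> a)"
    using t unfolding eq by (simp add: linear_cmul[OF mdiff_linear[OF m]])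
qed

text \<open>
  A curve \<open>c\<close> in the orbit of \<open>a\<close> has the form \<open>c t = \<delta> t a\<close> with \<open>\<delta>\<close> read off from the \<open>G\<close>-component of a
  local trivialization.  So \<open>\<delta>\<close> is differentiable, and \<open>c\<close> has the same velocity as the orbit of the
  one-parameter subgroup with initial velocity \<open>\<delta>'(0)\<close>.
\<close>

lemma vertical_imp_inf_gen:
  assumes a: "a \<in> Qset X" and v: "v \<in> vertical X a"
  obtains \<xi> where "v = inf_gen X \<xi> a"
proof -
  from v obtain c \<epsilon> where v: "v = velocity (Qm X) c" and c0: "c 0 = a" and \<epsilon>: "\<epsilon> > 0"
    and c: "smooth_map_on real_mfd (Qm X) {-\<epsilon><..<\<epsilon>} c" and orb: "c ` {-\<epsilon><..<\<epsilon>} \<subseteq> proj X a"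
    unfolding vertical_def tangent_space_def proj_def by blast
  obtain V j i where V: "proj X a \<in> V" and j: "smooth_map_on (Qm X) (Gm X) {q \<in> Qset X. proj X q \<in> V} j"
    and jact: "\<And>q g. q \<in> Qset X \<Longrightarrow> proj X q \<in> V \<Longrightarrow> g \<in> carrier (Grp X) \<Longrightarrow> j (act X g q) = g \<otimes>\<^bsub>Grp X\<^esub> j q"
    by (rule trivialization[OF proj_closed[OF a]]) (rule that)
  have tc: "has_tangent_map (Qm X) c 0 (\<lambda>t. t *\<^sub>R v)"
    unfolding v by (rule smooth_curve_tangent[OF c _ inj_Q]) (use \<epsilon> in auto)
  have ja: "j a \<in> carrier (Grp X)" using j a V by (auto simp: smooth_map_on_def carrier_G)
  have tj: "has_tangent_map (Gm X) (\<lambda>t. j (c t)) 0 (\<lambda>t. mfderiv (Qm X) (Gm X) j (c 0) (t *\<^sub>R v))"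
    by (rule smooth_map_on_tangent[OF j manifold_Q inj_G tc]) (use a V c0 in auto)
  define \<delta> where "\<delta> t = j (c t) \<otimes>\<^bsub>Grp X\<^esub> inv\<^bsub>Grp X\<^esub> (j a)" for t
  have "\<exists>D. has_tangent_map (Gm X) \<delta> 0 D"
    using mdiff_tangent[OF manifold_G _ tj, of "Gm X" "\<lambda>g. g \<otimes>\<^bsub>Grp X\<^esub> inv\<^bsub>Grp X\<^esub> (j a)"] ja c0
    by (auto simp: \<delta>_def[abs_def] mdiff_right_mult)
  then obtain D where D: "has_tangent_map (Gm X) \<delta> 0 D" by blast
  have \<delta>0: "\<delta> 0 = \<one>\<^bsub>Grp X\<^esub>" using ja c0 by (simp add: \<delta>_def)
  have "mdiff (Gm X) (Qm X) (\<lambda>g. act X g a) (\<delta> 0)" unfolding \<delta>0 by (intro mdiff_orbit_map G.one_closed a)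
  from mdiff_tangent[OF manifold_G this D]
  have t: "has_tangent_map (Qm X) (\<lambda>t. act X (\<delta> t) a) 0 (\<lambda>t. inf_gen X (D t) a)"
    unfolding \<delta>0 inf_gen_tangent(2)[OF a] .
  have "act X (\<delta> t) a = c t" if t: "t \<in> {-\<epsilon><..<\<epsilon>}" for t
  proof -
    have "c t \<in> proj X a" using orb t by blast
    then obtain g where g: "g \<in> carrier (Grp X)" "c t = act X g a" by (auto simp: mem_proj_iff)
    then have "\<delta> t = g" using jact[OF a V g(1)] ja by (simp add: \<delta>_def G.m_assoc)
    with g show ?thesis by simp
  qed
  moreover have "\<forall>\<^sub>F t in nhds 0. t \<in> {-\<epsilon><..<\<epsilon>}" using \<epsilon> by (intro eventually_nhds_in_open) auto
  ultimately have "\<forall>\<^sub>F t in nhds 0. act X (\<delta> t) a = c t" by (auto elim: eventually_mono)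
  from has_tangent_map_unique[OF has_tangent_map_cong[OF t this] tc]
  have "inf_gen X (D 1) a = v" by (metis scaleR_one)
  then show thesis using that by blast
qed

text \<open>
  In a local trivialization a vector with vanishing projection has only a \<open>G\<close>-component.  The straight
  line in that direction, in a chart of \<open>G\<close>, gives a smooth curve inside the orbit which has the
  vector as its velocity.
\<close>

lemma kernel_dproj_vertical:
  assumes a: "a \<in> Qset X" and v: "dproj X a v = 0"
  shows "v \<in> vertical X a"
proof -
  let ?r = "proj X a"
  obtain V j i where V: "?r \<in> V" and opV: "openin (mtop (Bm X)) V"
    and j: "smooth_map_on (Qm X) (Gm X) {q \<in> Qset X. proj X q \<in> V} j"
    and i: "smooth_map_on (prod_mfd (Bm X) (Gm X)) (Qm X) (V \<times> carrier (Grp X)) i"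
    and ij: "\<And>q. q \<in> Qset X \<Longrightarrow> proj X q \<in> V \<Longrightarrow> i (proj X q, j q) = q"
    and pi: "\<And>s g. s \<in> V \<Longrightarrow> g \<in> carrier (Grp X) \<Longrightarrow> proj X (i (s, g)) = s"
    by (rule trivialization[OF proj_closed[OF a]]) (rule that)
  let ?z = "snd (chart_at (Qm X) a) a" and ?\<phi> = "chart_inv (chart_at (Qm X) a)"
  have \<phi>0: "?\<phi> ?z = a" using chart_inv_chart[OF inj_Q chart_at_in[OF a] chart_at_mem[OF a]] .
  have \<phi>: "has_tangent_map (Qm X) ?\<phi> ?z (\<lambda>v. v)" by (rule has_tangent_map_chart[OF manifold_Q a])
  let ?dj = "mfderiv (Qm X) (Gm X) j a"
  have r: "?r \<in> mcarrier (Bm X)" and ja: "j a \<in> mcarrier (Gm X)"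
    using a V j by (auto simp: smooth_map_on_def)
  have tp: "has_tangent_map (Bm X) (\<lambda>y. proj X (?\<phi> y)) ?z (dproj X a)"
    using smooth_map_on_tangent[OF smooth_proj manifold_Q inj_B \<phi>] a by (simp add: \<phi>0 dproj_def)
  have tj: "has_tangent_map (Gm X) (\<lambda>y. j (?\<phi> y)) ?z ?dj"
    using smooth_map_on_tangent[OF j manifold_Q inj_G \<phi>] a V by (simp add: \<phi>0)
  let ?P = "pair_deriv (Bm X) (Gm X) (Qm X) i ?r (j a)"
  note i2 = smooth_map_on_tangent2(2)[OF i manifold_B manifold_G inj_Q]
  have ti: "has_tangent_map (Qm X) (\<lambda>y. i (proj X (?\<phi> y), j (?\<phi> y))) ?z (\<lambda>v. ?P (dproj X a v, ?dj v))"
    using i2[OF tp tj] V ja by (simp add: \<phi>0 carrier_G)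
  have "\<forall>\<^sub>F y in nhds ?z. proj X (?\<phi> y) \<in> V"
    using has_tangent_map_eventually[OF tp opV] V by (simp add: \<phi>0)
  with eventually_Q[OF \<phi>] have "\<forall>\<^sub>F y in nhds ?z. i (proj X (?\<phi> y), j (?\<phi> y)) = ?\<phi> y"
    by eventually_elim (rule ij)
  \<comment> \<open>Differentiating \<open>i(\<pi>(y), j(y)) = y\<close> recovers every tangent vector from its two components.\<close>
  from has_tangent_map_unique[OF has_tangent_map_cong[OF ti this] \<phi>]
  have "(\<lambda>v. ?P (dproj X a v, ?dj v)) = (\<lambda>v. v)" .
  from fun_cong[OF this, of v] have vP: "?P (0, ?dj v) = v" using v by simp
  let ?line = "\<lambda>s::real. chart_inv (chart_at (Gm X) (j a)) (snd (chart_at (Gm X) (j a)) (j a) + s *\<^sub>R ?dj v)"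
  have l0: "?line 0 = j a" using chart_inv_chart[OF inj_G chart_at_in[OF ja] chart_at_mem[OF ja]] by simp
  \<comment> \<open>The whole fibre over \<open>?r\<close> is in the domain of \<open>i\<close>, so the line only has to stay in its chart.\<close>
  have sub: "{?r} \<times> mcarrier (Gm X) \<subseteq> V \<times> carrier (Grp X)" using V carrier_G by auto
  obtain \<epsilon> where \<epsilon>: "\<epsilon> > 0" and line: "\<And>s. s \<in> {-\<epsilon><..<\<epsilon>} \<Longrightarrow> ?line s \<in> mcarrier (Gm X)"
    and sm: "smooth_map_on real_mfd (Qm X) {-\<epsilon><..<\<epsilon>} (\<lambda>s. i (?r, ?line s))"
    using smooth_map_on_line[OF i manifold_B manifold_G r ja sub, of "?dj v"] by blast
  have "has_tangent_map (Qm X) (\<lambda>s. i (?r, ?line s)) 0 (\<lambda>s. ?P (0, s *\<^sub>R ?dj v))"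
    using i2[OF has_tangent_map_const[OF r] has_tangent_map_line[OF manifold_G ja, of "?dj v"]] V ja l0
    by (simp add: carrier_G)
  from velocity_eq[OF this] have vel: "v = velocity (Qm X) (\<lambda>s. i (?r, ?line s))" by (simp add: vP)
  have start: "(\<lambda>s. i (?r, ?line s)) 0 = a" unfolding l0 by (rule ij[OF a V])
  have orb: "i (?r, ?line s) \<in> ?r" if "s \<in> {-\<epsilon><..<\<epsilon>}" for s
  proof -
    have "proj X (i (?r, ?line s)) = ?r" using line[OF that] V pi by (simp add: carrier_G)
    moreover have "i (?r, ?line s) \<in> Qset X" using sm that by (auto simp: smooth_map_on_def)
    ultimately show ?thesis using action.orbit_refl[of "i (?r, ?line s)"] by (simp add: proj_def)
  qed
  show ?thesis
    unfolding vertical_def tangent_space_def proj_def[symmetric]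
    by (rule CollectI, rule exI[of _ "\<lambda>s. i (?r, ?line s)"], intro conjI vel start exI[of _ \<epsilon>] \<epsilon> sm)
      (use orb in blast)
qed

lemma Hb_act:
  assumes "g \<in> carrier (Grp X)" "a \<in> Qset X" "v \<in> Hb X a"
  shows "mfderiv (Qm X) (Qm X) (act X g) a v \<in> Hb X (act X g a)"
proof -
  have "invariant_subbundle X (Hb X)" using connection unfolding connection_data_def by (elim conjE)
  then have "mfderiv (Qm X) (Qm X) (act X g) a ` Hb X a = Hb X (act X g a)"
    using assms by (simp add: invariant_subbundle_def)
  then show ?thesis using assms(3) by blast
qed

lemma subspaces:
  assumes "a \<in> Qset X"
  shows "subspace (Hb X a)" "subspace (Wb X a)" "subspace (Ub X a)" "subspace (Dc X a)"
  using connection system assms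
  by (auto simp: connection_data_def invariant_subbundle_def nonholonomic_system_def
      intro: smooth_subbundle_subspace)

lemma splittings:
  assumes "a \<in> Qset X"
  shows "direct_sum (Dc X a) [Sb X a, Hb X a]" "direct_sum (vertical X a) [Sb X a, Ub X a]"
    "direct_sum UNIV [Wb X a, Ub X a, Sb X a, Hb X a]"
  using connection assms unfolding connection_data_def by simp_all

text \<open>
  Two candidates for the lift differ by a vector of \<open>\<W> \<oplus> \<H>\<close> in the kernel of the projection, hence in
  \<open>\<S> \<oplus> \<U>\<close>; the sum of the four subbundles is direct, so the difference is zero.
\<close>

lemma hlift_dproj:
  assumes a: "a \<in> Qset X" and h: "h \<in> Hb X a"
  shows "hlift X a (dproj X a h) = h"
  unfolding hlift_def
proof (rule the_equality)
  note sub = subspaces[OF a]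
  show "h \<in> {x + y |x y. x \<in> Wb X a \<and> y \<in> Hb X a} \<and> dproj X a h = dproj X a h"
    using h subspace_0[OF sub(2)] by (metis (mono_tags, lifting) CollectI add_0)
  have S0: "0 \<in> Sb X a"
    using kernel_dproj_vertical[OF a linear_0[OF linear_dproj[OF a]]] subspace_0[OF sub(4)] by (simp add: Sb_def)
  fix v assume v: "v \<in> {x + y |x y. x \<in> Wb X a \<and> y \<in> Hb X a} \<and> dproj X a v = dproj X a h"
  then obtain x y where xy: "v = x + y" "x \<in> Wb X a" "y \<in> Hb X a" by blast
  have "dproj X a (v - h) = 0" using v by (simp add: linear_diff[OF linear_dproj[OF a]])
  then have "v - h \<in> vertical X a" by (rule kernel_dproj_vertical[OF a])
  then obtain s u where su: "v - h = s + u" "s \<in> Sb X a" "u \<in> Ub X a"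
    unfolding direct_sum2D[OF splittings(2)[OF a]] by blast
  \<comment> \<open>Two decompositions of \<open>v - h\<close>, in the order \<open>\<W>\<close>, \<open>\<U>\<close>, \<open>\<S>\<close>, \<open>\<H>\<close>.\<close>
  have *: "x + (0 + (0 + (y - h))) = 0 + (u + (s + 0))" using xy su by (simp add: algebra_simps)
  note ** = direct_sum4_unique[OF splittings(3)[OF a] xy(2) subspace_0[OF sub(3)] S0
      subspace_diff[OF sub(1) xy(3) h] subspace_0[OF sub(2)] su(3) su(2) subspace_0[OF sub(1)] *]
  show "v = h" using ** xy by simp
qed

lemma dproj_act:
  assumes g: "g \<in> carrier (Grp X)" and a: "a \<in> Qset X"
  shows "dproj X (act X g a) (mfderiv (Qm X) (Qm X) (act X g) a v) = dproj X a v"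
proof -
  let ?z = "snd (chart_at (Qm X) a) a" and ?\<phi> = "chart_inv (chart_at (Qm X) a)"
  have \<phi>0: "?\<phi> ?z = a" using chart_inv_chart[OF inj_Q chart_at_in[OF a] chart_at_mem[OF a]] .
  have \<phi>: "has_tangent_map (Qm X) ?\<phi> ?z (\<lambda>v. v)" by (rule has_tangent_map_chart[OF manifold_Q a])
  have t1: "has_tangent_map (Bm X) (\<lambda>y. proj X (?\<phi> y)) ?z (dproj X a)"
    using mdiff_tangent[OF manifold_Q _ \<phi>, of "Bm X" "proj X"] mdiff_proj[OF a] by (simp add: \<phi>0 dproj_def)
  have ta: "has_tangent_map (Qm X) (\<lambda>y. act X g (?\<phi> y)) ?z (mfderiv (Qm X) (Qm X) (act X g) a)"
    using mdiff_act[OF g a] by (simp add: mdiff_def)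
  have t2: "has_tangent_map (Bm X) (\<lambda>y. proj X (act X g (?\<phi> y))) ?z
      (\<lambda>v. dproj X (act X g a) (mfderiv (Qm X) (Qm X) (act X g) a v))"
    using mdiff_tangent[OF manifold_Q _ ta, of "Bm X" "proj X"] mdiff_proj[OF act_closed[OF g a]]
    by (simp add: \<phi>0 dproj_def)
  have "\<forall>\<^sub>F y in nhds ?z. proj X (act X g (?\<phi> y)) = proj X (?\<phi> y)"
    using eventually_Q[OF \<phi>] by eventually_elim (simp add: g)
  from has_tangent_map_unique[OF has_tangent_map_cong[OF t2 this] t1] show ?thesis by (rule fun_cong)
qed

lemma hlift_dproj_act:
  assumes "g \<in> carrier (Grp X)" "a \<in> Qset X" "h \<in> Hb X a"
  shows "hlift X (act X g a) (dproj X a h) = mfderiv (Qm X) (Qm X) (act X g) a h"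
  using hlift_dproj[of "act X g a" "mfderiv (Qm X) (Qm X) (act X g) a h"] assms
  by (simp add: dproj_act Hb_act)

lemma Dc_hat_proj:
  assumes a: "a \<in> Qset X" shows "Dc_hat X (proj X a) = dproj X a ` Dc X a"
  unfolding Dc_hat_def proj_def
proof (rule the_elem_orbit)
  fix g assume g: "g \<in> carrier (Grp X)"
  have "mfderiv (Qm X) (Qm X) (act X g) a ` Dc X a = Dc X (act X g a)"
    using symmetry g a by (simp add: symmetry_group_def)
  then have "dproj X (act X g a) ` Dc X (act X g a) =
      dproj X (act X g a) ` mfderiv (Qm X) (Qm X) (act X g) a ` Dc X a" by simp
  also have "\<dots> = dproj X a ` Dc X a" by (simp add: image_image dproj_act[OF g a])
  finally show "dproj X (act X g a) ` Dc X (act X g a) = dproj X a ` Dc X a" .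
qed (rule G.is_group)

section \<open>Derivatives of the lifted Lagrangian\<close>

lemma local_section:
  assumes "r \<in> mcarrier (Bm X)"
  obtains V \<sigma> where "r \<in> V" "openin (mtop (Bm X)) V" "mdiff (Bm X) (Qm X) \<sigma> r"
    "\<And>s. s \<in> V \<Longrightarrow> \<sigma> s \<in> Qset X" "\<And>s. s \<in> V \<Longrightarrow> proj X (\<sigma> s) = s"
proof -
  obtain V j i where V: "r \<in> V" "openin (mtop (Bm X)) V"
    and i: "smooth_map_on (prod_mfd (Bm X) (Gm X)) (Qm X) (V \<times> carrier (Grp X)) i"
    and pi: "\<And>s g. s \<in> V \<Longrightarrow> g \<in> carrier (Grp X) \<Longrightarrow> proj X (i (s, g)) = s"
    by (rule trivialization[OF assms]) (rule that)
  show thesis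
  proof (rule that[OF V])
    show "mdiff (Bm X) (Qm X) (\<lambda>s. i (s, \<one>\<^bsub>Grp X\<^esub>)) r"
      by (rule smooth_map_on_partial(1)[OF i manifold_B manifold_G inj_Q assms])
        (use V carrier_G in auto)
    show "i (s, \<one>\<^bsub>Grp X\<^esub>) \<in> Qset X" if "s \<in> V" for s
      using i that unfolding smooth_map_on_def by (elim conjE) blast
    show "proj X (i (s, \<one>\<^bsub>Grp X\<^esub>)) = s" if "s \<in> V" for s
      using pi that by simp
  qed
qed

text \<open>
  The orbits \<open>R y\<close> are represented by points \<open>S y\<close> that depend differentiably on \<open>y\<close> and at which the
  discrete connection form is defined.  Near \<open>z\<close>, \<open>L_check_eq\<close> then gives \<open>L_check\<close> in terms of \<open>S\<close>.
\<close>

lemma L_check_local: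
  assumes Fb: "(F z, b) \<in> frakU X" and Rb: "R z = proj X b"
    and F: "has_tangent_map (Qm X) F z D" and R: "has_tangent_map (Bm X) R z K"
  obtains S where "\<exists>E. has_tangent_map (Qm X) S z E"
    "\<forall>\<^sub>F y in nhds z. (F y, S y) \<in> frakU X \<and> R y = proj X (S y)"
proof -
  obtain V \<sigma> where V: "R z \<in> V" "openin (mtop (Bm X)) V" and \<sigma>: "mdiff (Bm X) (Qm X) \<sigma> (R z)"
    and \<sigma>Q: "\<And>s. s \<in> V \<Longrightarrow> \<sigma> s \<in> Qset X" and proj: "\<And>s. s \<in> V \<Longrightarrow> proj X (\<sigma> s) = s"
    by (rule local_section[OF has_tangent_map_carrier[OF R]]) (rule that)
  note S = mdiff_tangent[OF manifold_B \<sigma> R]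
  have "(F z, \<sigma> (R z)) \<in> frakU X"
    using Fb \<sigma>Q[OF V(1)] proj[OF V(1)] Rb by (simp add: frakU_def)
  from eventually_frakU[OF F S this] has_tangent_map_eventually[OF R V(2,1)]
  have "\<forall>\<^sub>F y in nhds z. (F y, \<sigma> (R y)) \<in> frakU X \<and> R y = proj X (\<sigma> (R y))"
    by eventually_elim (simp add: proj)
  with S show thesis by (intro that[of "\<lambda>y. \<sigma> (R y)"]) blast+
qed

lemma L_check_differentiable:
  assumes Fb: "(F z, b) \<in> frakU X" and Rb: "R z = proj X b"
    and F: "has_tangent_map (Qm X) F z D" and H: "has_tangent_map (Gm X) H z E"
    and R: "has_tangent_map (Bm X) R z K"
  shows "\<exists>T. ((\<lambda>y. L_check X (F y) (H y) (R y)) has_derivative T) (at z)"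
proof -
  obtain S E' where S: "has_tangent_map (Qm X) S z E'"
    and ev: "\<forall>\<^sub>F y in nhds z. (F y, S y) \<in> frakU X \<and> R y = proj X (S y)"
    using L_check_local[OF Fb Rb F R] by blast
  from eventually_nhds_x_imp_x[OF ev] have FS: "(F z, S z) \<in> frakU X" by simp
  have Hz: "H z \<in> carrier (Grp X)" using has_tangent_map_carrier[OF H] carrier_G by simp
  note A = smooth_map_on_total[OF smooth_Adisc manifold_Q manifold_Q inj_G F S FS, unfolded prod.case]
  have Az: "Adisc X (F z) (S z) \<in> mcarrier (Gm X)" using Adisc_closed[OF FS] carrier_G by simp
  note I = smooth_map_on_tangent[OF smooth_inv manifold_G inj_G A Az]
  have HI: "(H z, inv\<^bsub>Grp X\<^esub> Adisc X (F z) (S z)) \<in> mcarrier (prod_mfd (Gm X) (Gm X))"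
    using Hz Adisc_closed[OF FS] by (simp add: mcarrier_prod carrier_G)
  note M = smooth_map_on_total[OF smooth_mult manifold_G manifold_G inj_G H I HI, unfolded prod.case]
  have MS: "(H z \<otimes>\<^bsub>Grp X\<^esub> inv\<^bsub>Grp X\<^esub> Adisc X (F z) (S z), S z) \<in> mcarrier (prod_mfd (Gm X) (Qm X))"
    using Hz Adisc_closed[OF FS] frakU_memD[OF FS] by (simp add: mcarrier_prod carrier_G)
  note a = smooth_map_on_total[OF smooth_act manifold_G manifold_Q inj_Q M S MS, unfolded prod.case]
  from Ld_has_derivative[OF system F a] obtain T where
    T: "((\<lambda>y. Ld X (F y, act X (H y \<otimes>\<^bsub>Grp X\<^esub> inv\<^bsub>Grp X\<^esub> Adisc X (F y) (S y)) (S y))) has_derivative T) (at z)"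
    by blast
  from ev eventually_G[OF H]
  have "\<forall>\<^sub>F y in nhds z. Ld X (F y, act X (H y \<otimes>\<^bsub>Grp X\<^esub> inv\<^bsub>Grp X\<^esub> Adisc X (F y) (S y)) (S y)) =
      L_check X (F y) (H y) (R y)"
    by eventually_elim (simp add: L_check_eq)
  from has_tangent_map_cong[OF T[folded has_tangent_map_real] this]
  show ?thesis unfolding has_tangent_map_real by blast
qed

text \<open>
  The functions \<open>D1L\<close>, \<open>D2L\<close> and \<open>D3L\<close> come from varying one argument at a time.  Since \<open>L_check\<close> is
  differentiable in the three arguments jointly, they add up to its derivative along any
  parametrization.
\<close>

lemma L_check_has_derivative:
  assumes Fb: "(F z, b) \<in> frakU X" and Rb: "R z = proj X b"
    and F: "has_tangent_map (Qm X) F z D" and H: "has_tangent_map (Gm X) H z E"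
    and R: "has_tangent_map (Bm X) R z K"
  shows "((\<lambda>y. L_check X (F y) (H y) (R y)) has_derivative
      (\<lambda>v. D1L X (F z) (H z) (R z) (D v) + D2L X (F z) (H z) (R z) (E v) + D3L X (F z) (H z) (R z) (K v))) (at z)"
    and "linear (D1L X (F z) (H z) (R z))" "linear (D2L X (F z) (H z) (R z))" "linear (D3L X (F z) (H z) (R z))"
proof -
  note a = has_tangent_map_carrier[OF F] and w = has_tangent_map_carrier[OF H] and r = has_tangent_map_carrier[OF R]
  let ?ca = "chart_at (Qm X) (F z)" and ?cw = "chart_at (Gm X) (H z)" and ?cr = "chart_at (Bm X) (R z)"
  let ?za = "snd ?ca (F z)" and ?zw = "snd ?cw (H z)" and ?zr = "snd ?cr (R z)"
  let ?z = "(?za, ?zw, ?zr)"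
  have inv: "chart_inv ?ca ?za = F z" "chart_inv ?cw ?zw = H z" "chart_inv ?cr ?zr = R z"
    using chart_inv_chart[OF inj_Q chart_at_in[OF a] chart_at_mem[OF a]]
      chart_inv_chart[OF inj_G chart_at_in[OF w] chart_at_mem[OF w]]
      chart_inv_chart[OF inj_B chart_at_in[OF r] chart_at_mem[OF r]] by simp_all
  \<comment> \<open>\<open>L_check\<close> in the three fixed charts, as a function on the product of the model spaces.\<close>
  define L where "L p = L_check X (chart_inv ?ca (fst p)) (chart_inv ?cw (fst (snd p))) (chart_inv ?cr (snd (snd p)))" for p
  obtain T where T: "(L has_derivative T) (at ?z)"
  proof -
    have 1: "has_tangent_map (Qm X) (\<lambda>p. chart_inv ?ca (fst p)) ?z fst"
      by (rule has_tangent_map_reparametrize[where F = "chart_inv ?ca" and g = fst and D = "\<lambda>v. v" and E = fst])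
        (auto simp: has_tangent_map_chart[OF manifold_Q a] intro!: derivative_eq_intros)
    have 2: "has_tangent_map (Gm X) (\<lambda>p. chart_inv ?cw (fst (snd p))) ?z (\<lambda>v. fst (snd v))"
      by (rule has_tangent_map_reparametrize[where F = "chart_inv ?cw" and g = "\<lambda>p. fst (snd p)" and D = "\<lambda>v. v"])
        (auto simp: has_tangent_map_chart[OF manifold_G w] intro!: derivative_eq_intros)
    have 3: "has_tangent_map (Bm X) (\<lambda>p. chart_inv ?cr (snd (snd p))) ?z (\<lambda>v. snd (snd v))"
      by (rule has_tangent_map_reparametrize[where F = "chart_inv ?cr" and g = "\<lambda>p. snd (snd p)" and D = "\<lambda>v. v"])
        (auto simp: has_tangent_map_chart[OF manifold_B r] intro!: derivative_eq_intros)
    have "(chart_inv ?ca (fst ?z), b) \<in> frakU X" "chart_inv ?cr (snd (snd ?z)) = proj X b"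
      using Fb Rb inv by simp_all
    from L_check_differentiable[OF this 1 2 3] show thesis
      unfolding L_def[abs_def, symmetric] using that by blast
  qed
  note lin = has_derivative_linear[OF T]
  have d1: "D1L X (F z) (H z) (R z) = (\<lambda>v. T (v, 0, 0))"
  proof -
    have "((\<lambda>y. L (y, ?zw, ?zr)) has_derivative (\<lambda>v. T (v, 0, 0))) (at ?za)"
      by (rule has_derivative_at_point[OF T]) (auto simp: zero_prod_def intro!: derivative_eq_intros)
    then show ?thesis unfolding D1L_def
      by (intro mdiffI(2)[OF inj_Q a]) (simp add: has_tangent_map_real inv L_def)
  qed
  have d2: "D2L X (F z) (H z) (R z) = (\<lambda>v. T (0, v, 0))"
  proof -
    have "((\<lambda>y. L (?za, y, ?zr)) has_derivative (\<lambda>v. T (0, v, 0))) (at ?zw)"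
      by (rule has_derivative_at_point[OF T]) (auto simp: zero_prod_def intro!: derivative_eq_intros)
    then show ?thesis unfolding D2L_def
      by (intro mdiffI(2)[OF inj_G w]) (simp add: has_tangent_map_real inv L_def)
  qed
  have d3: "D3L X (F z) (H z) (R z) = (\<lambda>v. T (0, 0, v))"
  proof -
    have "((\<lambda>y. L (?za, ?zw, y)) has_derivative (\<lambda>v. T (0, 0, v))) (at ?zr)"
      by (rule has_derivative_at_point[OF T]) (auto simp: zero_prod_def intro!: derivative_eq_intros)
    then show ?thesis unfolding D3L_def
      by (intro mdiffI(2)[OF inj_B r]) (simp add: has_tangent_map_real inv L_def)
  qed
  have split: "T (x, y, k) = T (x, 0, 0) + T (0, y, 0) + T (0, 0, k)" for x y k
    using linear_add[OF lin, of "(x, 0, 0)" "(0, y, k)"] linear_add[OF lin, of "(0, y, 0)" "(0, 0, k)"] by simp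
  show "linear (D1L X (F z) (H z) (R z))" "linear (D2L X (F z) (H z) (R z))" "linear (D3L X (F z) (H z) (R z))"
    unfolding d1 d2 d3
    using linear_compose[OF _ lin, of "\<lambda>v. (v, 0, 0)"] linear_compose[OF _ lin, of "\<lambda>v. (0, v, 0)"]
      linear_compose[OF _ lin, of "\<lambda>v. (0, 0, v)"]
    by (simp_all add: comp_def linear_iff)
  have co: "((\<lambda>y. (snd ?ca (F y), snd ?cw (H y), snd ?cr (R y))) has_derivative (\<lambda>v. (D v, E v, K v))) (at z)"
    using F H R by (auto simp: has_tangent_map_def intro!: has_derivative_Pair)
  have "((\<lambda>y. L (snd ?ca (F y), snd ?cw (H y), snd ?cr (R y))) has_derivative (\<lambda>v. T (D v, E v, K v))) (at z)"
    by (rule has_derivative_at_point[OF T co refl])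
  moreover have "\<forall>\<^sub>F y in nhds z. L (snd ?ca (F y), snd ?cw (H y), snd ?cr (R y)) = L_check X (F y) (H y) (R y)"
    using has_tangent_map_eventually[OF F openin_chart[OF manifold_Q chart_at_in[OF a]] chart_at_mem[OF a]]
      has_tangent_map_eventually[OF H openin_chart[OF manifold_G chart_at_in[OF w]] chart_at_mem[OF w]]
      has_tangent_map_eventually[OF R openin_chart[OF manifold_B chart_at_in[OF r]] chart_at_mem[OF r]]
    by eventually_elim (simp add: L_def chart_inv_chart[OF inj_Q chart_at_in[OF a]]
        chart_inv_chart[OF inj_G chart_at_in[OF w]] chart_inv_chart[OF inj_B chart_at_in[OF r]])
  ultimately have "((\<lambda>y. L_check X (F y) (H y) (R y)) has_derivative (\<lambda>v. T (D v, E v, K v))) (at z)"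
    unfolding has_tangent_map_real[symmetric] by (rule has_tangent_map_cong)
  then show "((\<lambda>y. L_check X (F y) (H y) (R y)) has_derivative
      (\<lambda>v. D1L X (F z) (H z) (R z) (D v) + D2L X (F z) (H z) (R z) (E v) + D3L X (F z) (H z) (R z) (K v))) (at z)"
    unfolding d1 d2 d3 split[of "D _" "E _" "K _"] .
qed

lemma linear_DL:
  assumes "(a, b) \<in> frakU X" "w \<in> carrier (Grp X)"
  shows "linear (D1L X a w (proj X b))" "linear (D2L X a w (proj X b))" "linear (D3L X a w (proj X b))"
  using L_check_has_derivative(2-4)[of "\<lambda>_. a" "0::real" b "\<lambda>_. proj X b" "\<lambda>_. 0" "\<lambda>_. w" "\<lambda>_. 0" "\<lambda>_. 0"]
    assms frakU_memD[OF assms(1)] by (simp_all add: has_tangent_map_const carrier_G)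

lemma chart_param:
  assumes "smooth_manifold M" "x \<in> mcarrier M"
  obtains \<phi> z where "\<phi> z = x" "has_tangent_map M \<phi> z (\<lambda>v. v)"
  by (rule that[OF _ has_tangent_map_chart[OF assms]])
     (rule chart_inv_chart[OF inj_charts_manifold[OF assms(1)] chart_at_in[OF assms(2)] chart_at_mem[OF assms(2)]])

text \<open>
  This is the derivative of \<open>L\<^sub>d(a, y) = L_check(a, \<A>\<^sub>d(a, y), \<pi>(y))\<close> with respect to \<open>y\<close>.  At \<open>x = h\<^sup>b(\<delta>r)\<close>
  the first term is the force \<open>F\<^sup>+\<close>.
\<close>

lemma D2Ld_split:
  assumes ab: "(a, b) \<in> frakU X"
  shows "D2Ld X a b x = D2L X a (Adisc X a b) (proj X b) (D2A X a b x) + D3L X a (Adisc X a b) (proj X b) (dproj X b x)"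
proof -
  note Q = frakU_memD[OF ab] and A = Adisc_closed[OF ab]
  obtain \<phi> z where \<phi>0: "\<phi> z = b" and \<phi>: "has_tangent_map (Qm X) \<phi> z (\<lambda>v. v)"
    by (rule chart_param[OF manifold_Q Q(2)])
  have c: "has_tangent_map (Qm X) (\<lambda>_. a) z (\<lambda>_. 0)" by (rule has_tangent_map_const[OF Q(1)])
  have tA: "has_tangent_map (Gm X) (\<lambda>y. Adisc X a (\<phi> y)) z (D2A X a b)"
    using mdiff_tangent[OF manifold_Q _ \<phi>, of "Gm X" "Adisc X a"] mdiff_Adisc(2)[OF ab] by (simp add: \<phi>0 D2A_def)
  have tp: "has_tangent_map (Bm X) (\<lambda>y. proj X (\<phi> y)) z (dproj X b)"
    using mdiff_tangent[OF manifold_Q _ \<phi>, of "Bm X" "proj X"] mdiff_proj[OF Q(2)] by (simp add: \<phi>0 dproj_def)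
  have "((\<lambda>y. L_check X a (Adisc X a (\<phi> y)) (proj X (\<phi> y))) has_derivative
    (\<lambda>v. D2L X a (Adisc X a b) (proj X b) (D2A X a b v) + D3L X a (Adisc X a b) (proj X b) (dproj X b v))) (at z)"
    using L_check_has_derivative(1)[OF _ _ c tA tp, of b] ab linear_0[OF linear_DL(1)[OF ab A]] by (simp add: \<phi>0)
  moreover have "\<forall>\<^sub>F y in nhds z. L_check X a (Adisc X a (\<phi> y)) (proj X (\<phi> y)) = Ld X (a, \<phi> y)"
    using eventually_frakU[OF c \<phi>] ab \<phi>0 by (auto elim!: eventually_mono simp: L_check_Adisc)
  moreover have "((\<lambda>y. Ld X (a, \<phi> y)) has_derivative (\<lambda>v. D2Ld X a b v)) (at z)"
    using Ld_has_derivative[OF system c \<phi>] linear_0[OF linear_D1Ld[OF Q]] by (simp add: \<phi>0)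
  ultimately show ?thesis
    by (rule has_derivative_eventually_unique[THEN fun_cong, symmetric])
qed

text \<open>
  This is the derivative of \<open>L\<^sub>d(x, b) = L_check(x, \<A>\<^sub>d(x, b), \<pi>(b))\<close> with respect to \<open>x\<close>.  At \<open>x = h\<^sup>a(\<delta>r)\<close>
  the second term is the force \<open>F\<^sup>-\<close>.
\<close>

lemma D1Ld_split:
  assumes ab: "(a, b) \<in> frakU X"
  shows "D1Ld X a b x = D1L X a (Adisc X a b) (proj X b) x + D2L X a (Adisc X a b) (proj X b) (D1A X a b x)"
proof -
  note Q = frakU_memD[OF ab] and A = Adisc_closed[OF ab]
  obtain \<phi> z where \<phi>0: "\<phi> z = a" and \<phi>: "has_tangent_map (Qm X) \<phi> z (\<lambda>v. v)"
    by (rule chart_param[OF manifold_Q Q(1)])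
  have c: "has_tangent_map (Qm X) (\<lambda>_. b) z (\<lambda>_. 0)" by (rule has_tangent_map_const[OF Q(2)])
  have cB: "has_tangent_map (Bm X) (\<lambda>_. proj X b) z (\<lambda>_. 0)" by (rule has_tangent_map_const[OF proj_closed[OF Q(2)]])
  have tA: "has_tangent_map (Gm X) (\<lambda>y. Adisc X (\<phi> y) b) z (D1A X a b)"
    using mdiff_tangent[OF manifold_Q _ \<phi>, of "Gm X" "\<lambda>x. Adisc X x b"] mdiff_Adisc(1)[OF ab] by (simp add: \<phi>0 D1A_def)
  have "((\<lambda>y. L_check X (\<phi> y) (Adisc X (\<phi> y) b) (proj X b)) has_derivative
    (\<lambda>v. D1L X a (Adisc X a b) (proj X b) v + D2L X a (Adisc X a b) (proj X b) (D1A X a b v))) (at z)"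
    using L_check_has_derivative(1)[OF _ _ \<phi> tA cB, of b] ab linear_0[OF linear_DL(3)[OF ab A]] by (simp add: \<phi>0)
  moreover have "\<forall>\<^sub>F y in nhds z. L_check X (\<phi> y) (Adisc X (\<phi> y) b) (proj X b) = Ld X (\<phi> y, b)"
    using eventually_frakU[OF \<phi> c] ab \<phi>0 by (auto elim!: eventually_mono simp: L_check_Adisc)
  moreover have "((\<lambda>y. Ld X (\<phi> y, b)) has_derivative (\<lambda>v. D1Ld X a b v)) (at z)"
    using Ld_has_derivative[OF system \<phi> c] linear_0[OF linear_D2Ld[OF Q]] by (simp add: \<phi>0)
  ultimately show ?thesis
    by (rule has_derivative_eventually_unique[THEN fun_cong, symmetric])
qed

abbreviation dact :: "'g \<Rightarrow> 'q \<Rightarrow> 'e \<Rightarrow> 'e" where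
  "dact g a \<equiv> mfderiv (Qm X) (Qm X) (act X g) a"

lemma D1Ld_act:
  assumes g: "g \<in> carrier (Grp X)" and a: "a \<in> Qset X" and b: "b \<in> Qset X"
  shows "D1Ld X (act X g a) (act X g b) (dact g a x) = D1Ld X a b x"
proof -
  obtain \<phi> z where \<phi>0: "\<phi> z = a" and \<phi>: "has_tangent_map (Qm X) \<phi> z (\<lambda>v. v)"
    by (rule chart_param[OF manifold_Q a])
  have c: "has_tangent_map (Qm X) (\<lambda>_. b') z (\<lambda>_. 0)" if "b' \<in> Qset X" for b' by (rule has_tangent_map_const[OF that])
  have ta: "has_tangent_map (Qm X) (\<lambda>y. act X g (\<phi> y)) z (dact g a)"
    using mdiff_tangent[OF manifold_Q _ \<phi>, of "Qm X" "act X g"] mdiff_act[OF g a] by (simp add: \<phi>0)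
  have "((\<lambda>y. Ld X (act X g (\<phi> y), act X g b)) has_derivative (\<lambda>v. D1Ld X (act X g a) (act X g b) (dact g a v))) (at z)"
    using Ld_has_derivative[OF system ta c[OF act_closed[OF g b]]] linear_0[OF linear_D2Ld[OF act_closed[OF g a] act_closed[OF g b]]]
    by (simp add: \<phi>0)
  moreover have "\<forall>\<^sub>F y in nhds z. Ld X (act X g (\<phi> y), act X g b) = Ld X (\<phi> y, b)"
    using eventually_Q[OF \<phi>] by eventually_elim (simp add: Ld_act g b)
  moreover have "((\<lambda>y. Ld X (\<phi> y, b)) has_derivative (\<lambda>v. D1Ld X a b v)) (at z)"
    using Ld_has_derivative[OF system \<phi> c[OF b]] linear_0[OF linear_D2Ld[OF a b]] by (simp add: \<phi>0)
  ultimately show ?thesis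
    by (rule has_derivative_eventually_unique[THEN fun_cong])
qed

lemma D2Ld_act:
  assumes g: "g \<in> carrier (Grp X)" and a: "a \<in> Qset X" and b: "b \<in> Qset X"
  shows "D2Ld X (act X g a) (act X g b) (dact g b x) = D2Ld X a b x"
proof -
  obtain \<phi> z where \<phi>0: "\<phi> z = b" and \<phi>: "has_tangent_map (Qm X) \<phi> z (\<lambda>v. v)"
    by (rule chart_param[OF manifold_Q b])
  have c: "has_tangent_map (Qm X) (\<lambda>_. b') z (\<lambda>_. 0)" if "b' \<in> Qset X" for b' by (rule has_tangent_map_const[OF that])
  have ta: "has_tangent_map (Qm X) (\<lambda>y. act X g (\<phi> y)) z (dact g b)"
    using mdiff_tangent[OF manifold_Q _ \<phi>, of "Qm X" "act X g"] mdiff_act[OF g b] by (simp add: \<phi>0)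
  have "((\<lambda>y. Ld X (act X g a, act X g (\<phi> y))) has_derivative (\<lambda>v. D2Ld X (act X g a) (act X g b) (dact g b v))) (at z)"
    using Ld_has_derivative[OF system c[OF act_closed[OF g a]] ta] linear_0[OF linear_D1Ld[OF act_closed[OF g a] act_closed[OF g b]]]
    by (simp add: \<phi>0)
  moreover have "\<forall>\<^sub>F y in nhds z. Ld X (act X g a, act X g (\<phi> y)) = Ld X (a, \<phi> y)"
    using eventually_Q[OF \<phi>] by eventually_elim (simp add: Ld_act g a)
  moreover have "((\<lambda>y. Ld X (a, \<phi> y)) has_derivative (\<lambda>v. D2Ld X a b v)) (at z)"
    using Ld_has_derivative[OF system c[OF a] \<phi>] linear_0[OF linear_D1Ld[OF a b]] by (simp add: \<phi>0)
  ultimately show ?thesis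
    by (rule has_derivative_eventually_unique[THEN fun_cong])
qed

lemma D1L_act:
  assumes g: "g \<in> carrier (Grp X)" and ab: "(a, b) \<in> frakU X" and w: "w \<in> carrier (Grp X)"
  shows "D1L X (act X g a) (Gconj X g w) (proj X b) (dact g a x) = D1L X a w (proj X b) x"
proof -
  note Q = frakU_memD[OF ab]
  obtain \<phi> z where \<phi>0: "\<phi> z = a" and \<phi>: "has_tangent_map (Qm X) \<phi> z (\<lambda>v. v)"
    by (rule chart_param[OF manifold_Q Q(1)])
  have ta: "has_tangent_map (Qm X) (\<lambda>y. act X g (\<phi> y)) z (dact g a)"
    using mdiff_tangent[OF manifold_Q _ \<phi>, of "Qm X" "act X g"] mdiff_act[OF g Q(1)] by (simp add: \<phi>0)
  have cG: "has_tangent_map (Gm X) (\<lambda>_. w') z (\<lambda>_. 0)" if "w' \<in> carrier (Grp X)" for w'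
    by (rule has_tangent_map_const) (simp add: that carrier_G)
  have cB: "has_tangent_map (Bm X) (\<lambda>_. proj X b) z (\<lambda>_. 0)" by (rule has_tangent_map_const[OF proj_closed[OF Q(2)]])
  have cQ: "has_tangent_map (Qm X) (\<lambda>_. b) z (\<lambda>_. 0)" by (rule has_tangent_map_const[OF Q(2)])
  have gab: "(act X g a, b) \<in> frakU X" using frakU_act[OF ab g G.one_closed] Q by simp
  have gw: "Gconj X g w \<in> carrier (Grp X)" using g w by simp
  have "((\<lambda>y. L_check X (act X g (\<phi> y)) (Gconj X g w) (proj X b)) has_derivative
    (\<lambda>v. D1L X (act X g a) (Gconj X g w) (proj X b) (dact g a v))) (at z)"
    using L_check_has_derivative(1)[OF _ _ ta cG[OF gw] cB, of b] gab
      linear_0[OF linear_DL(2)[OF gab gw]] linear_0[OF linear_DL(3)[OF gab gw]] by (simp add: \<phi>0)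
  moreover have "\<forall>\<^sub>F y in nhds z. L_check X (act X g (\<phi> y)) (Gconj X g w) (proj X b) = L_check X (\<phi> y) w (proj X b)"
    using eventually_frakU[OF \<phi> cQ] ab \<phi>0 by (auto elim!: eventually_mono simp: L_check_equivariant g w)
  moreover have "((\<lambda>y. L_check X (\<phi> y) w (proj X b)) has_derivative (\<lambda>v. D1L X a w (proj X b) v)) (at z)"
    using L_check_has_derivative(1)[OF _ _ \<phi> cG[OF w] cB, of b] ab
      linear_0[OF linear_DL(2)[OF ab w]] linear_0[OF linear_DL(3)[OF ab w]] by (simp add: \<phi>0)
  ultimately show ?thesis
    by (rule has_derivative_eventually_unique[THEN fun_cong])
qed

lemma D3L_act:
  assumes g: "g \<in> carrier (Grp X)" and ab: "(a, b) \<in> frakU X" and w: "w \<in> carrier (Grp X)"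
  shows "D3L X (act X g a) (Gconj X g w) (proj X b) x = D3L X a w (proj X b) x"
proof -
  note Q = frakU_memD[OF ab]
  obtain \<phi> z where \<phi>0: "\<phi> z = proj X b" and \<phi>: "has_tangent_map (Bm X) \<phi> z (\<lambda>v. v)"
    by (rule chart_param[OF manifold_B proj_closed[OF Q(2)]])
  have cG: "has_tangent_map (Gm X) (\<lambda>_. w') z (\<lambda>_. 0)" if "w' \<in> carrier (Grp X)" for w'
    by (rule has_tangent_map_const) (simp add: that carrier_G)
  have cQ: "has_tangent_map (Qm X) (\<lambda>_. a') z (\<lambda>_. 0)" if "a' \<in> Qset X" for a' by (rule has_tangent_map_const[OF that])
  have gab: "(act X g a, b) \<in> frakU X" using frakU_act[OF ab g G.one_closed] Q by simp
  have gw: "Gconj X g w \<in> carrier (Grp X)" using g w by simp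
  have ga: "act X g a \<in> Qset X" using g Q by simp
  have "((\<lambda>y. L_check X (act X g a) (Gconj X g w) (\<phi> y)) has_derivative
    (\<lambda>v. D3L X (act X g a) (Gconj X g w) (proj X b) v)) (at z)"
    using L_check_has_derivative(1)[OF gab \<phi>0 cQ[OF ga] cG[OF gw] \<phi>]
      linear_0[OF linear_DL(1)[OF gab gw]] linear_0[OF linear_DL(2)[OF gab gw]] by (simp add: \<phi>0)
  moreover have "\<forall>\<^sub>F y in nhds z. L_check X (act X g a) (Gconj X g w) (\<phi> y) = L_check X a w (\<phi> y)"
  proof -
    obtain S where "\<forall>\<^sub>F y in nhds z. (a, S y) \<in> frakU X \<and> \<phi> y = proj X (S y)"
      by (rule L_check_local[OF ab \<phi>0 cQ[OF Q(1)] \<phi>])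
    then show ?thesis by eventually_elim (simp add: L_check_equivariant g w)
  qed
  moreover have "((\<lambda>y. L_check X a w (\<phi> y)) has_derivative (\<lambda>v. D3L X a w (proj X b) v)) (at z)"
    using L_check_has_derivative(1)[OF ab \<phi>0 cQ[OF Q(1)] cG[OF w] \<phi>]
      linear_0[OF linear_DL(1)[OF ab w]] linear_0[OF linear_DL(2)[OF ab w]] by (simp add: \<phi>0)
  ultimately show ?thesis
    by (rule has_derivative_eventually_unique[THEN fun_cong])
qed

text \<open>
  The right translate of \<open>\<xi>\<close> is the velocity of \<open>exp(t\<xi>) w\<close>, and \<open>L_check(a, exp(t\<xi>) \<A>\<^sub>d(a, b), \<pi>(b))\<close>
  is \<open>L\<^sub>d(a, exp(t\<xi>) b)\<close>.
\<close>

lemma rtrans_D2L: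
  assumes ab: "(a, b) \<in> frakU X"
  shows "rtrans X (D2L X a (Adisc X a b) (proj X b)) (Adisc X a b) \<xi> = D2Ld X a b (inf_gen X \<xi> b)"
proof -
  note Q = frakU_memD[OF ab] and A = Adisc_closed[OF ab]
  let ?dR = "mfderiv (Gm X) (Gm X) (\<lambda>x. x \<otimes>\<^bsub>Grp X\<^esub> Adisc X a b) \<one>\<^bsub>Grp X\<^esub>"
  have tw: "has_tangent_map (Gm X) (\<lambda>t. Gexp X (t *\<^sub>R \<xi>) \<otimes>\<^bsub>Grp X\<^esub> Adisc X a b) 0 (\<lambda>t. ?dR (t *\<^sub>R \<xi>))"
    using mdiff_tangent[OF manifold_G _ exp_tangent, of "Gm X" "\<lambda>x. x \<otimes>\<^bsub>Grp X\<^esub> Adisc X a b" \<xi>]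
      mdiff_right_mult[OF G.one_closed A] by (simp add: exp_zero)
  have c: "has_tangent_map (Qm X) (\<lambda>_. a) (0::real) (\<lambda>_. 0)" by (rule has_tangent_map_const[OF Q(1)])
  have cB: "has_tangent_map (Bm X) (\<lambda>_. proj X b) (0::real) (\<lambda>_. 0)" by (rule has_tangent_map_const[OF proj_closed[OF Q(2)]])
  have "((\<lambda>t. L_check X a (Gexp X (t *\<^sub>R \<xi>) \<otimes>\<^bsub>Grp X\<^esub> Adisc X a b) (proj X b)) has_derivative
      (\<lambda>t. D2L X a (Adisc X a b) (proj X b) (?dR (t *\<^sub>R \<xi>)))) (at 0)"
    using L_check_has_derivative(1)[OF ab refl c tw cB] A
      linear_0[OF linear_DL(1)[OF ab A]] linear_0[OF linear_DL(3)[OF ab A]] by (simp add: exp_zero)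
  moreover have "(\<lambda>t. L_check X a (Gexp X (t *\<^sub>R \<xi>) \<otimes>\<^bsub>Grp X\<^esub> Adisc X a b) (proj X b)) =
      (\<lambda>t. Ld X (a, act X (Gexp X (t *\<^sub>R \<xi>)) b))"
    by (simp add: L_check_mult ab exp_closed)
  moreover have "((\<lambda>t. Ld X (a, act X (Gexp X (t *\<^sub>R \<xi>)) b)) has_derivative
      (\<lambda>t. D2Ld X a b (t *\<^sub>R inf_gen X \<xi> b))) (at 0)"
    using Ld_has_derivative[OF system c inf_gen_tangent(1)[OF Q(2)]] Q linear_0[OF linear_D1Ld[OF Q]]
    by (simp add: exp_zero)
  ultimately have "(\<lambda>t. D2L X a (Adisc X a b) (proj X b) (?dR (t *\<^sub>R \<xi>))) = (\<lambda>t. D2Ld X a b (t *\<^sub>R inf_gen X \<xi> b))"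
    by (simp add: has_derivative_unique)
  from fun_cong[OF this, of 1] show ?thesis by (simp add: rtrans_def)
qed

lemma Ld_inf_gen:
  assumes a: "a \<in> Qset X" and b: "b \<in> Qset X"
  shows "D1Ld X a b (inf_gen X \<xi> a) + D2Ld X a b (inf_gen X \<xi> b) = 0"
proof -
  have "((\<lambda>t. Ld X (act X (Gexp X (t *\<^sub>R \<xi>)) a, act X (Gexp X (t *\<^sub>R \<xi>)) b)) has_derivative
      (\<lambda>t. D1Ld X a b (t *\<^sub>R inf_gen X \<xi> a) + D2Ld X a b (t *\<^sub>R inf_gen X \<xi> b))) (at 0)"
    using Ld_has_derivative[OF system inf_gen_tangent(1)[OF a] inf_gen_tangent(1)[OF b]] a b by (simp add: exp_zero)
  moreover have "(\<lambda>t. Ld X (act X (Gexp X (t *\<^sub>R \<xi>)) a, act X (Gexp X (t *\<^sub>R \<xi>)) b)) = (\<lambda>t. Ld X (a, b))"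
    by (simp add: Ld_act a b exp_closed)
  ultimately have "(\<lambda>t. D1Ld X a b (t *\<^sub>R inf_gen X \<xi> a) + D2Ld X a b (t *\<^sub>R inf_gen X \<xi> b)) = (\<lambda>t. 0)"
    by (simp add: has_derivative_unique[OF _ has_derivative_const])
  from fun_cong[OF this, of 1] show ?thesis by simp
qed

text \<open>
  Both sides are the velocity of \<open>g exp(t\<xi>) a = (g exp(t\<xi>) g\<^sup>-\<^sup>1) (g a)\<close>.
\<close>

lemma inf_gen_Adj:
  assumes g: "g \<in> carrier (Grp X)" and a: "a \<in> Qset X"
  shows "inf_gen X (Adj X g \<xi>) (act X g a) = dact g a (inf_gen X \<xi> a)"
proof -
  have Gconj: "mdiff (Gm X) (Gm X) (Gconj X g) \<one>\<^bsub>Grp X\<^esub>"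
  proof -
    let ?G = "Gm X"
    obtain \<phi> z where \<phi>0: "\<phi> z = \<one>\<^bsub>Grp X\<^esub>" and \<phi>: "has_tangent_map ?G \<phi> z (\<lambda>v. v)"
      and \<phi>c: "\<phi> = chart_inv (chart_at ?G \<one>\<^bsub>Grp X\<^esub>)" and zc: "z = snd (chart_at ?G \<one>\<^bsub>Grp X\<^esub>) \<one>\<^bsub>Grp X\<^esub>"
      using has_tangent_map_chart[OF manifold_G, of "\<one>\<^bsub>Grp X\<^esub>"] carrier_G
        chart_inv_chart[OF inj_G chart_at_in chart_at_mem, of "\<one>\<^bsub>Grp X\<^esub>"] by simp
    have 1: "mdiff ?G ?G (\<lambda>h. g \<otimes>\<^bsub>Grp X\<^esub> h) (\<phi> z)" unfolding \<phi>0 using g by (simp add: mdiff_left_mult)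
    note t1 = mdiff_tangent[OF manifold_G 1 \<phi>]
    have 2: "mdiff ?G ?G (\<lambda>h. h \<otimes>\<^bsub>Grp X\<^esub> inv\<^bsub>Grp X\<^esub> g) (g \<otimes>\<^bsub>Grp X\<^esub> \<phi> z)"
      unfolding \<phi>0 using g by (simp add: mdiff_right_mult)
    note t2 = mdiff_tangent[OF manifold_G 2 t1]
    show ?thesis
      by (rule mdiffI(1)[OF inj_G _ t2[folded Gconj_def, unfolded zc \<phi>c]]) (simp add: carrier_G)
  qed
  have tc: "has_tangent_map (Gm X) (\<lambda>t. Gconj X g (Gexp X (t *\<^sub>R \<xi>))) 0 (\<lambda>t. Adj X g (t *\<^sub>R \<xi>))"
    using mdiff_tangent[OF manifold_G _ exp_tangent, of "Gm X" "Gconj X g" \<xi>] Gconj by (simp add: exp_zero Adj_def)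
  have g1: "Gconj X g \<one>\<^bsub>Grp X\<^esub> = \<one>\<^bsub>Grp X\<^esub>" using g by (simp add: Gconj_def)
  have ga: "act X g a \<in> Qset X" using g a by simp
  have 1: "has_tangent_map (Qm X) (\<lambda>t. act X (Gconj X g (Gexp X (t *\<^sub>R \<xi>))) (act X g a)) 0
      (\<lambda>t. inf_gen X (Adj X g (t *\<^sub>R \<xi>)) (act X g a))"
    using mdiff_tangent[OF manifold_G _ tc, of "Qm X" "\<lambda>h. act X h (act X g a)"] mdiff_orbit_map[OF G.one_closed ga]
    by (simp add: exp_zero g1 inf_gen_tangent(2)[OF ga])
  have "act X (Gconj X g (Gexp X (t *\<^sub>R \<xi>))) (act X g a) = act X g (act X (Gexp X (t *\<^sub>R \<xi>)) a)" for t
    using g a exp_closed[of t \<xi>] by (simp add: Gconj_def act_mult)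
  moreover have "has_tangent_map (Qm X) (\<lambda>t. act X g (act X (Gexp X (t *\<^sub>R \<xi>)) a)) 0 (\<lambda>t. dact g a (t *\<^sub>R inf_gen X \<xi> a))"
    using mdiff_tangent[OF manifold_Q _ inf_gen_tangent(1)[OF a], of "Qm X" "act X g" \<xi>] mdiff_act[OF g a] a
    by (simp add: exp_zero)
  ultimately have "(\<lambda>t. inf_gen X (Adj X g (t *\<^sub>R \<xi>)) (act X g a)) = (\<lambda>t. dact g a (t *\<^sub>R inf_gen X \<xi> a))"
    using 1 by (simp add: has_tangent_map_unique)
  from fun_cong[OF this, of 1] show ?thesis by simp
qed

section \<open>The reduced equations\<close>

text \<open>
  The representatives of \<open>\<rho>(a, \<A>\<^sub>d(a, b))\<close> are the translates of \<open>(a, \<A>\<^sub>d(a, b))\<close>.  At the translate by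
  \<open>g\<close>, \<open>D2Ld_split\<close> for \<open>(g a, g b)\<close> gives the value, and equivariance makes it independent of \<open>g\<close>.
\<close>

lemma F_plus_eq:
  assumes ab: "(a, b) \<in> frakU X" and h: "h \<in> Hb X b"
  shows "F_plus X (rho X a (Adisc X a b)) (proj X b) (dproj X b h) =
    D2Ld X a b h - D3L X a (Adisc X a b) (proj X b) (dproj X b h)"
  unfolding F_plus_def rho_def
proof (rule the_elem_orbit[OF G.is_group])
  fix g assume g: "g \<in> carrier (Grp X)"
  note Q = frakU_memD[OF ab] and A = Adisc_closed[OF ab] and gab = frakU_act[OF ab g g]
  have F1: "F1_tilde X (act X g a) (Gconj X g (Adisc X a b)) (proj X b) = act X g b"
    using F1_tilde_equivariant[OF ab g A] by (simp add: F1_tilde_Adisc[OF ab])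
  show "(case QG_act X g (a, Adisc X a b) of (q0, w0) \<Rightarrow> let q1 = F1_tilde X q0 w0 (proj X b)
      in D2L X q0 w0 (proj X b) (D2A X q0 q1 (hlift X q1 (dproj X b h)))) =
    D2Ld X a b h - D3L X a (Adisc X a b) (proj X b) (dproj X b h)"
    using D2Ld_split[OF gab, of "dact g b h"] g Q A ab h
    by (simp add: QG_act_def Let_def F1 hlift_dproj_act Adisc_diag D2Ld_act dproj_act D3L_act)
qed

lemma F_minus_eq:
  assumes ab: "(a, b) \<in> frakU X" and h: "h \<in> Hb X a"
  shows "F_minus X (rho X a (Adisc X a b)) (proj X b) (dproj X a h) =
    D1Ld X a b h - D1L X a (Adisc X a b) (proj X b) h"
  unfolding F_minus_def rho_def
proof (rule the_elem_orbit[OF G.is_group])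
  fix g assume g: "g \<in> carrier (Grp X)"
  note Q = frakU_memD[OF ab] and A = Adisc_closed[OF ab] and gab = frakU_act[OF ab g g]
  have F1: "F1_tilde X (act X g a) (Gconj X g (Adisc X a b)) (proj X b) = act X g b"
    using F1_tilde_equivariant[OF ab g A] by (simp add: F1_tilde_Adisc[OF ab])
  show "(case QG_act X g (a, Adisc X a b) of (q0, w0) \<Rightarrow> let q1 = F1_tilde X q0 w0 (proj X b)
      in D2L X q0 w0 (proj X b) (D1A X q0 q1 (hlift X q0 (dproj X a h)))) =
    D1Ld X a b h - D1L X a (Adisc X a b) (proj X b) h"
    using D1Ld_split[OF gab, of "dact g a h"] g Q A ab h
    by (simp add: QG_act_def Let_def F1 hlift_dproj_act Adisc_diag D1Ld_act D1L_act)
qed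

lemma w_rep_act:
  assumes "(b, c) \<in> frakU X" "g \<in> carrier (Grp X)"
  shows "w_rep X (act X g b) (rho X b (Adisc X b c)) = Gconj X g (Adisc X b c)"
  using w_rep_eq[of "act X g b" "Gconj X g (Adisc X b c)"] assms frakU_memD[OF assms(1)] Adisc_closed[OF assms(1)]
  by simp

text \<open>
  In the forces, \<open>F_plus_eq\<close> and \<open>F_minus_eq\<close> subtract exactly the partial derivatives of \<open>L_check\<close> that
  \<open>\<phi>\<close> adds, and only the derivatives of \<open>L\<^sub>d\<close> remain.
\<close>

lemma phi_bar_eq:
  assumes ab: "(a, b) \<in> frakU X" and bc: "(b, c) \<in> frakU X" and h: "h \<in> Hb X b"
  shows "phi_bar X (rho X a (Adisc X a b)) (proj X b) (rho X b (Adisc X b c)) (proj X c) (dproj X b h) =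
    D2Ld X a b h + D1Ld X b c h"
  unfolding phi_bar_def rho_def[of X a]
proof (rule the_elem_orbit[OF G.is_group])
  fix g assume g: "g \<in> carrier (Grp X)"
  note Q = frakU_memD[OF ab] and A = Adisc_closed[OF ab] Adisc_closed[OF bc]
  have F1: "F1_tilde X (act X g a) (Gconj X g (Adisc X a b)) (proj X b) = act X g b"
    using F1_tilde_equivariant[OF ab g A(1)] by (simp add: F1_tilde_Adisc[OF ab])
  show "(case QG_act X g (a, Adisc X a b) of (q0, w0) \<Rightarrow>
      let q1 = F1_tilde X q0 w0 (proj X b); w1 = w_rep X q1 (rho X b (Adisc X b c))
      in D1L X q1 w1 (proj X c) (hlift X q1 (dproj X b h)) + D3L X q0 w0 (proj X b) (dproj X b h) +
        F_minus X (rho X b (Adisc X b c)) (proj X c) (dproj X b h) +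
        F_plus X (orbit (Grp X) (QG_act X) (a, Adisc X a b)) (proj X b) (dproj X b h)) =
    D2Ld X a b h + D1Ld X b c h"
    using g Q A h F_plus_eq[OF ab h] F_minus_eq[OF bc h]
    by (simp add: QG_act_def Let_def F1 w_rep_act[OF bc g] hlift_dproj_act D3L_act[OF g ab] D1L_act[OF g bc]
        flip: rho_def)
qed

text \<open>
  The momenta are \<open>D\<^sub>2L\<^sub>d(a, b)(\<xi>\<^sub>Q(b))\<close> and \<open>D\<^sub>2L\<^sub>d(b, c)(\<xi>\<^sub>Q(c))\<close>, and the latter is
  \<open>- D\<^sub>1L\<^sub>d(b, c)(\<xi>\<^sub>Q(b))\<close> by infinitesimal invariance of \<open>L\<^sub>d\<close>.
\<close>

lemma psi_bar_eq:
  assumes ab: "(a, b) \<in> frakU X" and bc: "(b, c) \<in> frakU X"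
  shows "psi_bar X (orbit (Grp X) (Q2_act X)
      (a, Adisc X a b, proj X b, rho X b (Adisc X b c), proj X c, \<xi>)) =
    D2Ld X a b (inf_gen X \<xi> b) + D1Ld X b c (inf_gen X \<xi> b)"
  unfolding psi_bar_def
proof (rule the_elem_orbit[OF G.is_group])
  fix g assume g: "g \<in> carrier (Grp X)"
  note Q = frakU_memD[OF ab] frakU_memD[OF bc] and A = Adisc_closed[OF ab] Adisc_closed[OF bc]
  have F1: "F1_tilde X (act X g a) (Gconj X g (Adisc X a b)) (proj X b) = act X g b"
    using F1_tilde_equivariant[OF ab g A(1)] by (simp add: F1_tilde_Adisc[OF ab])
  have r: "rtrans X (D2L X (act X g a') (Gconj X g (Adisc X a' b')) (proj X b')) (Gconj X g (Adisc X a' b')) (Adj X g \<xi>) =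
      D2Ld X a' b' (inf_gen X \<xi> b')" if "(a', b') \<in> frakU X" for a' b'
    using rtrans_D2L[OF frakU_act[OF that g g], of "Adj X g \<xi>"] that g frakU_memD[OF that]
    by (simp add: Adisc_diag inf_gen_Adj D2Ld_act)
  show "(case Q2_act X g (a, Adisc X a b, proj X b, rho X b (Adisc X b c), proj X c, \<xi>) of
      (q0, w0, r1, v1, r2, \<xi>1) \<Rightarrow> let q1 = F1_tilde X q0 w0 r1; w1 = w_rep X q1 v1
        in rtrans X (D2L X q0 w0 r1) w0 \<xi>1 - rtrans X (D2L X q1 w1 r2) w1 \<xi>1) =
    D2Ld X a b (inf_gen X \<xi> b) + D1Ld X b c (inf_gen X \<xi> b)"
    using Ld_inf_gen[OF Q(2,4), of \<xi>]
    by (simp add: Q2_act_def Let_def F1 w_rep_act[OF bc g] r[OF ab] r[OF bc])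
qed

text \<open>
  On the \<open>\<H>\<close>-component of \<open>\<delta>\<close> this is the first condition, on the \<open>\<S>\<close>-component, which is the value
  of an infinitesimal generator, the second one.
\<close>

lemma discrete_euler_lagrange:
  assumes ab: "(a, b) \<in> frakU X" and bc: "(b, c) \<in> frakU X"
    and 1: "first_condition X (rho X a (Adisc X a b)) (proj X b) (rho X b (Adisc X b c)) (proj X c)"
    and 2: "second_condition X (rho X a (Adisc X a b)) (proj X b) (rho X b (Adisc X b c)) (proj X c)"
    and \<delta>: "\<delta> \<in> Dc X b"
  shows "D2Ld X a b \<delta> + D1Ld X b c \<delta> = 0"
proof -
  note Q = frakU_memD[OF ab] frakU_memD(2)[OF bc]
  obtain s h where sh: "\<delta> = s + h" "s \<in> Sb X b" "h \<in> Hb X b"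
    using \<delta> unfolding direct_sum2D[OF splittings(1)[OF Q(2)]] by blast
  have "0 \<in> Sb X b"
    using kernel_dproj_vertical[OF Q(2) linear_0[OF linear_dproj[OF Q(2)]]] subspace_0[OF subspaces(4)[OF Q(2)]]
    by (simp add: Sb_def)
  \<comment> \<open>\<open>h = 0 + h\<close> is a sum of elements of \<open>\<S>\<close> and \<open>\<H>\<close>.\<close>
  then have hD: "h \<in> Dc X b"
    unfolding direct_sum2D[OF splittings(1)[OF Q(2)]] using sh(3) by force
  have "dproj X b h \<in> Dc_hat X (proj X b)" using hD by (simp add: Dc_hat_proj[OF Q(2)])
  then have h0: "D2Ld X a b h + D1Ld X b c h = 0"
    using 1 phi_bar_eq[OF ab bc sh(3)] by (simp add: first_condition_def)
  from sh(2) have sV: "s \<in> vertical X b" and sD: "s \<in> Dc X b" by (auto simp: Sb_def)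
  obtain \<xi> where \<xi>: "s = inf_gen X \<xi> b" by (rule vertical_imp_inf_gen[OF Q(2) sV])
  have "(b, \<xi>) \<in> gD X" using sD Q(2) by (simp add: gD_def \<xi>)
  then have "psi_bar X (orbit (Grp X) (Q2_act X)
      (a, Adisc X a b, proj X b, rho X b (Adisc X b c), proj X c, \<xi>)) = 0"
    using 2 rho_mem[OF Q(1) Adisc_closed[OF ab]] F1_tilde_Adisc[OF ab] unfolding second_condition_def by fastforce
  then have s0: "D2Ld X a b s + D1Ld X b c s = 0" by (simp add: psi_bar_eq[OF ab bc] \<xi>)
  show ?thesis using h0 s0 sh(1)
    by (simp add: linear_add[OF linear_D2Ld[OF Q(1,2)]] linear_add[OF linear_D1Ld[OF Q(2,3)]])
qed

section \<open>Reconstruction\<close>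

text \<open>
  Shifting the index in one of the two sums that make up \<open>dS\<^sub>d\<close> collects the two terms containing
  \<open>\<delta>\<^sub>k\<close>; the boundary terms vanish with \<open>\<delta>\<^sub>0\<close> and \<open>\<delta>\<^sub>N\<close>.
\<close>

lemma trajectoryI:
  assumes q: "\<And>k. k < N \<Longrightarrow> (q k, q (Suc k)) \<in> Dd X \<inter> frakU X" and N: "N \<ge> 1"
    and el: "\<And>k \<delta>. Suc k < N \<Longrightarrow> \<delta> \<in> Dc X (q (Suc k)) \<Longrightarrow>
      D2Ld X (q k) (q (Suc k)) \<delta> + D1Ld X (q (Suc k)) (q (Suc (Suc k))) \<delta> = 0"
  shows "trajectory X N q"
proof -
  have qQ: "q k \<in> Qset X" if "k \<le> N" for k
  proof (cases "k < N")
    case True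
    then show ?thesis using frakU_memD(1) q by blast
  next
    case False
    then have "k = Suc (N - 1)" "N - 1 < N" using that N by auto
    then show ?thesis using frakU_memD(2) q by (metis IntD2)
  qed
  have "d_discrete_action X N q \<delta> = 0"
    if \<delta>: "\<delta> 0 = 0 \<and> \<delta> N = 0 \<and> (\<forall>k\<le>N. \<delta> k \<in> Dc X (q k))" for \<delta>
  proof -
    obtain M where M: "N = Suc M" using N by (cases N) auto
    have lin: "linear (D1Ld X (q 0) (q 1))" "linear (D2Ld X (q M) (q N))"
      using qQ M by (auto intro: linear_D1Ld linear_D2Ld)
    have "d_discrete_action X N q \<delta> =
        (\<Sum>k<Suc M. D1Ld X (q k) (q (Suc k)) (\<delta> k)) + (\<Sum>k<Suc M. D2Ld X (q k) (q (Suc k)) (\<delta> (Suc k)))"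
      using d_discrete_action_eq[OF system, where N = N and q = q and \<delta> = \<delta>] qQ M by (simp add: sum.distrib)
    also have "(\<Sum>k<Suc M. D1Ld X (q k) (q (Suc k)) (\<delta> k)) =
        D1Ld X (q 0) (q 1) (\<delta> 0) + (\<Sum>k<M. D1Ld X (q (Suc k)) (q (Suc (Suc k))) (\<delta> (Suc k)))"
      by (subst sum.lessThan_Suc_shift) simp
    also have "(\<Sum>k<Suc M. D2Ld X (q k) (q (Suc k)) (\<delta> (Suc k))) =
        (\<Sum>k<M. D2Ld X (q k) (q (Suc k)) (\<delta> (Suc k))) + D2Ld X (q M) (q N) (\<delta> N)"
      by (simp add: M)
    also have "D1Ld X (q 0) (q 1) (\<delta> 0) = 0" using \<delta> linear_0[OF lin(1)] by simp
    also have "D2Ld X (q M) (q N) (\<delta> N) = 0" using \<delta> linear_0[OF lin(2)] by simp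
    finally have "d_discrete_action X N q \<delta> =
        (\<Sum>k<M. D2Ld X (q k) (q (Suc k)) (\<delta> (Suc k)) + D1Ld X (q (Suc k)) (q (Suc (Suc k))) (\<delta> (Suc k)))"
      by (simp add: sum.distrib)
    also have "\<dots> = 0"
      by (rule sum.neutral) (use el \<delta> M in auto)
    finally show ?thesis .
  qed
  then show ?thesis using q qQ unfolding trajectory_def by blast
qed

text \<open>
  The lift of \<open>(v, r)\<close> that starts at \<open>c\<close> is unique: its group element is determined by \<open>v = \<rho>(c, u)\<close>,
  by freeness of the action, and then its end point by \<open>u\<close> and \<open>r\<close>.
\<close>

lemma reconstruction_step:
  assumes vr: "(v, r) \<in> Dd_hat X" and p: "pQG X v = proj X c" and c: "c \<in> Qset X"
    and q': "q' \<in> Qset X" and w': "w' \<in> carrier (Grp X)" and v: "v = rho X q' w'"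
  defines "u \<equiv> Gconj X (tau X c q') w'"
  shows "u \<in> carrier (Grp X)" "(c, F1_tilde X c u r) \<in> Dd X \<inter> frakU X"
    "u = Adisc X c (F1_tilde X c u r)" "v = rho X c u" "r = proj X (F1_tilde X c u r)"
proof -
  obtain c' where c': "(c, c') \<in> Dd X" "(c, c') \<in> frakU X" "v = rho X c (Adisc X c c')" "r = proj X c'"
    by (rule lift_step[OF vr p c])
  note A = Adisc_closed[OF c'(2)]
  have "rho X q' w' = rho X c (Adisc X c c')" using v c'(3) by simp
  then obtain g where g: "g \<in> carrier (Grp X)" "c = act X g q'" "Adisc X c c' = Gconj X g w'"
    using q' c w' A by (rule rho_eqD)
  have "tau X c q' = g" unfolding g(2) by (rule tau_eq[OF g(1) q'])
  then have u: "u = Adisc X c c'" using g(3) by (simp add: u_def)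
  have F1: "F1_tilde X c u r = c'" unfolding u c'(4) by (rule F1_tilde_Adisc[OF c'(2)])
  show "u \<in> carrier (Grp X)" "(c, F1_tilde X c u r) \<in> Dd X \<inter> frakU X"
    "u = Adisc X c (F1_tilde X c u r)" "v = rho X c u" "r = proj X (F1_tilde X c u r)"
    unfolding F1 using c' A u by auto
qed

end

theorem theorem7p1:
  fixes X :: "('q, 'e::real_normed_vector, 'g, 'f::real_normed_vector, 'b::real_normed_vector) conn_system"
    and N :: nat
    and qbar0 qbar1 :: 'q
    and v :: "nat \<Rightarrow> ('q \<times> 'g) set"
    and r :: "nat \<Rightarrow> 'q set"
    and q qt :: "nat \<Rightarrow> 'q"
    and wt u :: "nat \<Rightarrow> 'g"
  assumes "nonholonomic_system X"
    and "symmetry_group X"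
    and "connection_data X"
    and "affine_discrete_connection X"
    and "N \<ge> 1"
    and "(qbar0, qbar1) \<in> Dd X \<inter> frakU X"
    and "\<forall>k<N. v k \<in> Gtilde X"
    and "\<forall>k\<le>N. r k \<in> mcarrier (Bm X)"
    and "\<forall>k<N. pQG X (v k) = r k"
    and "proj X qbar0 = r 0"
    and "proj X qbar1 = r 1"
    and "v 0 = rho X qbar0 (Adisc X qbar0 qbar1)"
    and "\<forall>k<N. (v k, r (Suc k)) \<in> Dd_hat X"
    and "\<forall>k. 1 \<le> k \<and> k \<le> N - 1 \<longrightarrow>
           first_condition X (v (k - 1)) (r k) (v k) (r (Suc k)) \<and>
           second_condition X (v (k - 1)) (r k) (v k) (r (Suc k))"
    and "\<forall>k<N. qt k \<in> Qset X \<and> wt k \<in> carrier (Grp X) \<and> v k = rho X (qt k) (wt k)"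
    and "q 0 = qbar0"
    and "\<forall>k<N. u k = Gconj X (tau X (q k) (qt k)) (wt k)"
    and "\<forall>k<N. q (Suc k) = F1_tilde X (q k) (u k) (r (Suc k))"
  shows "trajectory X N q \<and>
         (\<forall>k<N. Upsilon X (q k, q (Suc k)) = (v k, r (Suc k))) \<and>
         q 0 = qbar0 \<and> q 1 = qbar1 \<and>
         (\<forall>k<N. \<forall>q'\<in>Qset X. \<forall>w'\<in>carrier (Grp X). v k = rho X q' w' \<longrightarrow>
            u k \<in> carrier (Grp X) \<and> u k = Gconj X (tau X (q k) q') w')"
proof -
  interpret discrete_reduction X using assms(1-4) by unfold_locales
  have U01: "(qbar0, qbar1) \<in> frakU X" using assms(6) by simp
  have step: "(q k, q (Suc k)) \<in> Dd X \<inter> frakU X \<and> u k = Adisc X (q k) (q (Suc k)) \<and> u k \<in> carrier (Grp X) \<and>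
      v k = rho X (q k) (u k) \<and> r (Suc k) = proj X (q (Suc k))"
    if k: "k < N" and qk: "q k \<in> Qset X" "proj X (q k) = r k" for k
  proof -
    have uk: "u k = Gconj X (tau X (q k) (qt k)) (wt k)" using assms(17) k by simp
    have qS: "q (Suc k) = F1_tilde X (q k) (u k) (r (Suc k))" using assms(18) k by simp
    have "(v k, r (Suc k)) \<in> Dd_hat X" "pQG X (v k) = proj X (q k)" "qt k \<in> Qset X" "wt k \<in> carrier (Grp X)"
      "v k = rho X (qt k) (wt k)" using assms(13,9,15) k qk by simp_all
    note * = reconstruction_step[OF this(1,2) qk(1) this(3-5), folded uk, folded qS]
    then show ?thesis by simp
  qed
  have inv: "q k \<in> Qset X \<and> proj X (q k) = r k" if "k \<le> N" for k
    using that
  proof (induction k)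
    case 0
    then show ?case using assms(10,16) frakU_memD[OF U01] by simp
  next
    case (Suc k)
    then have *: "(q k, q (Suc k)) \<in> frakU X" "r (Suc k) = proj X (q (Suc k))" using step[of k] by auto
    then show ?case using frakU_memD(2)[OF *(1)] by simp
  qed
  note step = step[OF _ conjunct1[OF inv] conjunct2[OF inv]]
  have qU: "(q k, q (Suc k)) \<in> Dd X \<inter> frakU X" and uA: "u k = Adisc X (q k) (q (Suc k))"
    and uG: "u k \<in> carrier (Grp X)" and vk: "v k = rho X (q k) (Adisc X (q k) (q (Suc k)))"
    and rk: "r (Suc k) = proj X (q (Suc k))" if "k < N" for k
    using step[of k] that by auto
  have "trajectory X N q"
  proof (rule trajectoryI)
    show "(q k, q (Suc k)) \<in> Dd X \<inter> frakU X" if "k < N" for k using that by (rule qU)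
    show "N \<ge> 1" by (rule assms(5))
    fix k \<delta> assume k: "Suc k < N" and \<delta>: "\<delta> \<in> Dc X (q (Suc k))"
    then have k': "k < N" by simp
    have "first_condition X (v k) (r (Suc k)) (v (Suc k)) (r (Suc (Suc k)))"
      "second_condition X (v k) (r (Suc k)) (v (Suc k)) (r (Suc (Suc k)))"
      using assms(14)[rule_format, of "Suc k"] k by auto
    then show "D2Ld X (q k) (q (Suc k)) \<delta> + D1Ld X (q (Suc k)) (q (Suc (Suc k))) \<delta> = 0"
      using discrete_euler_lagrange[OF IntD2[OF qU[OF k']] IntD2[OF qU[OF k]] _ _ \<delta>]
      unfolding vk[OF k'] vk[OF k] rk[OF k'] rk[OF k] by simp
  qed
  moreover have "\<forall>k<N. Upsilon X (q k, q (Suc k)) = (v k, r (Suc k))"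
    by (simp add: Upsilon_def vk rk)
  moreover have "q 1 = qbar1"
  proof -
    have N0: "0 < N" using assms(5) by simp
    have "rho X qbar0 (Adisc X (q 0) (q 1)) = rho X qbar0 (Adisc X qbar0 qbar1)"
      using vk[OF N0] assms(12,16) by simp
    then have "w_rep X qbar0 (rho X qbar0 (u 0)) = w_rep X qbar0 (rho X qbar0 (Adisc X qbar0 qbar1))"
      using uA[OF N0] by simp
    then have "u 0 = Adisc X qbar0 qbar1"
      using w_rep_eq frakU_memD[OF U01] uG[OF N0] Adisc_closed[OF U01] by simp
    moreover have "q 1 = F1_tilde X qbar0 (u 0) (proj X qbar1)" using assms(18) N0 assms(11,16) by simp
    ultimately show ?thesis using F1_tilde_Adisc[OF U01] by simp
  qed
  moreover have "u k \<in> carrier (Grp X) \<and> u k = Gconj X (tau X (q k) q') w'"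
    if "k < N" "q' \<in> Qset X" "w' \<in> carrier (Grp X)" "v k = rho X q' w'" for k q' w'
  proof -
    have qk: "q k \<in> Qset X" "pQG X (v k) = proj X (q k)" using inv[of k] assms(9) that by auto
    have vr: "(v k, r (Suc k)) \<in> Dd_hat X" using assms(13)[rule_format, OF that(1)] .
    note R = reconstruction_step[OF vr qk(2,1) that(2-4)]
    have "rho X (q k) (u k) = rho X (q k) (Gconj X (tau X (q k) q') w')" using R(4) step[of k] that by simp
    then have "w_rep X (q k) (rho X (q k) (u k)) = w_rep X (q k) (rho X (q k) (Gconj X (tau X (q k) q') w'))" by simp
    then show ?thesis using w_rep_eq[OF qk(1)] uG[OF that(1)] R(1) by simp
  qed
  ultimately show ?thesis using assms(16) by blast
qed

end
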